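(* Let $X$ be a separable Hilbert space. Let $\omega:(0,\infty)\to(0,\infty)$ be a non-decreasing function such that $\lim_{t\to 0}\omega(t)=0$, $\lim_{t\to\infty}\omega(t)=\infty$, $\lim_{t\to 0}t/\omega(t)=0$, and, for some constant $C_{\mathrm{db}}>1$, $\omega(2t)\le C_{\mathrm{db}}\,\omega(t)$ for all $t\in(0,\infty)$. Then: (i) $\overline{C^\infty(X)\cap\mathrm{Lip}(X)\cap\dot C^{0,\omega}(X)}^{\,\dot C^{0,\omega}(X)}=\dot{\mathrm{VC}}^{0,\omega}_{\mathrm{small}}(X)$; (ii) $\overline{C^\infty_{\mathrm{bs}}(X)\cap\mathrm{Lip}(X)}^{\,\dot C^{0,\omega}(X)}=\dot{\mathrm{VC}}^{0,\omega}(X)$.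
   Context: All function classes consist of real-valued functions on $X$. $\dot C^{0,\omega}(X)$ is the set of $f:X\to\mathbb R$ with $\|f\|_{\dot C^{0,\omega}(X)}:=\sup_{x\ne y}\frac{|f(x)-f(y)|}{\omega(\|x-y\|)}<\infty$. For $x\neq y$ put $\mathrm{osc}^\omega_{(x,y)}(f)=\frac{|f(x)-f(y)|}{\omega(\|x-y\|)}$, and for $\delta>0$ put $\mathrm{osc}^\omega_\delta(f)=\sup\{\mathrm{osc}^\omega_{(x,y)}(f): x,y\in X,\ \|x-y\|=\delta\}$. Define $\dot{\mathrm{VC}}^{0,\omega}_{\mathrm{small}}(X)=\{f\in\dot C^{0,\omega}(X):\lim_{\delta\to0}\mathrm{osc}^\omega_\delta(f)=0\}$, $\dot{\mathrm{VC}}^{0,\omega}_{\mathrm{large}}(X)=\{f\in\dot C^{0,\omega}(X):\lim_{\delta\to\infty}\mathrm{osc}^\omega_\delta(f)=0\}$, $\dot{\mathrm{VC}}^{0,\omega}_{\mathrm{far}}(X)=\{f\in\dot C^{0,\omega}(X):\lim_{\delta\to\infty}\sup_{x\ne y,\ \min(\|x\|,\|y\|)>\delta}\mathrm{osc}^\omega_{(x,y)}(f)=0\}$, and $\dot{\mathrm{VC}}^{0,\omega}(X)$ as the intersection of these three sets. $\mathrm{Lip}(X)$ is the set of (not necessarily bounded) Lipschitz functions $X\to\mathbb R$. $C^\infty(X)$ is the set of functions $X\to\mathbb R$ with continuous Fréchet derivatives (over the real scalars) of all orders; $C^\infty_{\mathrm{bs}}(X)$ the subset of those with bounded support (vanishing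 outside some ball $B(0,R)$). For $\mathcal C\subset\dot C^{0,\omega}(X)$, $\overline{\mathcal C}^{\,\dot C^{0,\omega}(X)}$ is the set of $f\in\dot C^{0,\omega}(X)$ for which there is a sequence $(f_n)\subset\mathcal C$ with $\|f_n-f\|_{\dot C^{0,\omega}(X)}\to0$. *)

theory Defs
  imports "HOL-Analysis.Analysis"
begin

text \<open>
  Suprema are taken in \<^typ>\<open>ennreal\<close>, so that an infinite seminorm is admissible and the supremum
  of the empty set (which occurs if the space is trivial) is \<open>0\<close>.  The modulus \<open>w\<close> is
  a total function on the reals, but it is only ever evaluated at positive arguments.
\<close>

definition osc :: "(real \<Rightarrow> real) \<Rightarrow> ('a::real_normed_vector \<Rightarrow> real) \<Rightarrow> 'a \<Rightarrow> 'a \<Rightarrow> ennreal"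
  where "osc w f x y = ennreal (\<bar>f x - f y\<bar> / w (norm (x - y)))"

definition holder_seminorm :: "(real \<Rightarrow> real) \<Rightarrow> ('a::real_normed_vector \<Rightarrow> real) \<Rightarrow> ennreal"
  where "holder_seminorm w f = (SUP (x, y)\<in>{(x, y). x \<noteq> y}. osc w f x y)"

definition holder_space :: "(real \<Rightarrow> real) \<Rightarrow> ('a::real_normed_vector \<Rightarrow> real) set"
  where "holder_space w = {f. holder_seminorm w f < \<infinity>}"

definition osc_at_scale :: "(real \<Rightarrow> real) \<Rightarrow> ('a::real_normed_vector \<Rightarrow> real) \<Rightarrow> real \<Rightarrow> ennreal"
  where "osc_at_scale w f \<delta> = (SUP (x, y)\<in>{(x, y). norm (x - y) = \<delta>}. osc w f x y)"

definition osc_far :: "(real \<Rightarrow> real) \<Rightarrow> ('a::real_normed_vector \<Rightarrow> real) \<Rightarrow> real \<Rightarrow> ennreal"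
  where "osc_far w f \<delta> =
    (SUP (x, y)\<in>{(x, y). x \<noteq> y \<and> min (norm x) (norm y) > \<delta>}. osc w f x y)"

definition VC_small :: "(real \<Rightarrow> real) \<Rightarrow> ('a::real_normed_vector \<Rightarrow> real) set"
  where "VC_small w = {f \<in> holder_space w. (osc_at_scale w f \<longlongrightarrow> 0) (at_right 0)}"

definition VC_large :: "(real \<Rightarrow> real) \<Rightarrow> ('a::real_normed_vector \<Rightarrow> real) set"
  where "VC_large w = {f \<in> holder_space w. (osc_at_scale w f \<longlongrightarrow> 0) at_top}"

definition VC_far :: "(real \<Rightarrow> real) \<Rightarrow> ('a::real_normed_vector \<Rightarrow> real) set"
  where "VC_far w = {f \<in> holder_space w. (osc_far w f \<longlongrightarrow> 0) at_top}"

definition VC :: "(real \<Rightarrow> real) \<Rightarrow> ('a::real_normed_vector \<Rightarrow> real) set"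
  where "VC w = VC_small w \<inter> VC_large w \<inter> VC_far w"

definition holder_closure ::
  "(real \<Rightarrow> real) \<Rightarrow> ('a::real_normed_vector \<Rightarrow> real) set \<Rightarrow> ('a \<Rightarrow> real) set"
  where "holder_closure w \<C> = {f \<in> holder_space w.
    \<exists>F. (\<forall>n::nat. F n \<in> \<C>) \<and> (\<lambda>n. holder_seminorm w (\<lambda>x. F n x - f x)) \<longlonglongrightarrow> 0}"

definition Lip :: "('a::metric_space \<Rightarrow> real) set"
  where "Lip = {f. \<exists>L. L-lipschitz_on UNIV f}"

text \<open>
  The \<open>k\<close>-th Frechet derivative at a point is a bounded \<open>k\<close>-linear form.  As the types
  of iterated spaces of bounded linear maps depend on \<open>k\<close>, such forms are represented uniformly as
  functions on lists, of which only the values on lists of length \<open>k\<close> matter.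
\<close>

definition bounded_multilinear :: "nat \<Rightarrow> ('a::real_normed_vector list \<Rightarrow> real) \<Rightarrow> bool"
  where "bounded_multilinear k T \<longleftrightarrow>
    (\<forall>vs i. length vs = k \<and> i < k \<longrightarrow> linear (\<lambda>v. T (vs[i := v]))) \<and>
    (\<exists>C. \<forall>vs. length vs = k \<longrightarrow> \<bar>T vs\<bar> \<le> C * (\<Prod>v\<leftarrow>vs. norm v))"

definition multilinear_norm :: "nat \<Rightarrow> ('a::real_normed_vector list \<Rightarrow> real) \<Rightarrow> real"
  where "multilinear_norm k T = (SUP vs\<in>{vs. length vs = k \<and> (\<forall>v\<in>set vs. norm v \<le> 1)}. \<bar>T vs\<bar>)"

text \<open>
  \<open>D k x\<close> is the \<open>k\<close>-th derivative of \<open>f\<close> at \<open>x\<close>.  The third condition says that \<open>D k\<close> is Frechet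
  differentiable at \<open>x\<close> as a map into the normed space of bounded \<open>k\<close>-linear forms, where
  the derivative \<open>h \<mapsto> (vs \<mapsto> D (Suc k) x (h # vs))\<close> is identified with a bounded
  \<open>(k + 1)\<close>-linear form in the usual way; the fourth that \<open>D k\<close> is continuous into that space.
\<close>

definition smooth :: "('a::real_normed_vector \<Rightarrow> real) set"
  where "smooth = {f. \<exists>D :: nat \<Rightarrow> 'a \<Rightarrow> 'a list \<Rightarrow> real.
    (\<forall>x. D 0 x [] = f x) \<and>
    (\<forall>k x. bounded_multilinear k (D k x)) \<and>
    (\<forall>k x. ((\<lambda>h. multilinear_norm k (\<lambda>vs. D k (x + h) vs - D k x vs - D (Suc k) x (h # vs)) / norm h)
        \<longlongrightarrow> 0) (at 0)) \<and>
    (\<forall>k x. ((\<lambda>y. multilinear_norm k (\<lambda>vs. D k y vs - D k x vs)) \<longlongrightarrow> 0) (at x))}"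

definition smooth_bs :: "('a::real_normed_vector \<Rightarrow> real) set"
  where "smooth_bs = {f \<in> smooth. \<exists>R>0. \<forall>x. x \<notin> ball 0 R \<longrightarrow> f x = 0}"

end

theory Submission
  imports Defs
begin

text \<open>
  A function with vanishing small-scale oscillation is first replaced by its infimal convolution with
  a steep cone; this is Lipschitz, uniformly close at the right scale, and inherits every modulus of
  continuity.  A Lipschitz function \<open>f\<close> on a separable Hilbert space is then made smooth in two steps.
  Averaging \<open>f\<close> along each vector of an orthonormal basis, over lengths decreasing geometrically, gives
  a Lipschitz function \<open>F\<close> that is smooth along every finite-dimensional section.  The map
  \<open>x \<mapsto> \<Sum>\<^sub>i \<chi>\<^sub>i(x) \<langle>x, e\<^sub>i\<rangle> e\<^sub>i\<close>, where the smooth cutoff \<open>\<chi>\<^sub>i\<close> vanishes as soon as the tail of \<open>x\<close> from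
  index \<open>i\<close> on is small, takes values in finite-dimensional sections locally, is uniformly close to the
  identity, and has a Lipschitz constant independent of the closeness.  The composition of \<open>F\<close> with
  this map is smooth, and since its Lipschitz constant stays bounded while it converges uniformly
  to \<open>f\<close>, it converges in the seminorm because \<open>t / \<omega>(t) \<longrightarrow> 0\<close>.
  For bounded support, a function is beforehand clamped between two slowly decreasing cones.
\<close>

subsection \<open>Families with locally bounded directional derivatives\<close>

text \<open>An infinite-dimensional space has no translation-invariant measure to convolve with, so
  smoothing has to happen one direction at a time. This gains derivatives along finitely many
  averaged directions at once, but not Frechet smoothness; hence the point of evaluation must,
  locally, move only along finitely many of these directions, with smooth coordinates. A
  displacement along an averaged direction can be passed from the merely Lipschitz function to the
  smooth kernel (\<open>smear_shift\<close>), which is the only source of derivatives.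

  Uniform closeness alone does not control the seminorm. Below some distance d the Lipschitz
  constants are compared with w(t) / t, and above it the uniform error is compared with w(d). So d
  depends on the Lipschitz constants, and the admissible error depends on d; a retraction that
  became steeper as it approached the identity would make this circular.

  The inclusions of the closures in the vanishing classes only use that these classes are closed in
  the seminorm and contain the approximants.\<close>

text \<open>
  Working with sets of functions instead of single functions keeps the derivatives of all orders in
  one type: the derivatives of a family in the directions of the unit ball form again a family.
\<close>

fun bdd_deriv :: "nat \<Rightarrow> 'a::real_normed_vector set \<Rightarrow> ('a \<Rightarrow> real) set \<Rightarrow> bool" where
  "bdd_deriv 0 U A \<longleftrightarrow> (\<forall>x\<in>U. \<exists>C. \<forall>\<^sub>F y in nhds x. \<forall>f\<in>A. \<bar>f y\<bar> \<le> C)"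
| "bdd_deriv (Suc k) U A \<longleftrightarrow> bdd_deriv 0 U A \<and>
    (\<exists>B. bdd_deriv k U B \<and> (\<forall>f\<in>A. \<forall>v. norm v \<le> 1 \<longrightarrow>
      (\<exists>g\<in>B. \<forall>x\<in>U. ((\<lambda>t. f (x + t *\<^sub>R v)) has_real_derivative g x) (at 0))))"

lemma bdd_deriv_imp_0: "bdd_deriv k U A \<Longrightarrow> bdd_deriv 0 U A"
  by (cases k) auto

lemma eventually_line:
  fixes x v :: "'a::real_normed_vector"
  assumes "open U" "x \<in> U"
  shows "\<forall>\<^sub>F t in nhds 0. x + t *\<^sub>R v \<in> U"
proof -
  have "((\<lambda>t::real. x + t *\<^sub>R v) \<longlongrightarrow> x + 0 *\<^sub>R v) (nhds 0)"
    by (intro tendsto_intros filterlim_ident)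
  then show ?thesis
    using assms by (auto simp: tendsto_def)
qed

lemma line_derivative_cong:
  fixes x v :: "'a::real_normed_vector"
  assumes "open U" "x \<in> U" "\<And>y. y \<in> U \<Longrightarrow> f y = g y"
  shows "((\<lambda>t. f (x + t *\<^sub>R v)) has_real_derivative D) (at 0) \<longleftrightarrow>
    ((\<lambda>t. g (x + t *\<^sub>R v)) has_real_derivative D) (at 0)"
  by (rule DERIV_cong_ev) (use eventually_line[OF assms(1,2), of v] assms(3) in \<open>auto elim: eventually_mono\<close>)

lemma line_derivative_shift:
  fixes x v :: "'a::real_normed_vector"
  assumes "((\<lambda>t. f ((x + s *\<^sub>R v) + t *\<^sub>R v)) has_real_derivative D) (at 0)"
  shows "((\<lambda>t. f (x + t *\<^sub>R v)) has_real_derivative D) (at s)"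
proof -
  have "((\<lambda>t. f (x + (t + s) *\<^sub>R v)) has_real_derivative D) (at 0)"
    using assms by (simp add: algebra_simps)
  then show ?thesis
    using DERIV_shift[of "\<lambda>t. f (x + t *\<^sub>R v)" D 0 s] by simp
qed

lemma bdd_deriv_cong_0:
  assumes "open U" "bdd_deriv 0 U A" "\<And>f'. f' \<in> A' \<Longrightarrow> \<exists>f\<in>A. \<forall>x\<in>U. f' x = f x"
  shows "bdd_deriv 0 U A'"
  unfolding bdd_deriv.simps
proof
  fix x assume x: "x \<in> U"
  then obtain C where C: "\<forall>\<^sub>F y in nhds x. \<forall>f\<in>A. \<bar>f y\<bar> \<le> C"
    using assms(2) by auto
  have "\<forall>\<^sub>F y in nhds x. y \<in> U"
    using assms(1) x eventually_nhds by blast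
  with C have "\<forall>\<^sub>F y in nhds x. \<forall>f\<in>A'. \<bar>f y\<bar> \<le> C"
    by eventually_elim (use assms(3) in force)
  then show "\<exists>C. \<forall>\<^sub>F y in nhds x. \<forall>f\<in>A'. \<bar>f y\<bar> \<le> C"
    by blast
qed

text \<open>Members of a family are total functions, but only their values on \<open>U\<close> carry
  information. Since \<open>U\<close> is open, derivatives along lines at points of \<open>U\<close>
  depend on these values only.\<close>

lemma bdd_deriv_cong:
  assumes "open U" "bdd_deriv k U A" "\<And>f'. f' \<in> A' \<Longrightarrow> \<exists>f\<in>A. \<forall>x\<in>U. f' x = f x"
  shows "bdd_deriv k U A'"
  using assms(2,3)
proof (induction k arbitrary: A A')
  case 0
  then show ?case
    using bdd_deriv_cong_0[OF assms(1)] by blast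
next
  case (Suc k)
  from Suc.prems(1) obtain B where B: "bdd_deriv k U B" and
    d: "\<And>f v. f \<in> A \<Longrightarrow> norm v \<le> 1 \<Longrightarrow>
      \<exists>g\<in>B. \<forall>x\<in>U. ((\<lambda>t. f (x + t *\<^sub>R v)) has_real_derivative g x) (at 0)"
    unfolding bdd_deriv.simps by auto
  have 0: "bdd_deriv 0 U A'"
  proof -
    have "bdd_deriv 0 U A" using Suc.prems(1) by auto
    then show ?thesis
      using bdd_deriv_cong_0[OF assms(1)] Suc.prems(2) by blast
  qed
  have "\<exists>g\<in>B. \<forall>x\<in>U. ((\<lambda>t. f' (x + t *\<^sub>R v)) has_real_derivative g x) (at 0)"
    if "f' \<in> A'" "norm v \<le> 1" for f' v
  proof -
    have "\<exists>f\<in>A. \<forall>x\<in>U. f' x = f x"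
      by (rule Suc.prems) (rule \<open>f' \<in> A'\<close>)
    then obtain f where f: "f \<in> A" "\<forall>x\<in>U. f' x = f x"
      by blast
    obtain g where "g \<in> B" "\<forall>x\<in>U. ((\<lambda>t. f (x + t *\<^sub>R v)) has_real_derivative g x) (at 0)"
      using d[OF f(1) \<open>norm v \<le> 1\<close>] by blast
    then show ?thesis
      using line_derivative_cong[OF assms(1), of _ f' f] f(2) by blast
  qed
  with 0 B show ?case by auto
qed

lemma bdd_deriv_mono: "open U \<Longrightarrow> bdd_deriv k U A \<Longrightarrow> A' \<subseteq> A \<Longrightarrow> bdd_deriv k U A'"
  by (rule bdd_deriv_cong) auto

lemma bdd_deriv_SucD: "bdd_deriv (Suc k) U A \<Longrightarrow> bdd_deriv k U A"
proof (induction k arbitrary: A)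
  case (Suc k)
  then obtain B where "bdd_deriv (Suc k) U B" "\<forall>f\<in>A. \<forall>v. norm v \<le> 1 \<longrightarrow>
      (\<exists>g\<in>B. \<forall>x\<in>U. ((\<lambda>t. f (x + t *\<^sub>R v)) has_real_derivative g x) (at 0))"
    using bdd_deriv.simps(2)[of "Suc k" U A] by blast
  moreover have "bdd_deriv 0 U A"
    using Suc.prems by (rule bdd_deriv_imp_0)
  ultimately show ?case
    using Suc.IH bdd_deriv.simps(2)[of k U A] by blast
qed auto

lemma bdd_deriv_subset_domain:
  assumes "bdd_deriv k U A" "V \<subseteq> U"
  shows "bdd_deriv k V A"
  using assms(1)
proof (induction k arbitrary: A)
  case 0
  then show ?case using assms(2) by auto
next
  case (Suc k)
  from Suc.prems obtain B where B: "bdd_deriv k U B" and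
    d: "\<And>f v. f \<in> A \<Longrightarrow> norm v \<le> 1 \<Longrightarrow>
      \<exists>g\<in>B. \<forall>x\<in>U. ((\<lambda>t. f (x + t *\<^sub>R v)) has_real_derivative g x) (at 0)"
    unfolding bdd_deriv.simps by auto
  have "bdd_deriv 0 V A"
    using Suc.prems assms(2) by auto
  moreover have "\<exists>g\<in>B. \<forall>x\<in>V. ((\<lambda>t. f (x + t *\<^sub>R v)) has_real_derivative g x) (at 0)"
    if "f \<in> A" "norm v \<le> 1" for f v
    using d[OF that] assms(2) by blast
  ultimately show ?case
    using Suc.IH[OF B] by auto
qed

text \<open>The derivative families found on different neighbourhoods need not consist of the same
  functions. \<open>deriv\<close> provides one global candidate for each function and direction, and
  uniqueness of derivatives makes it agree with every local choice.\<close>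

lemma bdd_deriv_local:
  assumes "\<And>x. x \<in> U \<Longrightarrow> \<exists>V. open V \<and> x \<in> V \<and> bdd_deriv k V A"
  shows "bdd_deriv k U A"
  using assms
proof (induction k arbitrary: A)
  case 0
  then show ?case unfolding bdd_deriv.simps by blast
next
  case (Suc k)
  let ?D = "\<lambda>f v x. deriv (\<lambda>t. f (x + t *\<^sub>R v)) (0::real)"
  define B where "B = {?D f v | f v. f \<in> A \<and> norm v \<le> 1}"
  have *: "\<exists>V. open V \<and> x \<in> V \<and> bdd_deriv k V B \<and> (\<forall>f\<in>A. \<forall>v. norm v \<le> 1 \<longrightarrow>
    ((\<lambda>t. f (x + t *\<^sub>R v)) has_real_derivative ?D f v x) (at 0))" if "x \<in> U" for x
  proof -
    obtain V where V: "open V" "x \<in> V" "bdd_deriv (Suc k) V A"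
      using Suc.prems[OF \<open>x \<in> U\<close>] by blast
    from V(3) obtain B' where B': "bdd_deriv k V B'" and
      d: "\<And>f v. f \<in> A \<Longrightarrow> norm v \<le> 1 \<Longrightarrow>
        \<exists>g\<in>B'. \<forall>x\<in>V. ((\<lambda>t. f (x + t *\<^sub>R v)) has_real_derivative g x) (at 0)"
      unfolding bdd_deriv.simps by auto
    have "bdd_deriv k V B"
    proof (rule bdd_deriv_cong[OF V(1) B'])
      fix f' assume "f' \<in> B"
      then obtain f v where "f \<in> A" "norm v \<le> 1" "f' = ?D f v"
        by (auto simp: B_def)
      with d[of f v] show "\<exists>f\<in>B'. \<forall>x\<in>V. f' x = f x"
        using DERIV_imp_deriv by blast
    qed
    moreover have "((\<lambda>t. f (x + t *\<^sub>R v)) has_real_derivative ?D f v x) (at 0)"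
      if "f \<in> A" "norm v \<le> 1" for f v
      using d[OF that] V(2) DERIV_imp_deriv by metis
    ultimately show ?thesis using V by blast
  qed
  have "bdd_deriv k U B"
    by (rule Suc.IH) (use * in blast)
  moreover have "bdd_deriv 0 U A"
    unfolding bdd_deriv.simps
  proof
    fix x assume "x \<in> U"
    then obtain V where "x \<in> V" "bdd_deriv 0 V A"
      using Suc.prems bdd_deriv_imp_0 by blast
    then show "\<exists>C. \<forall>\<^sub>F y in nhds x. \<forall>f\<in>A. \<bar>f y\<bar> \<le> C"
      by simp
  qed
  moreover have "\<forall>f\<in>A. \<forall>v. norm v \<le> 1 \<longrightarrow>
      (\<exists>g\<in>B. \<forall>x\<in>U. ((\<lambda>t. f (x + t *\<^sub>R v)) has_real_derivative g x) (at 0))"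
  proof (intro ballI allI impI)
    fix f and v :: 'a assume fv: "f \<in> A" "norm v \<le> 1"
    then have "((\<lambda>t. f (x + t *\<^sub>R v)) has_real_derivative ?D f v x) (at 0)" if "x \<in> U" for x
      using *[OF that] by blast
    moreover have "?D f v \<in> B"
      using fv by (auto simp: B_def)
    ultimately show "\<exists>g\<in>B. \<forall>x\<in>U. ((\<lambda>t. f (x + t *\<^sub>R v)) has_real_derivative g x) (at 0)"
      by (intro bexI[of _ "?D f v"] ballI)
  qed
  ultimately show ?case by auto
qed

lemma bdd_deriv_const: "bdd_deriv k U {\<lambda>x. c | c. \<bar>c\<bar> \<le> C}"
proof (induction k arbitrary: C)
  case 0
  show ?case
    unfolding bdd_deriv.simps
  proof
    fix x :: 'a
    have "\<forall>\<^sub>F y in nhds x. \<forall>f\<in>{\<lambda>x. c | c. \<bar>c\<bar> \<le> C}. \<bar>f y\<bar> \<le> C"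
      by (rule always_eventually) auto
    then show "\<exists>C'. \<forall>\<^sub>F y in nhds x. \<forall>f\<in>{\<lambda>x. c | c. \<bar>c\<bar> \<le> C}. \<bar>f y\<bar> \<le> C'"
      by blast
  qed
next
  case (Suc k)
  have "bdd_deriv 0 U {\<lambda>x. c | c. \<bar>c\<bar> \<le> C}"
    by (rule bdd_deriv_imp_0[OF Suc.IH])
  moreover have "\<forall>f\<in>{\<lambda>x. c | c. \<bar>c\<bar> \<le> C}. \<forall>v. norm v \<le> 1 \<longrightarrow>
      (\<exists>g\<in>{\<lambda>x. c | c. \<bar>c\<bar> \<le> 0}. \<forall>x\<in>U. ((\<lambda>t. f (x + t *\<^sub>R v)) has_real_derivative g x) (at 0))"
    by auto
  ultimately show ?case using Suc.IH[of 0] bdd_deriv.simps(2) by blast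
qed

lemma bdd_deriv_add:
  assumes "bdd_deriv k U A" "bdd_deriv k U B"
  shows "bdd_deriv k U {\<lambda>x. f x + g x | f g. f \<in> A \<and> g \<in> B}"
  using assms
proof (induction k arbitrary: A B)
  case 0
  show ?case unfolding bdd_deriv.simps
  proof
    fix x assume "x \<in> U"
    then obtain C D where "\<forall>\<^sub>F y in nhds x. \<forall>f\<in>A. \<bar>f y\<bar> \<le> C" "\<forall>\<^sub>F y in nhds x. \<forall>f\<in>B. \<bar>f y\<bar> \<le> D"
      using 0 by fastforce
    then have "\<forall>\<^sub>F y in nhds x. \<forall>h\<in>{\<lambda>x. f x + g x | f g. f \<in> A \<and> g \<in> B}. \<bar>h y\<bar> \<le> C + D"
      by eventually_elim (auto, smt (verit))
    then show "\<exists>C. \<forall>\<^sub>F y in nhds x. \<forall>h\<in>{\<lambda>x. f x + g x | f g. f \<in> A \<and> g \<in> B}. \<bar>h y\<bar> \<le> C"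
      by blast
  qed
next
  case (Suc k)
  obtain A' where A': "bdd_deriv k U A'" and
    dA: "\<And>f v. f \<in> A \<Longrightarrow> norm v \<le> 1 \<Longrightarrow>
      \<exists>g\<in>A'. \<forall>x\<in>U. ((\<lambda>t. f (x + t *\<^sub>R v)) has_real_derivative g x) (at 0)"
    using Suc.prems(1) unfolding bdd_deriv.simps by auto
  obtain B' where B': "bdd_deriv k U B'" and
    dB: "\<And>f v. f \<in> B \<Longrightarrow> norm v \<le> 1 \<Longrightarrow>
      \<exists>g\<in>B'. \<forall>x\<in>U. ((\<lambda>t. f (x + t *\<^sub>R v)) has_real_derivative g x) (at 0)"
    using Suc.prems(2) unfolding bdd_deriv.simps by auto
  let ?S = "\<lambda>A B. {\<lambda>x. f x + g x | f g. f \<in> A \<and> g \<in> B}"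
  have 0: "bdd_deriv 0 U (?S A B)"
    by (rule bdd_deriv_imp_0[of k], rule Suc.IH) (use Suc.prems bdd_deriv_SucD in blast)+
  have "\<exists>d\<in>?S A' B'. \<forall>x\<in>U. ((\<lambda>t. h (x + t *\<^sub>R v)) has_real_derivative d x) (at 0)"
    if h: "h \<in> ?S A B" and v: "norm v \<le> 1" for h v
  proof -
    obtain f g where fg: "f \<in> A" "g \<in> B" "h = (\<lambda>x. f x + g x)"
      using h by blast
    obtain f' where f': "f' \<in> A'" "\<forall>x\<in>U. ((\<lambda>t. f (x + t *\<^sub>R v)) has_real_derivative f' x) (at 0)"
      using dA[OF fg(1) v] by blast
    obtain g' where g': "g' \<in> B'" "\<forall>x\<in>U. ((\<lambda>t. g (x + t *\<^sub>R v)) has_real_derivative g' x) (at 0)"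
      using dB[OF fg(2) v] by blast
    have "(\<lambda>x. f' x + g' x) \<in> ?S A' B'"
      using f' g' by blast
    moreover have "\<forall>x\<in>U. ((\<lambda>t. h (x + t *\<^sub>R v)) has_real_derivative f' x + g' x) (at 0)"
      unfolding fg(3) using f'(2) g'(2) by (intro ballI DERIV_add) auto
    ultimately show ?thesis
      by (intro bexI[of _ "\<lambda>x. f' x + g' x"])
  qed
  then show ?case
    unfolding bdd_deriv.simps(2) using 0 Suc.IH[OF A' B'] by (intro conjI exI[of _ "?S A' B'"] ballI allI impI)
qed

lemma bdd_deriv_mult:
  assumes "open U" "bdd_deriv k U A" "bdd_deriv k U B"
  shows "bdd_deriv k U {\<lambda>x. f x * g x | f g. f \<in> A \<and> g \<in> B}"
  using assms(2,3)
proof (induction k arbitrary: A B)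
  case 0
  show ?case unfolding bdd_deriv.simps
  proof
    fix x assume "x \<in> U"
    then obtain C D where "\<forall>\<^sub>F y in nhds x. \<forall>f\<in>A. \<bar>f y\<bar> \<le> C" "\<forall>\<^sub>F y in nhds x. \<forall>f\<in>B. \<bar>f y\<bar> \<le> D"
      using 0 by fastforce
    then have "\<forall>\<^sub>F y in nhds x. \<forall>h\<in>{\<lambda>x. f x * g x | f g. f \<in> A \<and> g \<in> B}. \<bar>h y\<bar> \<le> \<bar>C\<bar> * \<bar>D\<bar>"
    proof eventually_elim
      case (elim y)
      then show ?case
        by (auto simp: abs_mult intro!: mult_mono) force+
    qed
    then show "\<exists>C. \<forall>\<^sub>F y in nhds x. \<forall>h\<in>{\<lambda>x. f x * g x | f g. f \<in> A \<and> g \<in> B}. \<bar>h y\<bar> \<le> C"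
      by blast
  qed
next
  case (Suc k)
  obtain A' where A': "bdd_deriv k U A'" and
    dA: "\<And>f v. f \<in> A \<Longrightarrow> norm v \<le> 1 \<Longrightarrow>
      \<exists>g\<in>A'. \<forall>x\<in>U. ((\<lambda>t. f (x + t *\<^sub>R v)) has_real_derivative g x) (at 0)"
    using Suc.prems(1) unfolding bdd_deriv.simps by auto
  obtain B' where B': "bdd_deriv k U B'" and
    dB: "\<And>f v. f \<in> B \<Longrightarrow> norm v \<le> 1 \<Longrightarrow>
      \<exists>g\<in>B'. \<forall>x\<in>U. ((\<lambda>t. f (x + t *\<^sub>R v)) has_real_derivative g x) (at 0)"
    using Suc.prems(2) unfolding bdd_deriv.simps by auto
  let ?S = "\<lambda>A B. {\<lambda>x. f x + g x | f g. f \<in> A \<and> g \<in> B}"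
  let ?P = "\<lambda>A B. {\<lambda>x. f x * g x | f g. f \<in> A \<and> g \<in> B}"
  have k: "bdd_deriv k U A" "bdd_deriv k U B"
    using Suc.prems bdd_deriv_SucD by blast+
  have 0: "bdd_deriv 0 U (?P A B)"
    by (rule bdd_deriv_imp_0[OF Suc.IH[OF k]])
  have "\<exists>d\<in>?S (?P A' B) (?P A B'). \<forall>x\<in>U. ((\<lambda>t. h (x + t *\<^sub>R v)) has_real_derivative d x) (at 0)"
    if h: "h \<in> ?P A B" and v: "norm v \<le> 1" for h v
  proof -
    obtain f g where fg: "f \<in> A" "g \<in> B" "h = (\<lambda>x. f x * g x)"
      using h by blast
    obtain f' where f': "f' \<in> A'" "\<forall>x\<in>U. ((\<lambda>t. f (x + t *\<^sub>R v)) has_real_derivative f' x) (at 0)"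
      using dA[OF fg(1) v] by blast
    obtain g' where g': "g' \<in> B'" "\<forall>x\<in>U. ((\<lambda>t. g (x + t *\<^sub>R v)) has_real_derivative g' x) (at 0)"
      using dB[OF fg(2) v] by blast
    have "(\<lambda>x. f' x * g x + f x * g' x) \<in> ?S (?P A' B) (?P A B')"
      proof -
      have "(\<lambda>x. f' x * g x) \<in> ?P A' B" "(\<lambda>x. f x * g' x) \<in> ?P A B'"
        using f'(1) g'(1) fg(1,2) by blast+
      then show ?thesis
        unfolding mem_Collect_eq[where P="\<lambda>h. \<exists>f g. h = (\<lambda>x. f x + g x) \<and> f \<in> _ \<and> g \<in> _"]
        by (intro exI conjI) (rule refl)
    qed
    moreover have "\<forall>x\<in>U. ((\<lambda>t. h (x + t *\<^sub>R v)) has_real_derivative f' x * g x + f x * g' x) (at 0)"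
    proof
      fix x assume "x \<in> U"
      then show "((\<lambda>t. h (x + t *\<^sub>R v)) has_real_derivative f' x * g x + f x * g' x) (at 0)"
        unfolding fg(3)
        using DERIV_mult[of "\<lambda>t. f (x + t *\<^sub>R v)" "f' x" 0 UNIV "\<lambda>t. g (x + t *\<^sub>R v)" "g' x"] f' g'
        by (simp add: algebra_simps)
    qed
    ultimately show ?thesis
      by (intro bexI[of _ "\<lambda>x. f' x * g x + f x * g' x"])
  qed
  moreover have "bdd_deriv k U (?S (?P A' B) (?P A B'))"
    by (intro bdd_deriv_add Suc.IH A' B' k)
  ultimately show ?case
    unfolding bdd_deriv.simps(2) using 0
    by (intro conjI exI[of _ "?S (?P A' B) (?P A B')"] ballI allI impI)
qed

text \<open>\<open>H\<close> is a function together with all its derivatives. By the chain rule a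
  derivative of \<open>H n\<close> after \<open>f\<close> is a product of \<open>H (Suc n)\<close>
  after \<open>f\<close> with a derivative of \<open>f\<close>, so the induction on \<open>k\<close>
  must cover all \<open>n\<close> at once.\<close>

lemma bdd_deriv_compose:
  fixes H :: "nat \<Rightarrow> real \<Rightarrow> real"
  assumes "open U" and H: "\<And>n s. (H n has_real_derivative H (Suc n) s) (at s)"
    and "bdd_deriv k U A"
  shows "bdd_deriv k U {\<lambda>x. H n (f x) | f. f \<in> A}"
  using assms(3)
proof (induction k arbitrary: n)
  case 0
  show ?case unfolding bdd_deriv.simps
  proof
    fix x assume "x \<in> U"
    then obtain C where C: "\<forall>\<^sub>F y in nhds x. \<forall>f\<in>A. \<bar>f y\<bar> \<le> C"
      using 0 by fastforce
    \<comment> \<open>Compactness gives one bound for \<open>H n\<close> on the common range of all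
      members of the family near \<open>x\<close>.\<close>
    have "continuous_on {-C..C} (H n)"
      using H by (meson DERIV_isCont continuous_at_imp_continuous_on)
    then have "bounded (H n ` {-C..C})"
      by (intro compact_imp_bounded compact_continuous_image) auto
    then obtain D where D: "\<bar>H n s\<bar> \<le> D" if "s \<in> {-C..C}" for s
      unfolding bounded_iff by (metis imageI real_norm_def)
    from C have "\<forall>\<^sub>F y in nhds x. \<forall>h\<in>{\<lambda>x. H n (f x) | f. f \<in> A}. \<bar>h y\<bar> \<le> D"
      by eventually_elim (use D in \<open>fastforce simp: abs_le_iff\<close>)
    then show "\<exists>D. \<forall>\<^sub>F y in nhds x. \<forall>h\<in>{\<lambda>x. H n (f x) | f. f \<in> A}. \<bar>h y\<bar> \<le> D"
      by blast
  qed
next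
  case (Suc k)
  obtain A' where A': "bdd_deriv k U A'" and
    dA: "\<And>f v. f \<in> A \<Longrightarrow> norm v \<le> 1 \<Longrightarrow>
      \<exists>g\<in>A'. \<forall>x\<in>U. ((\<lambda>t. f (x + t *\<^sub>R v)) has_real_derivative g x) (at 0)"
    using Suc.prems(1) unfolding bdd_deriv.simps by auto
  let ?P = "\<lambda>A B. {\<lambda>x. f x * g x | f g. f \<in> A \<and> g \<in> B}"
  let ?C = "\<lambda>n. {\<lambda>x. H n (f x) | f. f \<in> A}"
  have IH: "bdd_deriv k U (?C n)" for n
    using Suc.IH Suc.prems bdd_deriv_SucD by blast
  have "\<exists>d\<in>?P (?C (Suc n)) A'. \<forall>x\<in>U. ((\<lambda>t. h (x + t *\<^sub>R v)) has_real_derivative d x) (at 0)"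
    if h: "h \<in> ?C n" and v: "norm v \<le> 1" for h v
  proof -
    obtain f where f: "f \<in> A" "h = (\<lambda>x. H n (f x))"
      using h by blast
    obtain f' where f': "f' \<in> A'" "\<forall>x\<in>U. ((\<lambda>t. f (x + t *\<^sub>R v)) has_real_derivative f' x) (at 0)"
      using dA[OF f(1) v] by blast
    have "(\<lambda>x. H (Suc n) (f x) * f' x) \<in> ?P (?C (Suc n)) A'"
    proof -
      have "(\<lambda>x. H (Suc n) (f x)) \<in> ?C (Suc n)"
        using f by blast
      then show ?thesis
        unfolding mem_Collect_eq[where P="\<lambda>h. \<exists>f g. h = (\<lambda>x. f x * g x) \<and> f \<in> _ \<and> g \<in> _"]
        using f' by (intro exI conjI) (rule refl)
    qed
    moreover have "\<forall>x\<in>U. ((\<lambda>t. h (x + t *\<^sub>R v)) has_real_derivative H (Suc n) (f x) * f' x) (at 0)"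
    proof
      fix x assume "x \<in> U"
      then show "((\<lambda>t. h (x + t *\<^sub>R v)) has_real_derivative H (Suc n) (f x) * f' x) (at 0)"
        unfolding f(2)
        using DERIV_chain2[of "H n" "H (Suc n) (f x)" "\<lambda>t. f (x + t *\<^sub>R v)" 0 "f' x" UNIV] f'(2) H
        by simp
    qed
    ultimately show ?thesis
      by (intro bexI[of _ "\<lambda>x. H (Suc n) (f x) * f' x"])
  qed
  moreover have "bdd_deriv k U (?P (?C (Suc n)) A')"
    by (intro bdd_deriv_mult assms(1) IH A')
  moreover have "bdd_deriv 0 U (?C n)"
    by (rule bdd_deriv_imp_0[OF IH])
  ultimately show ?case
    unfolding bdd_deriv.simps(2)
    by (intro conjI exI[of _ "?P (?C (Suc n)) A'"] ballI allI impI)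
qed

subsection \<open>Jets given by directional derivatives\<close>

text \<open>
  Locally bounded directional derivatives of all orders suffice: linearity in each
  argument and Frechet differentiability follow from the second-order Taylor estimate.
\<close>

locale directional_jet =
  fixes T :: "'a::real_normed_vector list \<Rightarrow> 'a \<Rightarrow> real"
  assumes deriv: "((\<lambda>t. T vs (x + t *\<^sub>R v)) has_real_derivative T (v # vs) x) (at 0)"
    and bdd: "\<exists>d>0. \<exists>C\<ge>0. \<forall>y\<in>ball x d. \<forall>vs. length vs = n \<longrightarrow> \<bar>T vs y\<bar> \<le> C * (\<Prod>v\<leftarrow>vs. norm v)"
begin

lemma deriv_at:
  "((\<lambda>t. T vs (x + t *\<^sub>R v)) has_real_derivative T (v # vs) (x + s *\<^sub>R v)) (at s)"
  by (rule line_derivative_shift, rule deriv)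

lemma mean_value: "\<exists>s. 0 < s \<and> s < 1 \<and> T vs (x + h) - T vs x = T (h # vs) (x + s *\<^sub>R h)"
  using MVT2[of 0 1 "\<lambda>t. T vs (x + t *\<^sub>R h)" "\<lambda>s. T (h # vs) (x + s *\<^sub>R h)"] deriv_at by auto

lemma segment_in_ball:
  fixes x y h :: 'a
  assumes "y \<in> ball x d" "y + h \<in> ball x d" "0 < s" "s < 1"
  shows "y + s *\<^sub>R h \<in> ball x d"
proof -
  have "(1 - s) *\<^sub>R y + s *\<^sub>R (y + h) \<in> ball x d"
    by (rule convexD[OF convex_ball]) (use assms in auto)
  then show ?thesis by (simp add: algebra_simps)
qed

lemma scale: "T (c *\<^sub>R v # vs) x = c * T (v # vs) x"
proof -
  have "((\<lambda>t. T vs (x + (t * c) *\<^sub>R v)) has_real_derivative T (v # vs) x * c) (at 0)"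
    by (rule DERIV_chain2[of "\<lambda>t. T vs (x + t *\<^sub>R v)" _ "\<lambda>t. t * c"])
      (auto intro!: derivative_eq_intros deriv)
  then show ?thesis
    using DERIV_unique[OF deriv[of vs x "c *\<^sub>R v"]] by simp
qed

lemma taylor:
  "\<exists>d>0. \<exists>C\<ge>0. \<forall>y\<in>ball x d. \<forall>h. y + h \<in> ball x d \<longrightarrow> (\<forall>vs. length vs = n \<longrightarrow>
    \<bar>T vs (y + h) - T vs y\<bar> \<le> C * norm h * (\<Prod>v\<leftarrow>vs. norm v) \<and>
    \<bar>T vs (y + h) - T vs y - T (h # vs) y\<bar> \<le> C * (norm h)\<^sup>2 * (\<Prod>v\<leftarrow>vs. norm v))"
proof -
  obtain d1 C1 where 1: "d1 > 0" "C1 \<ge> 0"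
    "\<And>y vs. y \<in> ball x d1 \<Longrightarrow> length vs = Suc n \<Longrightarrow> \<bar>T vs y\<bar> \<le> C1 * (\<Prod>v\<leftarrow>vs. norm v)"
    using bdd[of x "Suc n"] by blast
  obtain d2 C2 where 2: "d2 > 0" "C2 \<ge> 0"
    "\<And>y vs. y \<in> ball x d2 \<Longrightarrow> length vs = Suc (Suc n) \<Longrightarrow> \<bar>T vs y\<bar> \<le> C2 * (\<Prod>v\<leftarrow>vs. norm v)"
    using bdd[of x "Suc (Suc n)"] by blast
  define d where "d = min d1 d2"
  define C where "C = max C1 C2"
  have C: "C \<ge> 0" "C1 \<le> C" "C2 \<le> C"
    using 1 2 by (auto simp: C_def)
  have "\<bar>T vs (y + h) - T vs y\<bar> \<le> C * norm h * (\<Prod>v\<leftarrow>vs. norm v) \<and>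
    \<bar>T vs (y + h) - T vs y - T (h # vs) y\<bar> \<le> C * (norm h)\<^sup>2 * (\<Prod>v\<leftarrow>vs. norm v)"
    if y: "y \<in> ball x d" "y + h \<in> ball x d" and vs: "length vs = n" for y h vs
  proof -
    let ?p = "\<Prod>v\<leftarrow>vs. norm v"
    have p: "0 \<le> ?p" by (rule prod_list_nonneg) auto
    obtain s where s: "0 < s" "s < 1" "T vs (y + h) - T vs y = T (h # vs) (y + s *\<^sub>R h)"
      using mean_value by blast
    have m: "y + s *\<^sub>R h \<in> ball x d"
      using segment_in_ball y s by blast
    then have "\<bar>T (h # vs) (y + s *\<^sub>R h)\<bar> \<le> C1 * (norm h * ?p)"
      using 1(3)[of "y + s *\<^sub>R h" "h # vs"] vs by (simp add: d_def)
    also have "\<dots> \<le> C * (norm h * ?p)"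
      using C p by (intro mult_right_mono) auto
    finally have A: "\<bar>T vs (y + h) - T vs y\<bar> \<le> C * norm h * ?p"
      using s by (simp add: mult.assoc)
    obtain r where r: "0 < r" "r < 1"
      "T (h # vs) (y + s *\<^sub>R h) - T (h # vs) y = T (s *\<^sub>R h # h # vs) (y + r *\<^sub>R s *\<^sub>R h)"
      using mean_value by blast
    have "y + r *\<^sub>R s *\<^sub>R h \<in> ball x d"
      using segment_in_ball[OF y(1) m r(1,2)] .
    then have "\<bar>T (s *\<^sub>R h # h # vs) (y + r *\<^sub>R s *\<^sub>R h)\<bar> \<le> C2 * (norm (s *\<^sub>R h) * (norm h * ?p))"
      using 2(3)[of _ "s *\<^sub>R h # h # vs"] vs by (simp add: d_def)
    also have "\<dots> \<le> C * (norm h * (norm h * ?p))"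
      using C p s by (intro mult_mono mult_right_mono) (auto simp: mult_left_le_one_le)
    finally have "\<bar>T vs (y + h) - T vs y - T (h # vs) y\<bar> \<le> C * (norm h)\<^sup>2 * ?p"
      using s r by (simp add: power2_eq_square mult.assoc)
    with A show ?thesis by blast
  qed
  moreover have "d > 0" using 1 2 by (simp add: d_def)
  ultimately show ?thesis using C(1) by blast
qed

text \<open>The point x + t (v + w) is reached directly or by way of x + t v. Each of the three
  increments is linear up to O(t^2), and the derivative along \<open>w\<close> changes by O(t)
  between x and x + t v. Hence t times the defect of additivity is O(t^2); divide by t and let t
  tend to 0.\<close>

lemma add: "T ((v + w) # vs) x = T (v # vs) x + T (w # vs) x"
proof -
  let ?n = "length vs" and ?p = "\<Prod>v\<leftarrow>vs. norm v"
  obtain d1 C1 where 1: "d1 > 0" "C1 \<ge> 0"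
    "\<And>y h. y \<in> ball x d1 \<Longrightarrow> y + h \<in> ball x d1 \<Longrightarrow>
      \<bar>T vs (y + h) - T vs y - T (h # vs) y\<bar> \<le> C1 * (norm h)\<^sup>2 * ?p"
    using taylor[of x ?n] by blast
  obtain d2 C2 where 2: "d2 > 0" "C2 \<ge> 0"
    "\<And>y h. y \<in> ball x d2 \<Longrightarrow> y + h \<in> ball x d2 \<Longrightarrow>
      \<bar>T (w # vs) (y + h) - T (w # vs) y\<bar> \<le> C2 * norm h * (norm w * ?p)"
    using taylor[of x "Suc ?n"] by (metis length_Cons list.simps(9) prod_list.Cons)
  define a where "a = T ((v + w) # vs) x - T (v # vs) x - T (w # vs) x"
  define K where "K = C1 * (norm (v + w))\<^sup>2 * ?p + C1 * (norm v)\<^sup>2 * ?p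
    + C1 * (norm w)\<^sup>2 * ?p + C2 * norm v * (norm w * ?p)"
  have K: "\<bar>a\<bar> \<le> K * t"
    if t: "0 < t" "t * norm v < min d1 d2" "t * norm (v + w) < min d1 d2" for t
  proof -
    have in1: "x \<in> ball x d1" "x + t *\<^sub>R v \<in> ball x d1" "x + t *\<^sub>R (v + w) \<in> ball x d1"
      and in2: "x \<in> ball x d2" "x + t *\<^sub>R v \<in> ball x d2"
      using t 1 2 by (auto simp: dist_norm)
    have e: "x + t *\<^sub>R v + t *\<^sub>R w = x + t *\<^sub>R (v + w)"
      by (simp add: algebra_simps)
    have a1: "\<bar>T vs (x + t *\<^sub>R (v + w)) - T vs x - t * T ((v + w) # vs) x\<bar> \<le> t\<^sup>2 * (C1 * (norm (v + w))\<^sup>2 * ?p)"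
      using 1(3)[OF in1(1,3)] by (simp add: scale power_mult_distrib mult_ac)
    have a2: "\<bar>T vs (x + t *\<^sub>R v) - T vs x - t * T (v # vs) x\<bar> \<le> t\<^sup>2 * (C1 * (norm v)\<^sup>2 * ?p)"
      using 1(3)[OF in1(1,2)] by (simp add: scale power_mult_distrib mult_ac)
    have a3: "\<bar>T vs (x + t *\<^sub>R (v + w)) - T vs (x + t *\<^sub>R v) - t * T (w # vs) (x + t *\<^sub>R v)\<bar>
        \<le> t\<^sup>2 * (C1 * (norm w)\<^sup>2 * ?p)"
      using 1(3)[OF in1(2), of "t *\<^sub>R w"] in1(3) unfolding e by (simp add: scale power_mult_distrib mult_ac)
    have "\<bar>T (w # vs) (x + t *\<^sub>R v) - T (w # vs) x\<bar> \<le> t * (C2 * norm v * (norm w * ?p))"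
      using 2(3)[OF in2] t(1) by (simp add: mult_ac)
    then have "t * \<bar>T (w # vs) (x + t *\<^sub>R v) - T (w # vs) x\<bar> \<le> t * (t * (C2 * norm v * (norm w * ?p)))"
      using t(1) by (intro mult_left_mono) auto
    then have a4: "\<bar>t * T (w # vs) (x + t *\<^sub>R v) - t * T (w # vs) x\<bar> \<le> t\<^sup>2 * (C2 * norm v * (norm w * ?p))"
      using t(1) by (simp add: power2_eq_square mult.assoc flip: right_diff_distrib) (simp add: abs_mult)
    have "\<bar>t * a\<bar> \<le> t\<^sup>2 * K"
      using a1 a2 a3 a4 unfolding a_def K_def distrib_left right_diff_distrib by linarith
    then have "t * \<bar>a\<bar> \<le> t * (K * t)"
      using t(1) by (simp add: abs_mult power2_eq_square mult_ac)
    then show ?thesis using t(1) by simp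
  qed
  have "\<forall>\<^sub>F t in at_right 0. \<bar>a\<bar> \<le> K * t"
  proof -
    have lim: "((\<lambda>t. t * norm u) \<longlongrightarrow> 0 * norm u) (at_right (0::real))" for u :: 'a
      by (intro tendsto_intros)
    have "\<forall>\<^sub>F t in at_right (0::real). t * norm u < min d1 d2" for u :: 'a
      using order_tendstoD(2)[OF lim[of u], of "min d1 d2"] 1 2 by simp
    from this[of v] this[of "v + w"] eventually_at_right_less[of "0::real"]
    show ?thesis
      by eventually_elim (use K in blast)
  qed
  moreover have "((\<lambda>t. K * t) \<longlongrightarrow> K * 0) (at_right (0::real))"
    by (intro tendsto_intros)
  ultimately have "\<bar>a\<bar> \<le> K * 0"
    by (intro tendsto_lowerbound) auto
  then show ?thesis by (simp add: a_def)
qed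

text \<open>\<open>add\<close> and \<open>scale\<close> only treat the head of the list. For a later
  slot, the linearity known for the tail of the list holds at every point, and differentiating this
  identity along the head preserves it.\<close>

lemma linear_slot: "i < length vs \<Longrightarrow> linear (\<lambda>v. T (vs[i := v]) x)"
proof (induction vs arbitrary: i x)
  case (Cons u vs)
  show ?case
  proof (cases i)
    case 0
    then show ?thesis by (auto intro!: linearI add scale)
  next
    case (Suc j)
    then have lin: "linear (\<lambda>v. T (vs[j := v]) y)" for y
      using Cons by simp
    have "T (u # vs[j := a + b]) x = T (u # vs[j := a]) x + T (u # vs[j := b]) x" for a b
    proof -
      have "((\<lambda>t. T (vs[j := a + b]) (x + t *\<^sub>R u)) has_real_derivative
          T (u # vs[j := a]) x + T (u # vs[j := b]) x) (at 0)"
        unfolding linear_add[OF lin] by (intro DERIV_add deriv)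
      then show ?thesis using DERIV_unique deriv by blast
    qed
    moreover have "T (u # vs[j := c *\<^sub>R a]) x = c * T (u # vs[j := a]) x" for a c
    proof -
      have "((\<lambda>t. T (vs[j := c *\<^sub>R a]) (x + t *\<^sub>R u)) has_real_derivative
          c * T (u # vs[j := a]) x) (at 0)"
        unfolding linear_scale[OF lin] real_scaleR_def by (intro DERIV_cmult deriv)
      then show ?thesis using DERIV_unique deriv by blast
    qed
    ultimately show ?thesis
      using Suc by (auto intro!: linearI)
  qed
qed simp

end

section \<open>From directional jets to Frechet smoothness\<close>

lemma multilinear_norm_le:
  assumes "\<And>vs. length vs = k \<Longrightarrow> (\<forall>v\<in>set vs. norm v \<le> 1) \<Longrightarrow> \<bar>F vs\<bar> \<le> c"
  shows "0 \<le> multilinear_norm k F" "multilinear_norm k F \<le> c"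
proof -
  let ?S = "{vs::'a list. length vs = k \<and> (\<forall>v\<in>set vs. norm v \<le> 1)}"
  \<comment> \<open>The zero list shows that the supremum is over a nonempty set. The bound
    \<open>c\<close> is needed for nonnegativity as well, since a real \<open>SUP\<close> says
    nothing about an unbounded set.\<close>
  have mem: "replicate k 0 \<in> ?S" by auto
  show "multilinear_norm k F \<le> c"
    unfolding multilinear_norm_def
  proof (rule cSUP_least)
    show "?S \<noteq> {}" using mem by blast
  qed (use assms in auto)
  have "\<bar>F (replicate k 0)\<bar> \<le> multilinear_norm k F"
    unfolding multilinear_norm_def
    by (rule cSUP_upper[OF mem]) (use assms in \<open>auto intro!: bdd_aboveI2[where M=c]\<close>)
  then show "0 \<le> multilinear_norm k F" by linarith
qed

lemma prod_list_le_1: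
  fixes xs :: "'a::real_normed_vector list"
  shows "(\<forall>v\<in>set xs. norm v \<le> 1) \<Longrightarrow> (\<Prod>v\<leftarrow>xs. norm v) \<le> 1"
  by (induction xs) (auto intro!: mult_le_one prod_list_nonneg)

lemma (in directional_jet) smooth: "T [] \<in> smooth"
proof -
  have bm: "bounded_multilinear k (\<lambda>vs. T vs x)" for k x
    unfolding bounded_multilinear_def
  proof (intro conjI allI impI)
    show "\<exists>C. \<forall>vs. length vs = k \<longrightarrow> \<bar>T vs x\<bar> \<le> C * (\<Prod>v\<leftarrow>vs. norm v)"
      using bdd[of x k] by (meson centre_in_ball)
  qed (use linear_slot in blast)
  have der: "((\<lambda>h. multilinear_norm k (\<lambda>vs. T vs (x + h) - T vs x - T (h # vs) x) / norm h) \<longlongrightarrow> 0) (at 0)"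
    and cont: "((\<lambda>y. multilinear_norm k (\<lambda>vs. T vs y - T vs x)) \<longlongrightarrow> 0) (at x)" for k x
  proof -
    obtain d C where d: "d > 0" "C \<ge> 0" and
      est: "\<And>h vs. x + h \<in> ball x d \<Longrightarrow> length vs = k \<Longrightarrow>
        \<bar>T vs (x + h) - T vs x\<bar> \<le> C * norm h * (\<Prod>v\<leftarrow>vs. norm v) \<and>
        \<bar>T vs (x + h) - T vs x - T (h # vs) x\<bar> \<le> C * (norm h)\<^sup>2 * (\<Prod>v\<leftarrow>vs. norm v)"
      using taylor[of x k] by (meson centre_in_ball)
    have e: "\<bar>T vs (x + h) - T vs x\<bar> \<le> C * norm h"
        "\<bar>T vs (x + h) - T vs x - T (h # vs) x\<bar> \<le> C * (norm h)\<^sup>2"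
      if "norm h < d" "length vs = k" "\<forall>v\<in>set vs. norm v \<le> 1" for h vs
    proof -
      have p: "(\<Prod>v\<leftarrow>vs. norm v) \<le> 1"
        using that(3) by (rule prod_list_le_1)
      have "C * norm h * (\<Prod>v\<leftarrow>vs. norm v) \<le> C * norm h * 1"
        "C * (norm h)\<^sup>2 * (\<Prod>v\<leftarrow>vs. norm v) \<le> C * (norm h)\<^sup>2 * 1"
        using p d(2) by (intro mult_left_mono; simp)+
      then show "\<bar>T vs (x + h) - T vs x\<bar> \<le> C * norm h"
        "\<bar>T vs (x + h) - T vs x - T (h # vs) x\<bar> \<le> C * (norm h)\<^sup>2"
        using est[of h vs] that by (auto simp: dist_norm)
    qed
    have small: "\<forall>\<^sub>F h in at (0::'a). norm h < d"
      using d(1) by (auto simp: eventually_at dist_norm intro!: exI[of _ d])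
    have lim: "((\<lambda>h::'a. C * norm h) \<longlongrightarrow> 0) (at 0)"
      by (intro tendsto_mult_right_zero tendsto_norm_zero tendsto_ident_at)
    show "((\<lambda>h. multilinear_norm k (\<lambda>vs. T vs (x + h) - T vs x - T (h # vs) x) / norm h) \<longlongrightarrow> 0) (at 0)"
    proof (rule tendsto_sandwich[OF _ _ tendsto_const lim])
      show "\<forall>\<^sub>F h in at 0. 0 \<le> multilinear_norm k (\<lambda>vs. T vs (x + h) - T vs x - T (h # vs) x) / norm h"
        using small
        by eventually_elim (rule divide_nonneg_nonneg[OF multilinear_norm_le(1)[OF e(2)]], auto)
      show "\<forall>\<^sub>F h in at 0. multilinear_norm k (\<lambda>vs. T vs (x + h) - T vs x - T (h # vs) x) / norm h \<le> C * norm h"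
        using small eventually_neq_at_within[of 0 0 UNIV]
      proof eventually_elim
        case (elim h)
        have "multilinear_norm k (\<lambda>vs. T vs (x + h) - T vs x - T (h # vs) x) \<le> C * (norm h)\<^sup>2"
          by (rule multilinear_norm_le(2)) (rule e(2)[OF elim(1)])
        then show ?case using elim by (simp add: divide_le_eq power2_eq_square mult.assoc)
      qed
    qed
    have "((\<lambda>h. multilinear_norm k (\<lambda>vs. T vs (x + h) - T vs x)) \<longlongrightarrow> 0) (at 0)"
    proof (rule tendsto_sandwich[OF _ _ tendsto_const lim])
      show "\<forall>\<^sub>F h in at 0. 0 \<le> multilinear_norm k (\<lambda>vs. T vs (x + h) - T vs x)"
        using small by eventually_elim (rule multilinear_norm_le(1)[OF e(1)])
      show "\<forall>\<^sub>F h in at 0. multilinear_norm k (\<lambda>vs. T vs (x + h) - T vs x) \<le> C * norm h"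
        using small by eventually_elim (rule multilinear_norm_le(2)[OF e(1)])
    qed
    then show "((\<lambda>y. multilinear_norm k (\<lambda>vs. T vs y - T vs x)) \<longlongrightarrow> 0) (at x)"
      using LIM_offset_zero_cancel[of "\<lambda>y. multilinear_norm k (\<lambda>vs. T vs y - T vs x)" x 0] by simp
  qed
  show ?thesis
    unfolding smooth_def mem_Collect_eq
    by (rule exI[of _ "\<lambda>k x vs. T vs x"]) (use bm der cont in blast)
qed

primrec iter_deriv :: "('a::real_normed_vector \<Rightarrow> real) \<Rightarrow> 'a list \<Rightarrow> 'a \<Rightarrow> real" where
  "iter_deriv f [] = f"
| "iter_deriv f (v # vs) = (\<lambda>x. deriv (\<lambda>t. iter_deriv f vs (x + t *\<^sub>R v)) 0)"

text \<open>Normalizing a direction by \<open>sgn\<close> frees the derivatives from the unit ball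
  at the price of a factor \<open>norm v\<close>. These factors accumulate to the product of norms
  in a multilinear bound.\<close>

lemma bdd_deriv_SucE:
  assumes "bdd_deriv (Suc k) U A"
  obtains B where "bdd_deriv k U B" "\<And>f v. f \<in> A \<Longrightarrow>
    \<exists>g\<in>B. \<forall>x\<in>U. ((\<lambda>t. f (x + t *\<^sub>R v)) has_real_derivative norm v * g x) (at 0)"
proof -
  obtain B where B: "bdd_deriv k U B" and
    d: "\<And>f v. f \<in> A \<Longrightarrow> norm v \<le> 1 \<Longrightarrow>
      \<exists>g\<in>B. \<forall>x\<in>U. ((\<lambda>t. f (x + t *\<^sub>R v)) has_real_derivative g x) (at 0)"
    using assms unfolding bdd_deriv.simps by auto
  have "\<exists>g\<in>B. \<forall>x\<in>U. ((\<lambda>t. f (x + t *\<^sub>R v)) has_real_derivative norm v * g x) (at 0)"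
    if f: "f \<in> A" for f v
  proof -
    have "norm (sgn v) \<le> 1" by (simp add: norm_sgn)
    then obtain g where g: "g \<in> B"
      "\<And>x. x \<in> U \<Longrightarrow> ((\<lambda>t. f (x + t *\<^sub>R sgn v)) has_real_derivative g x) (at 0)"
      using d[OF f] by blast
    have v: "v = norm v *\<^sub>R sgn v" by (cases "v = 0") (simp_all add: sgn_div_norm)
    have "((\<lambda>t. f (x + t *\<^sub>R v)) has_real_derivative norm v * g x) (at 0)" if "x \<in> U" for x
    proof -
      have "((\<lambda>t. f (x + (t * norm v) *\<^sub>R sgn v)) has_real_derivative g x * norm v) (at 0)"
        by (rule DERIV_chain2[of "\<lambda>t. f (x + t *\<^sub>R sgn v)" _ "\<lambda>t. t * norm v"])
          (auto intro!: derivative_eq_intros g that)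
      then show ?thesis
        by (simp add: mult.commute flip: scaleR_scaleR) (metis v)
    qed
    then show ?thesis using g(1) by blast
  qed
  with B show ?thesis using that by blast
qed

lemma smoothI:
  assumes "\<And>k. bdd_deriv k UNIV {f}"
  shows "f \<in> smooth"
proof -
  \<comment> \<open>The family \<open>B\<close> depends on \<open>n\<close> and \<open>k\<close> but
    not on the directions, which makes the final bound uniform in \<open>vs\<close>. Each induction
    step consumes one of the \<open>k\<close> orders kept in reserve.\<close>
  have *: "\<exists>B. bdd_deriv k UNIV B \<and>
    (\<forall>vs. length vs = n \<longrightarrow> (\<exists>g\<in>B. iter_deriv f vs = (\<lambda>x. (\<Prod>v\<leftarrow>vs. norm v) * g x)))" for n k
  proof (induction n arbitrary: k)
    case 0
    show ?case using assms by (intro exI[of _ "{f}"]) simp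
  next
    case (Suc n)
    obtain B where B: "bdd_deriv (Suc k) UNIV B" and
      r: "\<And>vs. length vs = n \<Longrightarrow> \<exists>g\<in>B. iter_deriv f vs = (\<lambda>x. (\<Prod>v\<leftarrow>vs. norm v) * g x)"
      using Suc[of "Suc k"] by blast
    obtain B' where B': "bdd_deriv k UNIV B'" and d: "\<And>g v. g \<in> B \<Longrightarrow>
        \<exists>g'\<in>B'. \<forall>x\<in>UNIV. ((\<lambda>t. g (x + t *\<^sub>R v)) has_real_derivative norm v * g' x) (at 0)"
      using bdd_deriv_SucE[OF B] by metis
    have "\<exists>g\<in>B'. iter_deriv f vs = (\<lambda>x. (\<Prod>v\<leftarrow>vs. norm v) * g x)" if len: "length vs = Suc n" for vs
    proof -
      obtain v ws where vs: "vs = v # ws" "length ws = n"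
        using len by (cases vs) auto
      obtain g where g: "g \<in> B" "iter_deriv f ws = (\<lambda>x. (\<Prod>v\<leftarrow>ws. norm v) * g x)"
        using r[OF vs(2)] by blast
      obtain g' where g': "g' \<in> B'"
        "\<And>x. ((\<lambda>t. g (x + t *\<^sub>R v)) has_real_derivative norm v * g' x) (at 0)"
        using d[OF g(1), of v] by blast
      have "iter_deriv f vs x = (\<Prod>v\<leftarrow>vs. norm v) * g' x" for x
        using DERIV_imp_deriv[OF DERIV_cmult[OF g'(2)]] by (simp add: vs g mult_ac)
      then show ?thesis using g'(1) by blast
    qed
    then show ?case using B' by blast
  qed
  interpret directional_jet "iter_deriv f"
  proof
    fix vs :: "'a list" and x v
    obtain B where B: "bdd_deriv (Suc 0) UNIV B" and
      r: "\<And>ws. length ws = length vs \<Longrightarrow> \<exists>g\<in>B. iter_deriv f ws = (\<lambda>x. (\<Prod>v\<leftarrow>ws. norm v) * g x)"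
      using *[of "Suc 0" "length vs"] by blast
    obtain g where g: "g \<in> B" "iter_deriv f vs = (\<lambda>x. (\<Prod>v\<leftarrow>vs. norm v) * g x)"
      using r by blast
    obtain D where "((\<lambda>t. g (x + t *\<^sub>R v)) has_real_derivative D) (at 0)"
      using bdd_deriv_SucE[OF B] g(1) by (metis UNIV_I)
    from DERIV_cmult[OF this] have "((\<lambda>t. iter_deriv f vs (x + t *\<^sub>R v)) has_real_derivative
        (\<Prod>v\<leftarrow>vs. norm v) * D) (at 0)"
      by (simp add: g(2))
    then show "((\<lambda>t. iter_deriv f vs (x + t *\<^sub>R v)) has_real_derivative iter_deriv f (v # vs) x) (at 0)"
      using DERIV_imp_deriv by fastforce
  next
    fix x :: 'a and n
    obtain B where B: "bdd_deriv 0 UNIV B" and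
      r: "\<And>vs. length vs = n \<Longrightarrow> \<exists>g\<in>B. iter_deriv f vs = (\<lambda>x. (\<Prod>v\<leftarrow>vs. norm v) * g x)"
      using *[of 0 n] by blast
    obtain C where "\<forall>\<^sub>F y in nhds x. \<forall>f\<in>B. \<bar>f y\<bar> \<le> C"
      using B by auto
    then obtain d where d: "d > 0" "\<And>y g. dist y x < d \<Longrightarrow> g \<in> B \<Longrightarrow> \<bar>g y\<bar> \<le> C"
      unfolding eventually_nhds_metric by blast
    have "\<bar>iter_deriv f vs y\<bar> \<le> \<bar>C\<bar> * (\<Prod>v\<leftarrow>vs. norm v)" if y: "y \<in> ball x d" "length vs = n" for y vs
    proof -
      obtain g where g: "g \<in> B" "iter_deriv f vs = (\<lambda>x. (\<Prod>v\<leftarrow>vs. norm v) * g x)"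
        using r[OF y(2)] by blast
      have p: "0 \<le> (\<Prod>v\<leftarrow>vs. norm v)" by (rule prod_list_nonneg) auto
      have "\<bar>g y\<bar> \<le> \<bar>C\<bar>" using d(2)[of y g] y(1) g(1) by (simp add: dist_commute)
      then have "(\<Prod>v\<leftarrow>vs. norm v) * \<bar>g y\<bar> \<le> (\<Prod>v\<leftarrow>vs. norm v) * \<bar>C\<bar>"
        using p by (rule mult_left_mono)
      then show ?thesis using p by (simp add: g(2) abs_mult mult.commute)
    qed
    then show "\<exists>d>0. \<exists>C\<ge>0. \<forall>y\<in>ball x d. \<forall>vs. length vs = n \<longrightarrow>
        \<bar>iter_deriv f vs y\<bar> \<le> C * (\<Prod>v\<leftarrow>vs. norm v)"
      using d(1) by (metis abs_ge_zero)
  qed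
  show ?thesis using smooth by simp
qed

section \<open>Differentiation under the integral sign\<close>

lemma bounded_integral_bound:
  fixes \<phi> :: "'p \<Rightarrow> real"
  assumes "finite_measure M" "\<phi> \<in> borel_measurable M" "\<And>p. p \<in> space M \<Longrightarrow> \<bar>\<phi> p\<bar> \<le> C"
  shows "integrable M \<phi>" "\<bar>\<integral>p. \<phi> p \<partial>M\<bar> \<le> measure M (space M) * C"
proof -
  interpret finite_measure M by fact
  show i: "integrable M \<phi>"
    by (rule integrable_const_bound[of _ C]) (use assms in auto)
  have "\<bar>\<integral>p. \<phi> p \<partial>M\<bar> \<le> (\<integral>p. \<bar>\<phi> p\<bar> \<partial>M)"
    by (rule integral_abs_bound)
  also have "\<dots> \<le> (\<integral>p. C \<partial>M)"
    by (rule integral_mono) (use i assms in auto)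
  finally show "\<bar>\<integral>p. \<phi> p \<partial>M\<bar> \<le> measure M (space M) * C"
    by simp
qed

text \<open>Difference quotients are bounded by \<open>C\<close> through the mean value inequality,
  so dominated convergence applies on a finite measure space. Measurability of the derivative in the
  parameter is a conclusion: it is a pointwise limit of measurable quotients.\<close>

lemma has_real_derivative_integral_line:
  fixes \<alpha> :: "'p \<Rightarrow> 'a::real_normed_vector \<Rightarrow> real"
  assumes M: "finite_measure M" and U: "open U" "x \<in> U"
    and meas: "\<And>y. y \<in> U \<Longrightarrow> (\<lambda>p. \<alpha> p y) \<in> borel_measurable M"
    and bdd: "\<And>y. y \<in> U \<Longrightarrow> \<exists>C. \<forall>p\<in>space M. \<bar>\<alpha> p y\<bar> \<le> C"
    and der: "\<And>p y. p \<in> space M \<Longrightarrow> y \<in> U \<Longrightarrow> ((\<lambda>t. \<alpha> p (y + t *\<^sub>R v)) has_real_derivative \<alpha>' p y) (at 0)"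
    and dbdd: "\<forall>\<^sub>F y in nhds x. \<forall>p\<in>space M. \<bar>\<alpha>' p y\<bar> \<le> C"
  shows "(\<lambda>p. \<alpha>' p x) \<in> borel_measurable M"
    and "((\<lambda>t. \<integral>p. \<alpha> p (x + t *\<^sub>R v) \<partial>M) has_real_derivative (\<integral>p. \<alpha>' p x \<partial>M)) (at 0)"
proof -
  have "\<forall>\<^sub>F y in nhds x. y \<in> U"
    using U eventually_nhds by blast
  with dbdd have "\<forall>\<^sub>F y in nhds x. y \<in> U \<and> (\<forall>p\<in>space M. \<bar>\<alpha>' p y\<bar> \<le> C)"
    by eventually_elim simp
  then obtain V where V: "open V" "x \<in> V" "\<And>y. y \<in> V \<Longrightarrow> y \<in> U"
      "\<And>y p. y \<in> V \<Longrightarrow> p \<in> space M \<Longrightarrow> \<bar>\<alpha>' p y\<bar> \<le> C"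
    unfolding eventually_nhds by blast
  obtain d where d: "d > 0" "\<And>t. \<bar>t\<bar> < d \<Longrightarrow> x + t *\<^sub>R v \<in> V"
    using eventually_line[OF V(1,2), of v] unfolding eventually_nhds_metric
    by (auto simp: dist_real_def)
  let ?q = "\<lambda>h p. (\<alpha> p (x + h *\<^sub>R v) - \<alpha> p x) / h"
  have qm: "?q h \<in> borel_measurable M" if "\<bar>h\<bar> < d" for h
    using meas V d(2)[OF that] by (intro borel_measurable_divide borel_measurable_diff) auto
  have qlim: "((\<lambda>h. ?q h p) \<longlongrightarrow> \<alpha>' p x) (at 0)" if "p \<in> space M" for p
    using der[OF that V(3)[OF V(2)]] by (simp add: DERIV_def)
  have qbd: "\<bar>?q h p\<bar> \<le> C" if h: "\<bar>h\<bar> < d" and p: "p \<in> space M" for h p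
  proof -
    have C0: "0 \<le> C"
      using V(4)[OF V(2) p] by linarith
    have D: "((\<lambda>t. \<alpha> p (x + t *\<^sub>R v)) has_real_derivative \<alpha>' p (x + s *\<^sub>R v)) (at s)" if "\<bar>s\<bar> < d" for s
      by (rule line_derivative_shift, rule der[OF p V(3)[OF d(2)[OF that]]])
    have "norm (\<alpha> p (x + h *\<^sub>R v) - \<alpha> p (x + 0 *\<^sub>R v)) \<le> C * norm (h - 0)"
    proof (rule field_differentiable_bound[of "{-\<bar>h\<bar>..\<bar>h\<bar>}" _ "\<lambda>s. \<alpha>' p (x + s *\<^sub>R v)"])
      show "((\<lambda>t. \<alpha> p (x + t *\<^sub>R v)) has_field_derivative \<alpha>' p (x + s *\<^sub>R v)) (at s within {-\<bar>h\<bar>..\<bar>h\<bar>})"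
        if "s \<in> {-\<bar>h\<bar>..\<bar>h\<bar>}" for s
        using D[of s] that h by (auto intro: has_field_derivative_at_within)
      show "norm (\<alpha>' p (x + s *\<^sub>R v)) \<le> C" if "s \<in> {-\<bar>h\<bar>..\<bar>h\<bar>}" for s
        using V(4)[OF d(2) p, of s] that h by auto
    qed auto
    then show ?thesis
      using C0 by (cases "h = 0") (auto simp: abs_divide divide_le_eq)
  qed
  \<comment> \<open>Dominated convergence is sequential, so the limit at 0 is tested along arbitrary
    null sequences of nonzero numbers.\<close>
  have seq: "(\<lambda>n. integral\<^sup>L M (?q (S n))) \<longlonglongrightarrow> (\<integral>p. \<alpha>' p x \<partial>M)" "(\<lambda>p. \<alpha>' p x) \<in> borel_measurable M"
    if S: "\<And>n. S n \<noteq> 0" "S \<longlonglongrightarrow> 0" for S :: "nat \<Rightarrow> real"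
  proof -
    \<comment> \<open>The quotients are controlled only for increments below \<open>d\<close>; the
      first \<open>N\<close> terms are dropped and restored at the end.\<close>
    obtain N where N: "\<And>n. n \<ge> N \<Longrightarrow> \<bar>S n\<bar> < d"
      using LIMSEQ_D[OF S(2) d(1)] by auto
    have lim: "(\<lambda>n. ?q (S (n + N)) p) \<longlonglongrightarrow> \<alpha>' p x" if "p \<in> space M" for p
      using LIMSEQ_ignore_initial_segment[of "\<lambda>n. ?q (S n) p" "\<alpha>' p x" N]
        qlim[OF that, folded LIMSEQ_SEQ_conv] S by blast
    show m: "(\<lambda>p. \<alpha>' p x) \<in> borel_measurable M"
      by (rule borel_measurable_LIMSEQ_real[OF lim]) (use qm N in auto)
    have "(\<lambda>n. integral\<^sup>L M (?q (S (n + N)))) \<longlonglongrightarrow> (\<integral>p. \<alpha>' p x \<partial>M)"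
    proof (rule integral_dominated_convergence[where w="\<lambda>_. C"])
      interpret finite_measure M by fact
      show "integrable M (\<lambda>_. C)" by simp
      show "AE p in M. (\<lambda>n. ?q (S (n + N)) p) \<longlonglongrightarrow> \<alpha>' p x"
        using lim by auto
      show "?q (S (n + N)) \<in> borel_measurable M" for n
        using qm N by simp
      show "AE p in M. norm (?q (S (n + N)) p) \<le> C" for n
        unfolding real_norm_def by (rule AE_I2) (rule qbd, use N in auto)
    qed (rule m)
    then show "(\<lambda>n. integral\<^sup>L M (?q (S n))) \<longlonglongrightarrow> (\<integral>p. \<alpha>' p x \<partial>M)"
      by (rule LIMSEQ_offset)
  qed
  show "(\<lambda>p. \<alpha>' p x) \<in> borel_measurable M"
    by (rule seq(2)[OF _ LIMSEQ_inverse_real_of_nat]) simp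
  have "((\<lambda>h. integral\<^sup>L M (?q h)) \<longlongrightarrow> (\<integral>p. \<alpha>' p x \<partial>M)) (at 0)"
    using seq(1) by (simp flip: LIMSEQ_SEQ_conv)
  moreover have "\<forall>\<^sub>F h in at 0. integral\<^sup>L M (?q h) =
    ((\<integral>p. \<alpha> p (x + (0 + h) *\<^sub>R v) \<partial>M) - (\<integral>p. \<alpha> p (x + 0 *\<^sub>R v) \<partial>M)) / h"
  proof -
    have int: "integrable M (\<lambda>p. \<alpha> p y)" if y: "y \<in> U" for y
      using bdd[OF y] bounded_integral_bound(1)[OF M meas[OF y]] by blast
    have "\<forall>\<^sub>F h in at 0. \<bar>h\<bar> < d"
      using d(1) by (auto simp: eventually_at intro!: exI[of _ d])
    then show ?thesis
    proof eventually_elim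
      case (elim h)
      have "integrable M (\<lambda>p. \<alpha> p (x + h *\<^sub>R v))" "integrable M (\<lambda>p. \<alpha> p x)"
        using int V d(2)[OF elim] U by auto
      then show ?case by simp
    qed
  qed
  ultimately show "((\<lambda>t. \<integral>p. \<alpha> p (x + t *\<^sub>R v) \<partial>M) has_real_derivative (\<integral>p. \<alpha>' p x \<partial>M)) (at 0)"
    unfolding DERIV_def by (rule Lim_transform_eventually)
qed

lemma bdd_deriv_integral:
  fixes \<A> :: "('p \<Rightarrow> 'a::real_normed_vector \<Rightarrow> real) set"
  assumes M: "finite_measure M" and U: "open U"
    and "\<And>\<alpha> x. \<alpha> \<in> \<A> \<Longrightarrow> x \<in> U \<Longrightarrow> (\<lambda>p. \<alpha> p x) \<in> borel_measurable M"
    and "bdd_deriv k U {\<alpha> p | \<alpha> p. \<alpha> \<in> \<A> \<and> p \<in> space M}"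
  shows "bdd_deriv k U {\<lambda>x. \<integral>p. \<alpha> p x \<partial>M | \<alpha>. \<alpha> \<in> \<A>}"
  using assms(3,4)
proof (induction k arbitrary: \<A>)
  case 0
  show ?case
    unfolding bdd_deriv.simps
  proof
    fix x assume x: "x \<in> U"
    have "\<forall>\<^sub>F y in nhds x. y \<in> U"
      using U x eventually_nhds by blast
    moreover obtain C where C: "\<forall>\<^sub>F y in nhds x. \<forall>f\<in>{\<alpha> p | \<alpha> p. \<alpha> \<in> \<A> \<and> p \<in> space M}. \<bar>f y\<bar> \<le> C"
      using 0(2) x by auto
    ultimately have "\<forall>\<^sub>F y in nhds x. \<forall>f\<in>{\<lambda>x. \<integral>p. \<alpha> p x \<partial>M | \<alpha>. \<alpha> \<in> \<A>}. \<bar>f y\<bar> \<le> measure M (space M) * C"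
    proof eventually_elim
      case (elim y)
      have "\<bar>\<integral>p. \<alpha> p y \<partial>M\<bar> \<le> measure M (space M) * C" if "\<alpha> \<in> \<A>" for \<alpha>
        by (rule bounded_integral_bound(2)[OF M 0(1)[OF that elim(1)]]) (use elim(2) that in blast)
      then show ?case by blast
    qed
    then show "\<exists>C. \<forall>\<^sub>F y in nhds x. \<forall>f\<in>{\<lambda>x. \<integral>p. \<alpha> p x \<partial>M | \<alpha>. \<alpha> \<in> \<A>}. \<bar>f y\<bar> \<le> C"
      by blast
  qed
next
  case (Suc k)
  let ?F = "\<lambda>\<A>. {\<alpha> p | \<alpha> p. \<alpha> \<in> \<A> \<and> p \<in> space M}"
  let ?I = "\<lambda>\<A>. {\<lambda>x. \<integral>p. \<alpha> p x \<partial>M | \<alpha>. \<alpha> \<in> \<A>}"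
  obtain B where B: "bdd_deriv k U B" and
    d: "\<And>f v. f \<in> ?F \<A> \<Longrightarrow> norm v \<le> 1 \<Longrightarrow>
      \<exists>g\<in>B. \<forall>x\<in>U. ((\<lambda>t. f (x + t *\<^sub>R v)) has_real_derivative g x) (at 0)"
    using Suc.prems(2) unfolding bdd_deriv.simps by meson
  \<comment> \<open>Derivatives will be selected from \<open>B\<close> separately for each
    parameter, which by itself gives no measurability. Their values on \<open>U\<close> are forced
    by uniqueness of derivatives, so the preceding lemma places every such selection in this
    set.\<close>
  define \<B> where "\<B> = {\<beta>. (\<forall>p\<in>space M. \<beta> p \<in> B) \<and> (\<forall>x\<in>U. (\<lambda>p. \<beta> p x) \<in> borel_measurable M)}"
  have "bdd_deriv k U (?F \<B>)"
    by (rule bdd_deriv_mono[OF U B]) (auto simp: \<B>_def)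
  then have IB: "bdd_deriv k U (?I \<B>)"
    by (intro Suc.IH) (auto simp: \<B>_def)
  have bdd: "\<exists>C. \<forall>p\<in>space M. \<bar>\<alpha> p y\<bar> \<le> C" if "\<alpha> \<in> \<A>" "y \<in> U" for \<alpha> y
  proof -
    have "bdd_deriv 0 U (?F \<A>)" using bdd_deriv_imp_0 Suc.prems(2) .
    then obtain C where "\<forall>\<^sub>F z in nhds y. \<forall>f\<in>?F \<A>. \<bar>f z\<bar> \<le> C"
      using \<open>y \<in> U\<close> unfolding bdd_deriv.simps by meson
    then have "\<forall>f\<in>?F \<A>. \<bar>f y\<bar> \<le> C" by (rule eventually_nhds_x_imp_x)
    then show ?thesis using \<open>\<alpha> \<in> \<A>\<close> by blast
  qed
  have "\<exists>g\<in>?I \<B>. \<forall>x\<in>U. ((\<lambda>t. f (x + t *\<^sub>R v)) has_real_derivative g x) (at 0)"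
    if f: "f \<in> ?I \<A>" and v: "norm v \<le> 1" for f v
  proof -
    obtain \<alpha> where \<alpha>: "\<alpha> \<in> \<A>" "f = (\<lambda>x. \<integral>p. \<alpha> p x \<partial>M)"
      using f by blast
    have "\<forall>p\<in>space M. \<exists>g\<in>B. \<forall>x\<in>U. ((\<lambda>t. \<alpha> p (x + t *\<^sub>R v)) has_real_derivative g x) (at 0)"
      using d[OF _ v] \<alpha>(1) by blast
    then obtain \<beta> where \<beta>: "\<And>p. p \<in> space M \<Longrightarrow> \<beta> p \<in> B"
      "\<And>p x. p \<in> space M \<Longrightarrow> x \<in> U \<Longrightarrow> ((\<lambda>t. \<alpha> p (x + t *\<^sub>R v)) has_real_derivative \<beta> p x) (at 0)"
      by metis
    have *: "(\<lambda>p. \<beta> p x) \<in> borel_measurable M"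
      "((\<lambda>t. \<integral>p. \<alpha> p (x + t *\<^sub>R v) \<partial>M) has_real_derivative (\<integral>p. \<beta> p x \<partial>M)) (at 0)"
      if x: "x \<in> U" for x
    proof -
      obtain C where "\<forall>\<^sub>F y in nhds x. \<forall>f\<in>B. \<bar>f y\<bar> \<le> C"
        using bdd_deriv_imp_0[OF B] x unfolding bdd_deriv.simps by meson
      then have C: "\<forall>\<^sub>F y in nhds x. \<forall>p\<in>space M. \<bar>\<beta> p y\<bar> \<le> C"
        by eventually_elim (use \<beta>(1) in blast)
      note r = has_real_derivative_integral_line[OF M U x Suc.prems(1)[OF \<alpha>(1)] bdd[OF \<alpha>(1)] \<beta>(2) C]
      show "(\<lambda>p. \<beta> p x) \<in> borel_measurable M"
        by (rule r(1)) auto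
      show "((\<lambda>t. \<integral>p. \<alpha> p (x + t *\<^sub>R v) \<partial>M) has_real_derivative (\<integral>p. \<beta> p x \<partial>M)) (at 0)"
        by (rule r(2)) auto
    qed
    have "\<beta> \<in> \<B>" using \<beta>(1) *(1) by (auto simp: \<B>_def)
    then have "(\<lambda>x. \<integral>p. \<beta> p x \<partial>M) \<in> ?I \<B>" by blast
    then show ?thesis
      using *(2) unfolding \<alpha>(2) by (intro bexI[of _ "\<lambda>x. \<integral>p. \<beta> p x \<partial>M"] ballI)
  qed
  moreover have "bdd_deriv 0 U (?I \<A>)"
    by (rule bdd_deriv_imp_0, rule Suc.IH) (use Suc.prems bdd_deriv_SucD in blast)+
  ultimately show ?case
    unfolding bdd_deriv.simps(2) using IB by (intro conjI exI[of _ "?I \<B>"] ballI allI impI)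
qed

subsection \<open>A flat function and a mollifying kernel\<close>

text \<open>The derivative of p(1/x) exp(-1/x) is q(1/x) exp(-1/x) with q(y) = y^2 (p(y) - p'(y)).
  So \<open>flat n\<close> is the n-th derivative of the classical function exp(-1/x), extended by 0
  to the left.\<close>

primrec flat_poly :: "nat \<Rightarrow> real poly" where
  "flat_poly 0 = 1"
| "flat_poly (Suc n) = [:0, 0, 1:] * (flat_poly n - pderiv (flat_poly n))"

definition flat :: "nat \<Rightarrow> real \<Rightarrow> real"
  where "flat n x = (if x \<le> 0 then 0 else poly (flat_poly n) (1 / x) * exp (- (1 / x)))"

lemma poly_times_exp_tendsto_0: "((\<lambda>y. poly p y * exp (- y)) \<longlongrightarrow> 0) (at_top :: real filter)"
proof -
  have "((\<lambda>y. \<Sum>i\<le>degree p. coeff p i * (y ^ i / exp y)) \<longlongrightarrow> (\<Sum>i\<le>degree p. coeff p i * 0)) at_top"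
    by (intro tendsto_intros tendsto_power_div_exp_0)
  then show ?thesis
    by (simp add: poly_altdef sum_divide_distrib exp_minus field_simps)
qed

lemma flat_has_derivative: "(flat n has_real_derivative flat (Suc n) x) (at x)"
proof (cases x "0::real" rule: linorder_cases)
  case less
  have "((\<lambda>x. 0) has_real_derivative flat (Suc n) x) (at x)"
    using less by (simp add: flat_def)
  moreover have "\<forall>\<^sub>F y in nhds x. flat n y = 0"
    using eventually_nhds_in_open[of "{..<0}" x] less by (auto simp: flat_def elim: eventually_mono)
  ultimately show ?thesis
    using DERIV_cong_ev[of x x "flat n" "\<lambda>_. 0"] by simp
next
  case greater
  have "((\<lambda>x. poly (flat_poly n) (1 / x) * exp (- (1 / x))) has_real_derivative flat (Suc n) x) (at x)"
    using greater
    by (auto intro!: derivative_eq_intros DERIV_chain2[OF poly_DERIV]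
        simp: flat_def field_simps power2_eq_square)
  moreover have "\<forall>\<^sub>F y in nhds x. flat n y = poly (flat_poly n) (1 / y) * exp (- (1 / y))"
    using eventually_nhds_in_open[of "{0<..}" x] greater by (auto simp: flat_def elim: eventually_mono)
  ultimately show ?thesis
    using DERIV_cong_ev[of x x "flat n"] by simp
next
  case equal
  have "((\<lambda>h. flat n h / h) \<longlongrightarrow> 0) (at_left 0)"
    by (rule tendsto_eventually) (auto simp: flat_def eventually_at_filter)
  moreover have "((\<lambda>h. flat n h / h) \<longlongrightarrow> 0) (at_right 0)"
  proof (rule Lim_transform_eventually)
    \<comment> \<open>With y = 1/h, dividing by h multiplies the polynomial by y, which is what
      \<open>pCons 0\<close> does.\<close>
    show "((\<lambda>h. poly (pCons 0 (flat_poly n)) (inverse h) * exp (- inverse h)) \<longlongrightarrow> 0) (at_right (0::real))"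
      by (rule filterlim_compose[OF poly_times_exp_tendsto_0 filterlim_inverse_at_top_right])
    show "\<forall>\<^sub>F h in at_right 0. poly (pCons 0 (flat_poly n)) (inverse h) * exp (- inverse h) = flat n h / h"
      by (auto simp: flat_def eventually_at_filter field_simps)
  qed
  ultimately have "((\<lambda>h. flat n h / h) \<longlongrightarrow> 0) (at 0)"
    by (simp add: filterlim_at_split)
  then show ?thesis
    using equal by (simp add: DERIV_def flat_def)
qed

lemma flat_0_nonneg: "0 \<le> flat 0 x"
  and flat_0_pos_iff: "0 < flat 0 x \<longleftrightarrow> 0 < x"
  and flat_0_eq_0: "x \<le> 0 \<Longrightarrow> flat 0 x = 0"
  by (auto simp: flat_def)

lemma flat_0_mono: "x \<le> y \<Longrightarrow> flat 0 x \<le> flat 0 y"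
  by (auto simp: flat_def divide_simps)

text \<open>With u = 1/t the derivative is u^2 exp(-u). Squaring u/2 <= exp(u/2) bounds it by
  4.\<close>

lemma flat_0_lipschitz: "\<bar>flat 0 x - flat 0 y\<bar> \<le> 4 * \<bar>x - y\<bar>"
proof -
  have "norm (flat (Suc 0) t) \<le> 4" for t
  proof (cases "t \<le> 0")
    case False
    let ?u = "1 / t"
    have u: "0 \<le> ?u" using False by simp
    have "?u / 2 \<le> exp (?u / 2)"
      using exp_ge_add_one_self[of "?u / 2"] by linarith
    then have "(?u / 2)\<^sup>2 \<le> (exp (?u / 2))\<^sup>2"
      using u by (intro power_mono) auto
    also have "\<dots> = exp ?u" by (simp flip: exp_double)
    finally have "?u\<^sup>2 * exp (- ?u) \<le> 4 * exp ?u * exp (- ?u)"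
      by (intro mult_right_mono) (auto simp: power_divide)
    also have "\<dots> = 4"
      by (simp only: mult.assoc exp_minus_inverse mult_1_right)
    finally show ?thesis
      using False by (simp add: flat_def power2_eq_square)
  qed (simp add: flat_def)
  then have "norm (flat 0 x - flat 0 y) \<le> 4 * norm (x - y)"
    by (intro field_differentiable_bound[of UNIV _ "flat (Suc 0)"])
      (auto intro: flat_has_derivative)
  then show ?thesis by simp
qed

lemma continuous_flat: "continuous_on S (flat n)"
  using flat_has_derivative by (meson DERIV_isCont continuous_at_imp_continuous_on)

text \<open>A probability density on [-1, 1]. Building the bump as a product of two flat functions
  lets its smoothness follow from closure under products and composition.\<close>

definition kernel :: "real \<Rightarrow> real"
  where "kernel s = flat 0 (1 + s) * flat 0 (1 - s) / (\<integral>s. flat 0 (1 + s) * flat 0 (1 - s) \<partial>lborel)"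

lemma integrable_compact_support:
  fixes \<phi> :: "real \<Rightarrow> real"
  assumes "continuous_on UNIV \<phi>" "\<And>s. \<bar>s\<bar> \<ge> 1 \<Longrightarrow> \<phi> s = 0"
  shows "integrable lborel \<phi>"
proof -
  have "set_integrable lborel {-1..1} \<phi>"
    by (rule borel_integrable_atLeastAtMost') (use assms(1) continuous_on_subset in blast)
  moreover have "(\<lambda>s. indicator {-1..1} s *\<^sub>R \<phi> s) = \<phi>"
  proof
    show "indicator {-1..1} s *\<^sub>R \<phi> s = \<phi> s" for s
      using assms(2)[of s] by (cases "\<bar>s\<bar> \<ge> 1") (auto simp: indicator_def)
  qed
  ultimately show ?thesis
    by (simp add: set_integrable_def)
qed

lemma kernel_integral_pos: "0 < (\<integral>s. flat 0 (1 + s) * flat 0 (1 - s) \<partial>lborel)"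
proof -
  let ?c = "flat 0 (1/2) * flat 0 (1/2)"
  have "0 < ?c" by (simp add: flat_0_pos_iff)
  \<comment> \<open>The interval [-1/2, 1/2] has length 1, and both factors are at least
    \<open>flat 0 (1/2)\<close> on it.\<close>
  also have "?c = (\<integral>s. ?c * indicator {-1/2..1/2::real} s \<partial>lborel)"
    by simp
  also have "\<dots> \<le> (\<integral>s. flat 0 (1 + s) * flat 0 (1 - s) \<partial>lborel)"
  proof (rule integral_mono)
    show "integrable lborel (\<lambda>s. ?c * indicator {-1/2..1/2::real} s)"
      by (intro integrable_mult_right integrable_real_indicator) auto
    show "integrable lborel (\<lambda>s. flat 0 (1 + s) * flat 0 (1 - s))"
      by (rule integrable_compact_support)
        (auto intro!: continuous_intros continuous_on_compose2[OF continuous_flat[of UNIV]]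
          simp: abs_le_iff abs_if flat_0_eq_0 split: if_splits)
    show "?c * indicator {-1/2..1/2} s \<le> flat 0 (1 + s) * flat 0 (1 - s)" for s :: real
      by (auto simp: indicator_def flat_0_nonneg intro!: mult_mono flat_0_mono)
  qed
  finally show ?thesis .
qed

lemma kernel_nonneg: "0 \<le> kernel s"
  using kernel_integral_pos by (simp add: kernel_def flat_0_nonneg)

lemma kernel_eq_0: "\<bar>s\<bar> \<ge> 1 \<Longrightarrow> kernel s = 0"
  by (auto simp: kernel_def abs_if flat_0_eq_0 split: if_splits)

lemma continuous_kernel: "continuous_on UNIV kernel"
  unfolding kernel_def
  using kernel_integral_pos
  by (intro continuous_intros continuous_on_compose2[OF continuous_flat[of UNIV]]) auto

lemma integral_kernel: "(\<integral>s. kernel s \<partial>lborel) = 1"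
  using kernel_integral_pos by (simp add: kernel_def)

lemma kernel_times_integrable:
  "continuous_on UNIV \<phi> \<Longrightarrow> integrable lborel (\<lambda>s. kernel s * \<phi> s)"
  by (rule integrable_compact_support) (auto intro: continuous_intros continuous_kernel simp: kernel_eq_0)

lemma kernel_integral_bound:
  assumes "continuous_on UNIV \<phi>" "\<And>s. \<bar>s\<bar> \<le> 1 \<Longrightarrow> \<bar>\<phi> s\<bar> \<le> b"
  shows "\<bar>\<integral>s. kernel s * \<phi> s \<partial>lborel\<bar> \<le> b"
proof -
  have int: "integrable lborel (\<lambda>s. kernel s * \<phi> s)"
    by (rule kernel_times_integrable[OF assms(1)])
  have "\<bar>\<integral>s. kernel s * \<phi> s \<partial>lborel\<bar> \<le> (\<integral>s. \<bar>kernel s * \<phi> s\<bar> \<partial>lborel)"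
    by (rule integral_abs_bound)
  also have "\<dots> \<le> (\<integral>s. kernel s * b \<partial>lborel)"
  proof (rule integral_mono)
    show "integrable lborel (\<lambda>s. \<bar>kernel s * \<phi> s\<bar>)" using int by simp
    show "integrable lborel (\<lambda>s. kernel s * b)" by (intro kernel_times_integrable continuous_intros)
    show "\<bar>kernel s * \<phi> s\<bar> \<le> kernel s * b" for s
      using assms(2)[of s] kernel_nonneg[of s] kernel_eq_0[of s]
      by (cases "\<bar>s\<bar> \<le> 1") (auto simp: abs_mult intro: mult_left_mono)
  qed
  also have "\<dots> = b" by (simp add: integral_kernel)
  finally show ?thesis .
qed

subsection \<open>Averaging along finitely many directions\<close>

text \<open>A weighted average over the segment from x - d to x + d: the length of \<open>d\<close>
  is the smoothing scale, and d = 0 changes nothing.\<close>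

definition smear :: "'a::real_normed_vector \<Rightarrow> ('a \<Rightarrow> real) \<Rightarrow> 'a \<Rightarrow> real"
  where "smear d G x = (\<integral>s. kernel s * G (x + s *\<^sub>R d) \<partial>lborel)"

lemma continuous_on_line:
  assumes "L-lipschitz_on UNIV (G :: 'a::real_normed_vector \<Rightarrow> real)"
  shows "continuous_on UNIV (\<lambda>s::real. G (x + s *\<^sub>R d + y))"
  by (rule continuous_on_compose2[OF lipschitz_on_continuous_on[OF assms]]) (auto intro!: continuous_intros)

lemma smear_diff_bound:
  assumes "L-lipschitz_on UNIV G" "L-lipschitz_on UNIV H"
    and "\<And>s. \<bar>s\<bar> \<le> 1 \<Longrightarrow> \<bar>G (x + s *\<^sub>R d) - H (y + s *\<^sub>R d)\<bar> \<le> b"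
  shows "\<bar>smear d G x - smear d H y\<bar> \<le> b"
proof -
  have c: "continuous_on UNIV (\<lambda>s. G (x + s *\<^sub>R d))" "continuous_on UNIV (\<lambda>s. H (y + s *\<^sub>R d))"
    using continuous_on_line[OF assms(1), of x d 0] continuous_on_line[OF assms(2), of y d 0] by simp_all
  have "smear d G x - smear d H y = (\<integral>s. kernel s * (G (x + s *\<^sub>R d) - H (y + s *\<^sub>R d)) \<partial>lborel)"
    using kernel_times_integrable[OF c(1)] kernel_times_integrable[OF c(2)]
    by (simp add: smear_def right_diff_distrib)
  also have "\<bar>\<dots>\<bar> \<le> b"
    by (rule kernel_integral_bound) (use c assms(3) in \<open>auto intro: continuous_intros\<close>)
  finally show ?thesis .
qed

lemma smear_near:
  assumes "L-lipschitz_on UNIV G" "\<And>s. \<bar>s\<bar> \<le> 1 \<Longrightarrow> \<bar>G (x + s *\<^sub>R d) - c\<bar> \<le> b"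
  shows "\<bar>smear d G x - c\<bar> \<le> b"
proof -
  have "smear d (\<lambda>_. c) x = c"
    by (simp add: smear_def integral_kernel)
  moreover have "L-lipschitz_on UNIV (\<lambda>_::'a. c)"
    using assms(1) by (auto simp: lipschitz_on_def)
  ultimately show ?thesis
    using smear_diff_bound[of L G "\<lambda>_. c" x d x b] assms by simp
qed

lemma smear_lipschitz:
  assumes "L-lipschitz_on UNIV (G :: 'a::real_normed_vector \<Rightarrow> real)"
  shows "L-lipschitz_on UNIV (smear d G)"
proof (rule lipschitz_onI)
  fix x y :: 'a
  have "\<bar>smear d G x - smear d G y\<bar> \<le> L * dist x y"
  proof (rule smear_diff_bound[OF assms assms])
    fix s :: real
    show "\<bar>G (x + s *\<^sub>R d) - G (y + s *\<^sub>R d)\<bar> \<le> L * dist x y"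
      using lipschitz_onD[OF assms, of "x + s *\<^sub>R d" "y + s *\<^sub>R d"] by (simp add: dist_real_def)
  qed
  then show "dist (smear d G x) (smear d G y) \<le> L * dist x y"
    by (simp add: dist_real_def)
qed (rule lipschitz_on_nonneg[OF assms])

text \<open>Translating the variable of integration moves a displacement along \<open>d\<close> from
  \<open>G\<close>, which need not be differentiable, into the kernel, which is smooth.\<close>

lemma smear_shift:
  "smear d G (z + t *\<^sub>R d) = (\<integral>s. kernel (s - t) * G (z + s *\<^sub>R d) \<partial>lborel)"
  by (subst lborel_integral_real_affine[where c=1 and t=t])
    (simp_all add: smear_def scaleR_add_left add.assoc)

primrec smear_list :: "'a::real_normed_vector list \<Rightarrow> ('a \<Rightarrow> real) \<Rightarrow> 'a \<Rightarrow> real" where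
  "smear_list [] G = G"
| "smear_list (d # ds) G = smear d (smear_list ds G)"

lemma smear_list_append: "smear_list (ds @ es) G = smear_list ds (smear_list es G)"
  by (induction ds) auto

lemma smear_list_lipschitz: "L-lipschitz_on UNIV G \<Longrightarrow> L-lipschitz_on UNIV (smear_list ds G)"
  by (induction ds) (auto intro: smear_lipschitz)

lemma smear_list_diff_bound:
  assumes "L-lipschitz_on UNIV G" "L-lipschitz_on UNIV H" "\<And>x. \<bar>G x - H x\<bar> \<le> b"
  shows "\<bar>smear_list ds G x - smear_list ds H x\<bar> \<le> b"
proof (induction ds arbitrary: x)
  case (Cons d ds)
  then show ?case
    by (auto intro!: smear_diff_bound[of L] smear_list_lipschitz assms)
qed (simp add: assms)

lemma smear_list_near:
  assumes "L-lipschitz_on UNIV (G :: 'a::real_normed_vector \<Rightarrow> real)"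
  shows "\<bar>smear_list ds G x - G x\<bar> \<le> L * (\<Sum>d\<leftarrow>ds. norm d)"
proof (induction ds arbitrary: x)
  case (Cons d ds)
  have L: "L \<ge> 0" by (rule lipschitz_on_nonneg[OF assms])
  have "\<bar>smear_list ds G (x + s *\<^sub>R d) - G x\<bar> \<le> L * norm d + L * (\<Sum>d\<leftarrow>ds. norm d)" if "\<bar>s\<bar> \<le> 1" for s
  proof -
    have "\<bar>G (x + s *\<^sub>R d) - G x\<bar> \<le> L * (\<bar>s\<bar> * norm d)"
      using lipschitz_onD[OF assms, of "x + s *\<^sub>R d" x] by (simp add: dist_norm)
    also have "\<dots> \<le> L * norm d"
      using L that by (intro mult_left_mono) (auto simp: mult_left_le_one_le)
    finally show ?thesis
      using Cons[of "x + s *\<^sub>R d"] by linarith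
  qed
  from smear_near[OF smear_list_lipschitz[OF assms] this]
  show ?case by (simp add: distrib_left)
qed simp

text \<open>The average at \<open>x\<close> only samples \<open>G\<close> within distance
  \<open>(\<Sum>d\<leftarrow>ds. norm d)\<close> of \<open>x\<close>.\<close>

lemma smear_list_eq_0:
  assumes "L-lipschitz_on UNIV (G :: 'a::real_normed_vector \<Rightarrow> real)" "\<And>x. norm x \<ge> R \<Longrightarrow> G x = 0"
    and "norm x \<ge> R + (\<Sum>d\<leftarrow>ds. norm d)"
  shows "smear_list ds G x = 0"
  using assms(3)
proof (induction ds arbitrary: x)
  case (Cons d ds)
  have "\<bar>smear_list ds G (x + s *\<^sub>R d) - 0\<bar> \<le> 0" if "\<bar>s\<bar> \<le> 1" for s
  proof -
    have "\<bar>s\<bar> * norm d \<le> norm d" using that by (simp add: mult_left_le_one_le)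
    then have "norm x - norm d \<le> norm (x + s *\<^sub>R d)"
      using norm_triangle_ineq4[of "x + s *\<^sub>R d" "s *\<^sub>R d"] by simp
    then show ?thesis using Cons by simp
  qed
  from smear_near[OF smear_list_lipschitz[OF assms(1)] this]
  show ?case by simp
qed (simp add: assms)

section \<open>Smoothness of averages at a point moving in the averaged directions\<close>

lemma family_addI:
  "f \<in> A \<Longrightarrow> g \<in> B \<Longrightarrow> (\<lambda>x. f x + g x) \<in> {\<lambda>x. f x + g x | f g. f \<in> A \<and> g \<in> B}"
  by blast

lemma family_multI:
  "f \<in> A \<Longrightarrow> g \<in> B \<Longrightarrow> (\<lambda>x. f x * g x) \<in> {\<lambda>x. f x * g x | f g. f \<in> A \<and> g \<in> B}"
  by blast

lemma family_composeI:
  "f \<in> A \<Longrightarrow> (\<lambda>x. H (f x)) \<in> {\<lambda>x. H (f x) | f. f \<in> A}"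
  by blast

lemma bdd_deriv_add_consts:
  assumes "open U" "bdd_deriv k U {\<psi>}"
  shows "bdd_deriv k U {\<lambda>x. a + b * \<psi> x | a. \<bar>a\<bar> \<le> A}"
proof -
  have "bdd_deriv k U {\<lambda>x. c | c. \<bar>c\<bar> \<le> \<bar>b\<bar>}" "bdd_deriv k U {\<lambda>x. c | c. \<bar>c\<bar> \<le> A}"
    by (rule bdd_deriv_const)+
  from bdd_deriv_add[OF this(2) bdd_deriv_mult[OF assms(1) this(1) assms(2)]]
  show ?thesis
  proof (rule bdd_deriv_mono[OF assms(1)], intro subsetI)
    fix f assume "f \<in> {\<lambda>x. a + b * \<psi> x | a. \<bar>a\<bar> \<le> A}"
    then obtain a where a: "\<bar>a\<bar> \<le> A" "f = (\<lambda>x. a + b * \<psi> x)" by blast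
    show "f \<in> {\<lambda>x. f x + g x | f g. f \<in> {\<lambda>x. c | c. \<bar>c\<bar> \<le> A} \<and>
        g \<in> {\<lambda>x. f x * g x | f g. f \<in> {\<lambda>x. c | c. \<bar>c\<bar> \<le> \<bar>b\<bar>} \<and> g \<in> {\<psi>}}}"
      unfolding a(2) by (intro family_addI family_multI) (use a(1) in auto)
  qed
qed

lemma bdd_deriv_kernel:
  assumes "open U" "bdd_deriv k U {\<psi>}"
  shows "bdd_deriv k U {\<lambda>x. kernel (s - \<psi> x) | s. \<bar>s\<bar> \<le> A}"
proof -
  let ?c = "1 / (\<integral>s. flat 0 (1 + s) * flat 0 (1 - s) \<partial>lborel)"
  let ?P = "\<lambda>A B. {\<lambda>x. f x * g x | f g. f \<in> A \<and> g \<in> B}"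
  \<comment> \<open>The arguments of the two flat factors are 1 + s - psi(x) and 1 - s + psi(x);
    their constant parts are at most A + 1 in absolute value.\<close>
  let ?A = "\<lambda>b. {\<lambda>x. a + b * \<psi> x | a. \<bar>a\<bar> \<le> A + 1}"
  have *: "bdd_deriv k U {\<lambda>x. flat 0 (f x) | f. f \<in> ?A b}" for b
    by (rule bdd_deriv_compose[where H=flat, OF assms(1) flat_has_derivative bdd_deriv_add_consts[OF assms]])
  have c: "bdd_deriv k U {\<lambda>x. c | c. \<bar>c\<bar> \<le> \<bar>?c\<bar>}" by (rule bdd_deriv_const)
  show ?thesis
  proof (rule bdd_deriv_cong[OF assms(1) bdd_deriv_mult[OF assms(1) c bdd_deriv_mult[OF assms(1) *[of "-1"] *[of 1]]]])
    fix f' assume "f' \<in> {\<lambda>x. kernel (s - \<psi> x) | s. \<bar>s\<bar> \<le> A}"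
    then obtain s where s: "\<bar>s\<bar> \<le> A" "f' = (\<lambda>x. kernel (s - \<psi> x))" by blast
    have mem: "(\<lambda>x. a + b * \<psi> x) \<in> ?A b" if "\<bar>a\<bar> \<le> A + 1" for a b
      using that by blast
    have 1: "(\<lambda>x. (1 + s) + (- 1) * \<psi> x) \<in> ?A (-1)" "(\<lambda>x. (1 - s) + 1 * \<psi> x) \<in> ?A 1"
      using s(1) by (intro mem; linarith)+
    show "\<exists>f\<in>?P {\<lambda>x. c | c. \<bar>c\<bar> \<le> \<bar>?c\<bar>} (?P {\<lambda>x. flat 0 (f x) | f. f \<in> ?A (-1)} {\<lambda>x. flat 0 (f x) | f. f \<in> ?A 1}).
        \<forall>x\<in>U. f' x = f x"
    proof (rule bexI)
      show "\<forall>x\<in>U. f' x = ?c * (flat 0 ((1 + s) + (- 1) * \<psi> x) * flat 0 ((1 - s) + 1 * \<psi> x))"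
        by (simp add: s(2) kernel_def algebra_simps)
      show "(\<lambda>x. ?c * (flat 0 ((1 + s) + (- 1) * \<psi> x) * flat 0 ((1 - s) + 1 * \<psi> x)))
        \<in> ?P {\<lambda>x. c | c. \<bar>c\<bar> \<le> \<bar>?c\<bar>} (?P {\<lambda>x. flat 0 (f x) | f. f \<in> ?A (-1)} {\<lambda>x. flat 0 (f x) | f. f \<in> ?A 1})"
        by (intro family_multI family_composeI[where H="flat 0"] 1) auto
    qed
  qed
qed

text \<open>Although \<open>G\<close> is only Lipschitz, the composite has bounded derivatives to
  the order shared by the coordinates, because all motion takes place in averaged directions.
  \<open>smear_shift\<close> turns the first direction into an integral over s of kernel(s - psi(x))
  times the composite for the remaining directions with base point z + s d. This is why the base
  point ranges over a bounded set: the induction hypothesis must hold uniformly in s. With no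
  direction left, only constants remain.\<close>

lemma bdd_deriv_smear_list:
  fixes G :: "'a::real_normed_vector \<Rightarrow> real"
  assumes U: "open U" and G: "L-lipschitz_on UNIV G"
    and "\<And>\<psi> d. (\<psi>, d) \<in> set ps \<Longrightarrow> bdd_deriv k U {\<psi>}"
    and "\<And>\<psi> d x. (\<psi>, d) \<in> set ps \<Longrightarrow> x \<in> U \<Longrightarrow> \<bar>\<psi> x\<bar> \<le> K"
    and "bounded Z"
  shows "bdd_deriv k U {\<lambda>x. smear_list (map snd ps) G (z + (\<Sum>(\<psi>, d)\<leftarrow>ps. \<psi> x *\<^sub>R d)) | z. z \<in> Z}"
  using assms(3-)
proof (induction ps arbitrary: Z)
  case Nil
  obtain D where D: "\<And>z. z \<in> Z \<Longrightarrow> norm z \<le> D"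
    using Nil(3) bounded_iff by blast
  have "\<bar>G z\<bar> \<le> \<bar>G 0\<bar> + L * D" if "z \<in> Z" for z
  proof -
    have "L * norm z \<le> L * D"
      using D[OF that] lipschitz_on_nonneg[OF G] by (rule mult_left_mono)
    then show ?thesis
      using lipschitz_onD[OF G, of z 0] by (simp add: dist_real_def dist_norm)
  qed
  then show ?case
    by (intro bdd_deriv_mono[OF U bdd_deriv_const[of k U "\<bar>G 0\<bar> + L * D"]]) auto
next
  case (Cons p ps)
  obtain \<psi> d where p: "p = (\<psi>, d)" by force
  define H where "H = smear_list (map snd ps) G"
  define w where "w = (\<lambda>x. \<Sum>(\<psi>, d)\<leftarrow>ps. \<psi> x *\<^sub>R d)"
  \<comment> \<open>The coordinate is at most \<open>K\<close> in absolute value and the kernel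
    lives on [-1, 1], so the integrand vanishes for |s| > R and a finite measure suffices.\<close>
  define R where "R = \<bar>K\<bar> + 1"
  define M where "M = restrict_space lborel {-R..R}"
  define \<A> where "\<A> = {\<lambda>s x. kernel (s - \<psi> x) * H (z + s *\<^sub>R d + w x) | z. z \<in> Z}"
  have spM: "space M = {-R..R}"
    by (simp add: M_def space_restrict_space)
  have H: "L-lipschitz_on UNIV H"
    unfolding H_def by (rule smear_list_lipschitz[OF G])
  have finM: "finite_measure M"
    by (rule finite_measureI) (simp add: spM, simp add: M_def emeasure_restrict_space emeasure_lborel_Icc_eq)
  have \<psi>: "bdd_deriv k U {\<psi>}" "\<And>x. x \<in> U \<Longrightarrow> \<bar>\<psi> x\<bar> \<le> K"
    using Cons.prems(1)[of \<psi> d] Cons.prems(2)[of \<psi> d] p by auto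
  \<comment> \<open>All base points that occur after the first direction has become an integration
    variable.\<close>
  let ?Z = "(\<lambda>(z, s). z + s *\<^sub>R d) ` (Z \<times> {-R..R})"
  have "bounded ?Z"
  proof -
    have "?Z = (\<Union>x\<in>Z. \<Union>y\<in>(\<lambda>s. s *\<^sub>R d) ` {-R..R}. {x + y})" by force
    moreover have "bounded ((\<lambda>s. s *\<^sub>R d) ` {-R..R})"
      by (intro compact_imp_bounded compact_continuous_image continuous_intros) auto
    ultimately show ?thesis
      by (simp only: bounded_sums[OF Cons.prems(3)])
  qed
  then have IH: "bdd_deriv k U {\<lambda>x. H (z + w x) | z. z \<in> ?Z}"
    unfolding H_def w_def
    by (intro Cons.IH Cons.prems(1)[OF list.set_intros(2)] Cons.prems(2)[OF list.set_intros(2)])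
  have meas: "(\<lambda>s. \<alpha> s x) \<in> borel_measurable M" if "\<alpha> \<in> \<A>" for \<alpha> x
  proof -
    obtain z where \<alpha>: "\<alpha> = (\<lambda>s x. kernel (s - \<psi> x) * H (z + s *\<^sub>R d + w x))"
      using \<open>\<alpha> \<in> \<A>\<close> by (auto simp: \<A>_def)
    have "continuous_on UNIV (\<lambda>s. kernel (s - \<psi> x) * H (z + s *\<^sub>R d + w x))"
      by (intro continuous_intros continuous_on_line[OF H] continuous_on_compose2[OF continuous_kernel]) auto
    then show ?thesis
      unfolding \<alpha> M_def by (intro measurable_restrict_space1) (simp add: borel_measurable_continuous_onI)
  qed
  have "bdd_deriv k U {\<lambda>x. \<integral>s. \<alpha> s x \<partial>M | \<alpha>. \<alpha> \<in> \<A>}"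
  proof (rule bdd_deriv_integral[OF finM U])
    show "(\<lambda>s. \<alpha> s x) \<in> borel_measurable M" if "\<alpha> \<in> \<A>" for \<alpha> x
      using that by (rule meas)
    show "bdd_deriv k U {\<alpha> s | \<alpha> s. \<alpha> \<in> \<A> \<and> s \<in> space M}"
    proof (rule bdd_deriv_mono[OF U bdd_deriv_mult[OF U bdd_deriv_kernel[OF U \<psi>(1), of R] IH]], safe)
      fix \<alpha> s assume "\<alpha> \<in> \<A>" "s \<in> space M"
      then obtain z where z: "z \<in> Z" "\<alpha> = (\<lambda>s x. kernel (s - \<psi> x) * H (z + s *\<^sub>R d + w x))" "\<bar>s\<bar> \<le> R"
        by (auto simp: \<A>_def spM)
      then have "z + s *\<^sub>R d \<in> ?Z" by force
      then show "\<exists>f g. \<alpha> s = (\<lambda>x. f x * g x) \<and> f \<in> {\<lambda>x. kernel (s - \<psi> x) | s. \<bar>s\<bar> \<le> R} \<and>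
          g \<in> {\<lambda>x. H (z + w x) | z. z \<in> ?Z}"
        unfolding z(2) using z(3)
        by (intro exI[of _ "\<lambda>x. kernel (s - \<psi> x)"] exI[of _ "\<lambda>x. H (z + s *\<^sub>R d + w x)"] conjI refl) blast+
    qed
  qed
  then show ?case
  proof (rule bdd_deriv_cong[OF U])
    fix f' assume "f' \<in> {\<lambda>x. smear_list (map snd (p # ps)) G (z + (\<Sum>(\<psi>, d)\<leftarrow>p # ps. \<psi> x *\<^sub>R d)) | z. z \<in> Z}"
    then obtain z where z: "z \<in> Z" "f' = (\<lambda>x. smear d H ((z + w x) + \<psi> x *\<^sub>R d))"
      by (auto simp: p H_def w_def add_ac)
    let ?\<alpha> = "\<lambda>s x. kernel (s - \<psi> x) * H (z + s *\<^sub>R d + w x)"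
    have "f' x = (\<integral>s. ?\<alpha> s x \<partial>M)" if "x \<in> U" for x
    proof -
      have "kernel (s - \<psi> x) = 0" if "s \<notin> {-R..R}" for s
        using that \<psi>(2)[OF \<open>x \<in> U\<close>] by (intro kernel_eq_0) (auto simp: R_def)
      then have ind: "indicator {-R..R} s *\<^sub>R ?\<alpha> s x = ?\<alpha> s x" for s
        by (auto simp: indicator_def)
      have "(\<integral>s. ?\<alpha> s x \<partial>M) = (\<integral>s. indicator {-R..R} s *\<^sub>R ?\<alpha> s x \<partial>lborel)"
        unfolding M_def by (rule integral_restrict_space) simp
      also have "\<dots> = (\<integral>s. ?\<alpha> s x \<partial>lborel)"
        by (simp only: ind)
      also have "\<dots> = f' x"
        unfolding z(2) smear_shift by (simp add: add_ac)
      finally show ?thesis by simp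
    qed
    then show "\<exists>f\<in>{\<lambda>x. \<integral>s. \<alpha> s x \<partial>M | \<alpha>. \<alpha> \<in> \<A>}. \<forall>x\<in>U. f' x = f x"
      using z(1) by (intro bexI[of _ "\<lambda>x. \<integral>s. ?\<alpha> s x \<partial>M"]) (auto simp: \<A>_def)
  qed
qed

text \<open>The last property is what smoothness will use: for each \<open>N\<close> the limit is an
  average along the first \<open>N\<close> directions of a function that is still Lipschitz. That
  function is the limit \<open>G N\<close> of the averages starting at index
  \<open>N\<close>.\<close>

lemma smear_limit:
  fixes f :: "'a::real_normed_vector \<Rightarrow> real"
  assumes f: "L-lipschitz_on UNIV f" and \<eta>: "0 < \<eta>" and d: "\<And>n. norm (d n) \<le> \<eta> / 2 ^ Suc n"
  obtains F where "L-lipschitz_on UNIV F" "\<And>x. \<bar>F x - f x\<bar> \<le> L * \<eta>"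
    "\<And>R x. (\<And>x. norm x \<ge> R \<Longrightarrow> f x = 0) \<Longrightarrow> norm x \<ge> R + \<eta> \<Longrightarrow> F x = 0"
    "\<And>N. \<exists>G. L-lipschitz_on UNIV G \<and> F = smear_list (map d [0..<N]) G"
proof -
  have L: "L \<ge> 0" by (rule lipschitz_on_nonneg[OF f])
  define A where "A k m = smear_list (map d [k..<k + m]) f" for k m
  have sum_le: "(\<Sum>e\<leftarrow>map d [k..<k + m]. norm e) \<le> \<eta> / 2 ^ k" for k m
  proof -
    \<comment> \<open>The subtracted remainder of the geometric series makes the induction
      close.\<close>
    have "(\<Sum>e\<leftarrow>map d [k..<k + m]. norm e) \<le> \<eta> / 2 ^ k - \<eta> / 2 ^ (k + m)"
    proof (induction m)
      case (Suc m)
      have "\<eta> / 2 ^ (k + m) = 2 * (\<eta> / 2 ^ Suc (k + m))" by simp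
      then show ?case using d[of "k + m"] Suc by simp
    qed simp
    then show ?thesis using \<eta> by (smt (verit) divide_pos_pos zero_less_power)
  qed
  have A_split: "A k (m + j) = smear_list (map d [k..<k + m]) (A (k + m) j)" for k m j
    using upt_add_eq_append[of k "k + m" j] by (simp add: A_def add.assoc smear_list_append)
  have A_lip: "L-lipschitz_on UNIV (A k m)" for k m
    unfolding A_def by (rule smear_list_lipschitz[OF f])
  have A_near: "\<bar>A k m x - f x\<bar> \<le> L * (\<eta> / 2 ^ k)" for k m x
    unfolding A_def by (rule order_trans[OF smear_list_near[OF f]]) (intro mult_left_mono sum_le L)
  \<comment> \<open>The additional directions act innermost, where they change \<open>f\<close> by
    at most the tail of the series, and the outer averages do not increase uniform
    distances.\<close>
  have A_cauchy: "\<bar>A k (m + j) x - A k m x\<bar> \<le> L * (\<eta> / 2 ^ (k + m))" for k m j x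
  proof -
    have "A k m = smear_list (map d [k..<k + m]) f" by (simp add: A_def)
    then show ?thesis
      unfolding A_split[of k m j] by (simp only:) (rule smear_list_diff_bound[OF A_lip f A_near])
  qed
  have tail: "(\<lambda>m. L * (\<eta> / 2 ^ (k + m))) \<longlonglongrightarrow> 0" for k
  proof -
    have "(\<lambda>m. L * \<eta> / 2 ^ k * (1 / 2) ^ m) \<longlonglongrightarrow> L * \<eta> / 2 ^ k * 0"
      by (intro tendsto_intros LIMSEQ_power_zero) auto
    then show ?thesis by (simp add: power_add power_one_over divide_simps)
  qed
  have conv: "convergent (\<lambda>m. A k m x)" for k x
  proof (rule Cauchy_convergent, rule metric_CauchyI)
    fix e :: real assume "e > 0"
    then obtain M where M: "L * (\<eta> / 2 ^ (k + M)) < e / 2"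
      using order_tendstoD(2)[OF tail[of k], of "e / 2"] by (auto simp: eventually_sequentially)
    have near: "\<bar>A k m x - A k M x\<bar> < e / 2" if "m \<ge> M" for m
      using order_le_less_trans[OF A_cauchy[of k M "m - M" x] M] that by simp
    then have "dist (A k m x) (A k n x) < e" if "m \<ge> M" "n \<ge> M" for m n
      unfolding dist_real_def using near[OF that(1)] near[OF that(2)] by linarith
    then show "\<exists>M. \<forall>m\<ge>M. \<forall>n\<ge>M. dist (A k m x) (A k n x) < e" by blast
  qed
  define G where "G k x = lim (\<lambda>m. A k m x)" for k x
  have G: "(\<lambda>m. A k m x) \<longlonglongrightarrow> G k x" for k x
    unfolding G_def using conv[of k x] by (simp add: convergent_LIMSEQ_iff)
  have G_lip: "L-lipschitz_on UNIV (G k)" for k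
  proof (rule lipschitz_onI)
    fix x y
    have "(\<lambda>m. dist (A k m x) (A k m y)) \<longlonglongrightarrow> dist (G k x) (G k y)"
      by (intro tendsto_intros G)
    then show "dist (G k x) (G k y) \<le> L * dist x y"
      by (rule LIMSEQ_le_const2) (use lipschitz_onD[OF A_lip] in auto)
  qed (rule L)
  have G_near: "\<bar>G k x - A k m x\<bar> \<le> L * (\<eta> / 2 ^ (k + m))" for k m x
  proof -
    have "(\<lambda>j. \<bar>A k (j + m) x - A k m x\<bar>) \<longlonglongrightarrow> \<bar>G k x - A k m x\<bar>"
      by (intro tendsto_intros LIMSEQ_ignore_initial_segment G)
    then show ?thesis
      by (rule LIMSEQ_le_const2) (use A_cauchy[of k m _ x] in \<open>auto simp: add.commute\<close>)
  qed
  show ?thesis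
  proof
    show "L-lipschitz_on UNIV (G 0)" by (rule G_lip)
    show "\<bar>G 0 x - f x\<bar> \<le> L * \<eta>" for x
      using G_near[of 0 x 0] by (simp add: A_def)
    show "G 0 x = 0" if R: "\<And>x. norm x \<ge> R \<Longrightarrow> f x = 0" "norm x \<ge> R + \<eta>" for R x
    proof -
      have "A 0 m x = 0" for m
        unfolding A_def
        by (rule smear_list_eq_0[OF f R(1)]) (use R(2) sum_le[of 0 m] in auto)
      then show ?thesis using G[of 0 x] by (simp add: LIMSEQ_const_iff)
    qed
    show "\<exists>G'. L-lipschitz_on UNIV G' \<and> G 0 = smear_list (map d [0..<N]) G'" for N
    proof (intro exI conjI ext)
      show "L-lipschitz_on UNIV (G N)" by (rule G_lip)
      fix x
      let ?S = "smear_list (map d [0..<N])"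
      have "\<bar>A 0 (N + m) x - ?S (G N) x\<bar> \<le> L * (\<eta> / 2 ^ (N + m))" for m
        unfolding A_split add_0
        by (rule smear_list_diff_bound[OF A_lip G_lip])
          (use G_near[of N _ m] in \<open>simp add: abs_minus_commute\<close>)
      then have "(\<lambda>m. A 0 (N + m) x - ?S (G N) x) \<longlonglongrightarrow> 0"
        by (intro Lim_null_comparison[OF _ tail[of N]]) (simp add: always_eventually)
      then have "(\<lambda>m. A 0 (m + N) x) \<longlonglongrightarrow> ?S (G N) x"
        using LIM_zero_iff[of "\<lambda>m. A 0 (N + m) x"] by (simp add: add.commute)
      moreover have "(\<lambda>m. A 0 (m + N) x) \<longlonglongrightarrow> G 0 x"
        by (rule LIMSEQ_ignore_initial_segment[OF G])
      ultimately show "G 0 x = ?S (G N) x"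
        using LIMSEQ_unique by blast
    qed
  qed
qed

section \<open>Smoothness of the elementary building blocks\<close>

lemma bdd_deriv_const1: "bdd_deriv k U {\<lambda>x. c}"
proof -
  have "open (UNIV :: 'a set)" by simp
  from bdd_deriv_subset_domain[OF bdd_deriv_mono[OF this bdd_deriv_const[of k UNIV "\<bar>c\<bar>"]], of "{\<lambda>x. c}" U]
  show ?thesis by auto
qed

lemma bdd_deriv_add1:
  assumes "open U" "bdd_deriv k U {f}" "bdd_deriv k U {g}"
  shows "bdd_deriv k U {\<lambda>x. f x + g x}"
  by (rule bdd_deriv_mono[OF assms(1) bdd_deriv_add[OF assms(2,3)]]) auto

lemma bdd_deriv_mult1:
  assumes "open U" "bdd_deriv k U {f}" "bdd_deriv k U {g}"
  shows "bdd_deriv k U {\<lambda>x. f x * g x}"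
  by (rule bdd_deriv_mono[OF assms(1) bdd_deriv_mult[OF assms]]) auto

lemma bdd_deriv_flat1:
  assumes "open U" "bdd_deriv k U {f}"
  shows "bdd_deriv k U {\<lambda>x. flat n (f x)}"
  by (rule bdd_deriv_mono[OF assms(1) bdd_deriv_compose[where H=flat, OF assms(1) flat_has_derivative assms(2), of n]]) auto

lemma bdd_deriv_sum1:
  assumes "open U" "\<And>i. i < (n::nat) \<Longrightarrow> bdd_deriv k U {f i}"
  shows "bdd_deriv k U {\<lambda>x. \<Sum>i<n. f i x}"
  using assms(2) by (induction n) (simp_all add: bdd_deriv_const1 bdd_deriv_add1[OF assms(1)])

lemma bdd_deriv_inner: "bdd_deriv k U {\<lambda>x::'a::real_inner. x \<bullet> a | a. norm a \<le> R}"
proof -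
  have 0: "bdd_deriv 0 U {\<lambda>x::'a. x \<bullet> a | a. norm a \<le> R}"
    unfolding bdd_deriv.simps
  proof
    fix x :: 'a
    have "\<bar>y \<bullet> a\<bar> \<le> (norm x + 1) * R" if "dist y x < 1" "norm a \<le> R" for y a
    proof -
      have "norm y \<le> norm x + 1"
        using that(1) norm_triangle_sub[of y x] by (simp add: dist_norm)
      then have "norm y * norm a \<le> (norm x + 1) * R"
        using that(2) by (intro mult_mono) auto
      then show ?thesis using Cauchy_Schwarz_ineq2[of y a] by linarith
    qed
    then have "\<forall>\<^sub>F y in nhds x. \<forall>f\<in>{\<lambda>x. x \<bullet> a | a. norm a \<le> R}. \<bar>f y\<bar> \<le> (norm x + 1) * R"
      unfolding eventually_nhds_metric by (intro exI[of _ 1]) auto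
    then show "\<exists>C. \<forall>\<^sub>F y in nhds x. \<forall>f\<in>{\<lambda>x. x \<bullet> a | a. norm a \<le> R}. \<bar>f y\<bar> \<le> C"
      by blast
  qed
  show ?thesis
  proof (cases k)
    case (Suc j)
    have "\<exists>g\<in>{\<lambda>x. c | c. \<bar>c\<bar> \<le> R}. \<forall>x\<in>U. ((\<lambda>t. f (x + t *\<^sub>R v)) has_real_derivative g x) (at 0)"
      if f: "f \<in> {\<lambda>x::'a. x \<bullet> a | a. norm a \<le> R}" and v: "norm v \<le> 1" for f v
    proof -
      obtain a where a: "norm a \<le> R" "f = (\<lambda>x. x \<bullet> a)" using f by blast
      have "\<bar>v \<bullet> a\<bar> \<le> norm v * norm a" by (rule Cauchy_Schwarz_ineq2)
      also have "\<dots> \<le> 1 * R" using a(1) v by (intro mult_mono) auto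
      finally have "(\<lambda>x. v \<bullet> a) \<in> {\<lambda>x. c | c. \<bar>c\<bar> \<le> R}" by auto
      moreover have "((\<lambda>t. f (x + t *\<^sub>R v)) has_real_derivative v \<bullet> a) (at 0)" for x
        unfolding a(2) by (auto intro!: derivative_eq_intros simp: inner_add_left)
      ultimately show ?thesis by (intro bexI[of _ "\<lambda>x. v \<bullet> a"] ballI)
    qed
    then show ?thesis
      unfolding Suc bdd_deriv.simps(2) using 0 bdd_deriv_const[of j U R]
      by (intro conjI exI[of _ "{\<lambda>x. c | c. \<bar>c\<bar> \<le> R}"] ballI allI impI)
  qed (use 0 in simp)
qed

lemma bdd_deriv_inner1:
  assumes "open U"
  shows "bdd_deriv k U {\<lambda>x::'a::real_inner. x \<bullet> a}"
  by (rule bdd_deriv_mono[OF assms bdd_deriv_inner[of k U "norm a"]]) auto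

lemma bdd_deriv_inner_self:
  assumes "open U"
  shows "bdd_deriv k U {\<lambda>x::'a::real_inner. x \<bullet> x}"
proof -
  have 0: "bdd_deriv 0 U {\<lambda>x::'a. x \<bullet> x}"
    unfolding bdd_deriv.simps
  proof
    fix x :: 'a
    have "((\<lambda>y. \<bar>y \<bullet> y\<bar>) \<longlongrightarrow> \<bar>x \<bullet> x\<bar>) (nhds x)"
      by (intro tendsto_intros filterlim_ident)
    then have "\<forall>\<^sub>F y in nhds x. \<bar>y \<bullet> y\<bar> < \<bar>x \<bullet> x\<bar> + 1"
      by (rule order_tendstoD) simp
    then have "\<forall>\<^sub>F y in nhds x. \<forall>f\<in>{\<lambda>x. x \<bullet> x}. \<bar>f y\<bar> \<le> \<bar>x \<bullet> x\<bar> + 1"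
      by eventually_elim simp
    then show "\<exists>C. \<forall>\<^sub>F y in nhds x. \<forall>f\<in>{\<lambda>x. x \<bullet> x}. \<bar>f y\<bar> \<le> C"
      by blast
  qed
  show ?thesis
  proof (cases k)
    case (Suc j)
    have "\<exists>g\<in>{\<lambda>x. x \<bullet> a | a. norm a \<le> 2}. \<forall>x\<in>U. ((\<lambda>t. f (x + t *\<^sub>R v)) has_real_derivative g x) (at 0)"
      if f: "f \<in> {\<lambda>x::'a. x \<bullet> x}" and v: "norm v \<le> 1" for f v
    proof -
      have "(\<lambda>x. x \<bullet> (2 *\<^sub>R v)) \<in> {\<lambda>x. x \<bullet> a | a. norm a \<le> 2}"
      proof -
        have "norm (2 *\<^sub>R v) \<le> 2" using v by simp
        then show ?thesis by blast
      qed
      moreover have "((\<lambda>t. f (x + t *\<^sub>R v)) has_real_derivative x \<bullet> (2 *\<^sub>R v)) (at 0)" for x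
        using f by (auto intro!: derivative_eq_intros simp: inner_commute inner_add_left inner_add_right)
      ultimately show ?thesis by (intro bexI[of _ "\<lambda>x. x \<bullet> (2 *\<^sub>R v)"] ballI)
    qed
    then show ?thesis
      unfolding Suc bdd_deriv.simps(2) using 0 bdd_deriv_inner[of j U 2]
      by (intro conjI exI[of _ "{\<lambda>x. x \<bullet> a | a. norm a \<le> 2}"] ballI allI impI)
  qed (use 0 in simp)
qed

subsection \<open>A smooth retraction onto locally finite-dimensional sections\<close>

text \<open>Zero vectors are allowed, so that finite-dimensional spaces need no separate treatment.\<close>

locale orthonormal_or_zero =
  fixes e :: "nat \<Rightarrow> 'a::real_inner"
  assumes orthogonal: "i \<noteq> j \<Longrightarrow> e i \<bullet> e j = 0"
    and normalized: "e i = 0 \<or> norm (e i) = 1"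
begin

text \<open>The component of \<open>x\<close> orthogonal to the first \<open>n\<close> vectors of
  the sequence.\<close>

definition tail :: "nat \<Rightarrow> 'a \<Rightarrow> 'a"
  where "tail n x = x - (\<Sum>i<n. (x \<bullet> e i) *\<^sub>R e i)"

lemma tail_0: "tail 0 x = x"
  by (simp add: tail_def)

lemma tail_Suc: "tail (Suc n) x = tail n x - (x \<bullet> e n) *\<^sub>R e n"
  by (simp add: tail_def)

lemma tail_diff: "tail n (x - y) = tail n x - tail n y"
  by (simp add: tail_def inner_diff_left scaleR_diff_left sum_subtractf)

lemma tail_inner: "tail n x \<bullet> e n = x \<bullet> e n"
  by (simp add: tail_def inner_diff_left inner_sum_left orthogonal)

lemma norm_tail_Suc: "(norm (tail (Suc n) x))\<^sup>2 = (norm (tail n x))\<^sup>2 - (x \<bullet> e n)\<^sup>2"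
proof -
  let ?c = "x \<bullet> e n"
  have "(norm (tail (Suc n) x))\<^sup>2 = (norm (tail n x))\<^sup>2 - 2 * ?c * (tail n x \<bullet> e n) + ?c\<^sup>2 * (e n \<bullet> e n)"
    unfolding tail_Suc power2_norm_eq_inner
    by (simp add: inner_diff_left inner_diff_right inner_commute power2_eq_square algebra_simps)
  moreover have "?c\<^sup>2 * (e n \<bullet> e n) = ?c\<^sup>2"
    using normalized[of n] by (auto simp: norm_eq_1)
  ultimately show ?thesis
    by (simp add: tail_inner power2_eq_square)
qed

text \<open>This form exhibits the squared norm as a finite combination of sums and products of
  inner products, ready for the closure rules of \<open>bdd_deriv\<close>.\<close>

lemma norm_tail_eq: "(norm (tail n x))\<^sup>2 = x \<bullet> x + (\<Sum>i<n. - 1 * ((x \<bullet> e i) * (x \<bullet> e i)))"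
proof (induction n)
  case 0
  show ?case by (simp add: tail_0 power2_norm_eq_inner)
next
  case (Suc n)
  then show ?case by (simp add: norm_tail_Suc flip: power2_eq_square)
qed

lemma norm_tail_antimono: "m \<le> n \<Longrightarrow> norm (tail n x) \<le> norm (tail m x)"
proof (induction n rule: dec_induct)
  case (step n)
  have "(norm (tail (Suc n) x))\<^sup>2 \<le> (norm (tail n x))\<^sup>2"
    by (simp add: norm_tail_Suc)
  then have "norm (tail (Suc n) x) \<le> norm (tail n x)"
    by (rule power2_le_imp_le) simp
  with step show ?case by simp
qed simp

lemma norm_tail_le: "norm (tail n x) \<le> norm x"
  using norm_tail_antimono[of 0 n x] by (simp add: tail_0)

lemma norm_tail_diff_le: "\<bar>norm (tail n x) - norm (tail n y)\<bar> \<le> norm (x - y)"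
  using norm_triangle_ineq3[of "tail n x" "tail n y"] norm_tail_le[of n "x - y"]
  by (simp add: tail_diff)

lemma norm_sum_le: "(norm (\<Sum>i<n. a i *\<^sub>R e i))\<^sup>2 \<le> (\<Sum>i<n. (a i)\<^sup>2)"
proof -
  have "(norm (\<Sum>i<n. a i *\<^sub>R e i))\<^sup>2 = (\<Sum>i<n. (norm (a i *\<^sub>R e i))\<^sup>2)"
    by (rule norm_sum_Pythagorean) (auto simp: pairwise_def orthogonal_def orthogonal)
  also have "\<dots> \<le> (\<Sum>i<n. (a i)\<^sup>2)"
  proof (rule sum_mono)
    fix i
    show "(norm (a i *\<^sub>R e i))\<^sup>2 \<le> (a i)\<^sup>2"
      using normalized[of i] by auto
  qed
  finally show ?thesis .
qed

text \<open>
  Coefficients that vanish as long as the tail exceeds \<open>b\<close> produce a vector of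
  norm \<open>O(b)\<close>, however many of them are nonzero.  This makes the
  Lipschitz constant of the retraction below independent of the number of cutoffs in transition.
\<close>

lemma norm_masked_sum_le:
  assumes "0 \<le> b" "0 \<le> C" "\<And>i. i < n \<Longrightarrow> \<bar>c i\<bar> \<le> C"
    and "\<And>i. i < n \<Longrightarrow> norm (tail i y) > b \<Longrightarrow> c i = 0"
  shows "norm (\<Sum>i<n. (c i * (y \<bullet> e i)) *\<^sub>R e i) \<le> C * b"
proof -
  let ?S = "\<lambda>m. \<Sum>i<m. if norm (tail i y) \<le> b then (y \<bullet> e i)\<^sup>2 else 0"
  \<comment> \<open>While the tail exceeds \<open>b\<close> the masked sum is empty and the minimum
    is \<open>b\<^sup>2\<close>. From then on every term equals the loss of squared tail norm, so
    the total cannot grow.\<close>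
  have S: "?S m + min (b\<^sup>2) ((norm (tail m y))\<^sup>2) \<le> b\<^sup>2" for m
  proof (induction m)
    case (Suc m)
    show ?case
    proof (cases "norm (tail m y) \<le> b")
      case True
      then have "(norm (tail m y))\<^sup>2 \<le> b\<^sup>2" by (intro power_mono) auto
      then show ?thesis using Suc True by (simp add: norm_tail_Suc)
    next
      case False
      then have "b\<^sup>2 \<le> (norm (tail m y))\<^sup>2" using assms(1) by (intro power_mono) auto
      then show ?thesis using Suc False by simp
    qed
  qed simp
  have "(norm (\<Sum>i<n. (c i * (y \<bullet> e i)) *\<^sub>R e i))\<^sup>2 \<le> (\<Sum>i<n. (c i * (y \<bullet> e i))\<^sup>2)"
    by (rule norm_sum_le)
  also have "\<dots> \<le> (\<Sum>i<n. C\<^sup>2 * (if norm (tail i y) \<le> b then (y \<bullet> e i)\<^sup>2 else 0))"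
  proof (rule sum_mono)
    fix i assume i: "i \<in> {..<n}"
    have "(c i)\<^sup>2 \<le> C\<^sup>2"
      using power_mono[OF assms(3)[of i], of 2] i by simp
    then show "(c i * (y \<bullet> e i))\<^sup>2 \<le> C\<^sup>2 * (if norm (tail i y) \<le> b then (y \<bullet> e i)\<^sup>2 else 0)"
      using assms(4)[of i] i by (auto simp: power_mult_distrib not_le intro: mult_right_mono)
  qed
  also have "\<dots> = C\<^sup>2 * ?S n" by (simp add: sum_distrib_left)
  also have "\<dots> \<le> C\<^sup>2 * b\<^sup>2"
  proof (rule mult_left_mono)
    have "0 \<le> min (b\<^sup>2) ((norm (tail n y))\<^sup>2)" by simp
    then show "?S n \<le> b\<^sup>2" using S[of n] by linarith
  qed simp
  finally show ?thesis
    by (intro power2_le_imp_le[OF _ mult_nonneg_nonneg[OF assms(2,1)]]) (simp add: power_mult_distrib)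
qed

end

text \<open>A smooth step obtained by nesting. The inner difference is nonpositive for s <= 1/4,
  where the outer \<open>flat 0\<close> kills it, and equals \<open>flat 0 (3/4)\<close> for s >= 1.
  As squares will be inserted, the transition takes place between 1/2 and 1 before squaring.\<close>

definition cutoff :: "real \<Rightarrow> real"
  where "cutoff s = flat 0 (flat 0 (3/4) - flat 0 (1 - s)) / flat 0 (flat 0 (3/4))"

text \<open>The factor 16 is the Lipschitz constant 4 of \<open>flat 0\<close>, taken once for each
  of the two nested occurrences.\<close>

definition cutoff_lip :: real
  where "cutoff_lip = 16 / flat 0 (flat 0 (3/4))"

lemma cutoff_denominator_pos: "0 < flat 0 (flat 0 (3/4))"
  by (simp add: flat_0_pos_iff)

lemma cutoff_eq_0: "s \<le> 1/4 \<Longrightarrow> cutoff s = 0"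
  using flat_0_mono[of "3/4" "1 - s"] by (simp add: cutoff_def flat_0_eq_0)

lemma cutoff_eq_1: "1 \<le> s \<Longrightarrow> cutoff s = 1"
  using cutoff_denominator_pos by (simp add: cutoff_def flat_0_eq_0[of "1 - s"])

lemma cutoff_nonneg: "0 \<le> cutoff s"
  using cutoff_denominator_pos by (simp add: cutoff_def flat_0_nonneg)

lemma cutoff_le_1: "cutoff s \<le> 1"
  using cutoff_denominator_pos flat_0_nonneg[of "1 - s"]
  by (simp add: cutoff_def divide_le_eq flat_0_mono)

lemma cutoff_lip_nonneg: "0 \<le> cutoff_lip"
  using cutoff_denominator_pos by (simp add: cutoff_lip_def)

lemma cutoff_lipschitz: "\<bar>cutoff s - cutoff t\<bar> \<le> cutoff_lip * \<bar>s - t\<bar>"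
proof -
  have "\<bar>flat 0 (flat 0 (3/4) - flat 0 (1 - s)) - flat 0 (flat 0 (3/4) - flat 0 (1 - t))\<bar>
      \<le> 4 * \<bar>flat 0 (1 - t) - flat 0 (1 - s)\<bar>"
    using flat_0_lipschitz[of "flat 0 (3/4) - flat 0 (1 - s)" "flat 0 (3/4) - flat 0 (1 - t)"] by simp
  also have "\<dots> \<le> 4 * (4 * \<bar>s - t\<bar>)"
    using flat_0_lipschitz[of "1 - t" "1 - s"] by simp
  finally show ?thesis
    using cutoff_denominator_pos
    by (simp add: cutoff_def cutoff_lip_def divide_right_mono flip: diff_divide_distrib)
qed

text \<open>Squaring is not globally Lipschitz, but \<open>cutoff\<close> is constant from 1 on, so
  both arguments may be truncated at 1, where squaring has constant 2.\<close>

lemma cutoff_square_lipschitz: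
  assumes "0 \<le> u" "0 \<le> v"
  shows "\<bar>cutoff (u\<^sup>2) - cutoff (v\<^sup>2)\<bar> \<le> 2 * cutoff_lip * \<bar>u - v\<bar>"
proof -
  let ?u = "min u 1" and ?v = "min v 1"
  have eq: "cutoff (w\<^sup>2) = cutoff ((min w 1)\<^sup>2)" if "0 \<le> w" for w
    by (cases "w \<le> 1") (auto simp: min_def cutoff_eq_1 one_le_power)
  have "\<bar>cutoff (u\<^sup>2) - cutoff (v\<^sup>2)\<bar> \<le> cutoff_lip * \<bar>?u\<^sup>2 - ?v\<^sup>2\<bar>"
    unfolding eq[OF assms(1)] eq[OF assms(2)] by (rule cutoff_lipschitz)
  also have "\<bar>?u\<^sup>2 - ?v\<^sup>2\<bar> = (?u + ?v) * \<bar>?u - ?v\<bar>"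
    using assms by (simp add: power2_eq_square square_diff_square_factored abs_mult)
  also have "\<dots> \<le> 2 * \<bar>u - v\<bar>"
    using assms by (intro mult_mono) auto
  finally show ?thesis
    using cutoff_lip_nonneg by (simp add: mult_left_mono mult.assoc mult.left_commute)
qed

locale exhausting_sequence = orthonormal_or_zero +
  fixes \<eta> :: real
  assumes exhausting: "(\<lambda>n. norm (tail n x)) \<longlonglongrightarrow> 0"
    and \<eta>_pos: "0 < \<eta>"
begin

text \<open>The norm is squared because the squared norm is smooth everywhere, while the norm itself
  is not differentiable at 0.\<close>

definition weight :: "nat \<Rightarrow> 'a \<Rightarrow> real"
  where "weight n x = cutoff ((norm (tail n x) / \<eta>)\<^sup>2)"

definition retract :: "'a \<Rightarrow> 'a"
  where "retract x = (\<Sum>i. (weight i x * (x \<bullet> e i)) *\<^sub>R e i)"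

lemma weight_bounds: "0 \<le> weight n x" "weight n x \<le> 1"
  by (simp_all add: weight_def cutoff_nonneg cutoff_le_1)

lemma weight_eq_1: "\<eta> \<le> norm (tail n x) \<Longrightarrow> weight n x = 1"
  using \<eta>_pos unfolding weight_def by (intro cutoff_eq_1 one_le_power) (simp add: le_divide_eq)

lemma weight_eq_0:
  assumes "norm (tail n x) \<le> \<eta> / 2"
  shows "weight n x = 0"
proof -
  have "(norm (tail n x) / \<eta>)\<^sup>2 \<le> (1/2)\<^sup>2"
    using assms \<eta>_pos by (intro power_mono) (auto simp: divide_le_eq)
  then show ?thesis
    unfolding weight_def by (intro cutoff_eq_0) (simp add: power2_eq_square)
qed

lemma weight_lipschitz: "\<bar>weight n x - weight n y\<bar> \<le> 2 * cutoff_lip / \<eta> * norm (x - y)"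
proof -
  have "\<bar>weight n x - weight n y\<bar> \<le> 2 * cutoff_lip * \<bar>norm (tail n x) / \<eta> - norm (tail n y) / \<eta>\<bar>"
    unfolding weight_def using \<eta>_pos by (intro cutoff_square_lipschitz) auto
  also have "\<bar>norm (tail n x) / \<eta> - norm (tail n y) / \<eta>\<bar> \<le> norm (x - y) / \<eta>"
    using norm_tail_diff_le[of n x y] \<eta>_pos
    by (simp add: divide_right_mono flip: diff_divide_distrib)
  finally show ?thesis
    using cutoff_lip_nonneg by (simp add: mult_left_mono)
qed

text \<open>The scalar and the inner product are included because this is exactly the shape of the
  coordinates of the retraction.\<close>

lemma weight_smooth:
  assumes "open U"
  shows "bdd_deriv k U {\<lambda>x. c * (weight n x * (x \<bullet> a))}"
proof -
  let ?c = "1 / flat 0 (flat 0 (3/4))"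
  note intros = bdd_deriv_add1[OF assms] bdd_deriv_mult1[OF assms] bdd_deriv_const1
    bdd_deriv_sum1[OF assms] bdd_deriv_inner1[OF assms] bdd_deriv_inner_self[OF assms]
  have "bdd_deriv k U {\<lambda>x. x \<bullet> x + (\<Sum>i<n. - 1 * ((x \<bullet> e i) * (x \<bullet> e i)))}"
    by (intro intros)
  then have sq: "bdd_deriv k U {\<lambda>x. (norm (tail n x))\<^sup>2}"
    by (simp only: norm_tail_eq)
  have "bdd_deriv k U {\<lambda>x. c * ((?c * flat 0 (flat 0 (3/4) +
      - 1 * flat 0 (1 + - (1 / \<eta>\<^sup>2) * (norm (tail n x))\<^sup>2))) * (x \<bullet> a))}"
    by (intro intros bdd_deriv_flat1[OF assms] sq)
  then show ?thesis
    by (simp add: weight_def cutoff_def power_divide)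
qed

text \<open>Tail norms decrease in the index and are 1-Lipschitz in the point, so a tail below eta/4
  at \<open>x\<close> stays below eta/2 on a ball of radius eta/4 for all later indices. One
  \<open>N\<close> thus serves a whole neighbourhood.\<close>

lemma local_cutoff:
  obtains N V where "open V" "x \<in> V" "\<And>i y. y \<in> V \<Longrightarrow> N \<le> i \<Longrightarrow> weight i y = 0"
    "norm (tail N x) \<le> \<eta>"
proof -
  obtain N where N: "norm (tail N x) < \<eta> / 4"
    using order_tendstoD(2)[OF exhausting, of "\<eta> / 4" x] \<eta>_pos by (auto simp: eventually_sequentially)
  have "weight i y = 0" if y: "y \<in> ball x (\<eta> / 4)" and i: "N \<le> i" for i y
  proof (rule weight_eq_0)
    have "norm (tail i y) \<le> norm (tail N y)" using i by (rule norm_tail_antimono)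
    also have "\<dots> \<le> norm (tail N x) + norm (x - y)" using norm_tail_diff_le[of N x y] by linarith
    finally show "norm (tail i y) \<le> \<eta> / 2" using N y by (simp add: dist_norm)
  qed
  then show ?thesis
    using that[of "ball x (\<eta> / 4)" N] N \<eta>_pos by simp
qed

lemma retract_eq_sum:
  assumes "\<And>i. N \<le> i \<Longrightarrow> weight i x = 0"
  shows "retract x = (\<Sum>i<N. (weight i x * (x \<bullet> e i)) *\<^sub>R e i)"
  unfolding retract_def by (rule suminf_finite) (use assms in auto)

text \<open>The error is a tail of norm at most eta plus a sum with coefficients 1 - weight. These
  vanish while the tail exceeds eta, so the masked sum contributes at most another eta.\<close>

lemma retract_near: "norm (x - retract x) \<le> 2 * \<eta>"
proof -
  obtain N V where V: "x \<in> V" "\<And>i y. y \<in> V \<Longrightarrow> N \<le> i \<Longrightarrow> weight i y = 0" "norm (tail N x) \<le> \<eta>"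
    by (rule local_cutoff[of x]) blast
  have "x - retract x = tail N x + (\<Sum>i<N. ((1 - weight i x) * (x \<bullet> e i)) *\<^sub>R e i)"
    using retract_eq_sum[OF V(2)[OF V(1)]]
    by (simp add: tail_def left_diff_distrib scaleR_diff_left sum_subtractf)
  moreover have "norm (\<Sum>i<N. ((1 - weight i x) * (x \<bullet> e i)) *\<^sub>R e i) \<le> 1 * \<eta>"
    using \<eta>_pos weight_bounds weight_eq_1 by (intro norm_masked_sum_le) auto
  ultimately show ?thesis
    using V(3) norm_triangle_ineq[of "tail N x"] by (smt (verit))
qed

text \<open>For nearby points the difference splits into a part with differing points and a part
  with differing weights. The slope of the weights is of order 1/eta, but the masked sum they
  multiply has norm O(eta), so eta cancels. For points farther apart than eta, closeness to the
  identity is enough.\<close>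

lemma retract_lipschitz: "norm (retract x - retract y) \<le> (5 + 4 * cutoff_lip) * norm (x - y)"
proof (cases "norm (x - y) \<le> \<eta>")
  case True
  obtain N V where V: "x \<in> V" "\<And>i y. y \<in> V \<Longrightarrow> N \<le> i \<Longrightarrow> weight i y = 0"
    by (rule local_cutoff[of x]) blast
  obtain M W where W: "y \<in> W" "\<And>i x. x \<in> W \<Longrightarrow> M \<le> i \<Longrightarrow> weight i x = 0"
    by (rule local_cutoff[of y]) blast
  let ?N = "max N M"
  have "retract x - retract y = (\<Sum>i<?N. (weight i x * ((x - y) \<bullet> e i)) *\<^sub>R e i)
      + (\<Sum>i<?N. ((weight i x - weight i y) * (y \<bullet> e i)) *\<^sub>R e i)"
    using V W
    by (simp add: retract_eq_sum[of ?N] inner_diff_left algebra_simps sum.distrib sum_subtractf)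
  \<comment> \<open>Here the mask is vacuous: no tail of x - y exceeds norm (x - y).\<close>
  moreover have "norm (\<Sum>i<?N. (weight i x * ((x - y) \<bullet> e i)) *\<^sub>R e i) \<le> 1 * norm (x - y)"
    by (rule norm_masked_sum_le) (use weight_bounds norm_tail_le in \<open>auto simp: not_less[symmetric]\<close>)
  moreover have "norm (\<Sum>i<?N. ((weight i x - weight i y) * (y \<bullet> e i)) *\<^sub>R e i)
      \<le> (2 * cutoff_lip / \<eta> * norm (x - y)) * (2 * \<eta>)"
  proof (rule norm_masked_sum_le)
    \<comment> \<open>The threshold is 2 eta so that, at distance at most eta, the tail of
      \<open>x\<close> is still at least eta and both weights are 1.\<close>
    show "weight i x - weight i y = 0" if "norm (tail i y) > 2 * \<eta>" for i
    proof -
      have "norm (tail i x) \<ge> \<eta>"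
        using that True norm_tail_diff_le[of i x y] by linarith
      then show ?thesis
        using that \<eta>_pos by (simp add: weight_eq_1)
    qed
  qed (use \<eta>_pos cutoff_lip_nonneg weight_lipschitz in auto)
  ultimately have "norm (retract x - retract y) \<le> norm (x - y) + 4 * cutoff_lip * norm (x - y)"
    using \<eta>_pos norm_triangle_ineq[of "\<Sum>i<?N. (weight i x * ((x - y) \<bullet> e i)) *\<^sub>R e i"
        "\<Sum>i<?N. ((weight i x - weight i y) * (y \<bullet> e i)) *\<^sub>R e i"] by simp
  then show ?thesis by (simp add: distrib_right) (smt (verit) norm_ge_zero)
next
  case False
  \<comment> \<open>Each of the two displacements is at most 2 eta < 2 norm (x - y), which gives the
    factor 1 + 2 + 2.\<close>
  have "retract x - retract y = (x - y) - (x - retract x) + (y - retract y)" by simp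
  then have "norm (retract x - retract y) \<le> norm (x - y) + norm (x - retract x) + norm (y - retract y)"
    by (smt (verit) norm_triangle_ineq norm_triangle_ineq4)
  then have "norm (retract x - retract y) \<le> 5 * norm (x - y)"
    using False retract_near[of x] retract_near[of y] by linarith
  also have "\<dots> \<le> (5 + 4 * cutoff_lip) * norm (x - y)"
    using cutoff_lip_nonneg by (intro mult_right_mono) auto
  finally show ?thesis .
qed

lemma smooth_approximation:
  fixes f :: "'a \<Rightarrow> real"
  assumes f: "L-lipschitz_on UNIV f"
  obtains g where "g \<in> smooth" "((5 + 4 * cutoff_lip) * L)-lipschitz_on UNIV g"
    "\<And>x. \<bar>g x - f x\<bar> \<le> 3 * L * \<eta>"
    "\<And>R x. (\<And>x. norm x \<ge> R \<Longrightarrow> f x = 0) \<Longrightarrow> norm x \<ge> R + 3 * \<eta> \<Longrightarrow> g x = 0"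
proof -
  define d where "d n = (\<eta> / 2 ^ Suc n) *\<^sub>R e n" for n
  have "norm (d n) \<le> \<eta> / 2 ^ Suc n" for n
    using normalized[of n] \<eta>_pos by (auto simp: d_def)
  then obtain F where F: "L-lipschitz_on UNIV F" "\<And>x. \<bar>F x - f x\<bar> \<le> L * \<eta>"
    "\<And>R x. (\<And>x. norm x \<ge> R \<Longrightarrow> f x = 0) \<Longrightarrow> norm x \<ge> R + \<eta> \<Longrightarrow> F x = 0"
    "\<And>N. \<exists>G. L-lipschitz_on UNIV G \<and> F = smear_list (map d [0..<N]) G"
    using smear_limit[OF f \<eta>_pos] by metis
  have L: "0 \<le> L" by (rule lipschitz_on_nonneg[OF f])
  define g where "g x = F (retract x)" for x
  have "bdd_deriv k UNIV {g}" for k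
  proof (rule bdd_deriv_local)
    fix x
    obtain N V where V: "open V" "x \<in> V" "\<And>i y. y \<in> V \<Longrightarrow> N \<le> i \<Longrightarrow> weight i y = 0"
      by (rule local_cutoff[of x]) blast
    \<comment> \<open>The unit ball bounds the inner products, hence the coordinates, as
      \<open>bdd_deriv_smear_list\<close> requires.\<close>
    let ?U = "V \<inter> ball x 1"
    have U: "open ?U" "x \<in> ?U" using V by auto
    obtain G where G: "L-lipschitz_on UNIV G" "F = smear_list (map d [0..<N]) G"
      using F(4) by blast
    \<comment> \<open>The prefactor undoes the length of \<open>d i\<close>, so that
      \<open>\<psi> i y *\<^sub>R d i\<close> is the i-th term of \<open>retract y\<close>.\<close>
    define \<psi> where "\<psi> i y = 2 ^ Suc i / \<eta> * (weight i y * (y \<bullet> e i))" for i y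
    define ps where "ps = map (\<lambda>i. (\<psi> i, d i)) [0..<N]"
    have "bdd_deriv k ?U {\<lambda>y. smear_list (map snd ps) G (z + (\<Sum>(\<psi>, d)\<leftarrow>ps. \<psi> y *\<^sub>R d)) | z. z \<in> {0}}"
    proof (rule bdd_deriv_smear_list[OF U(1) G(1)])
      show "bdd_deriv k ?U {\<phi>}" if "(\<phi>, c) \<in> set ps" for \<phi> c
      proof -
        obtain i where "\<phi> = \<psi> i"
          using \<open>(\<phi>, c) \<in> set ps\<close> by (auto simp: ps_def)
        then have "\<phi> = (\<lambda>y. 2 ^ Suc i / \<eta> * (weight i y * (y \<bullet> e i)))"
          by (simp only: \<psi>_def[abs_def])
        then show ?thesis by (simp only: weight_smooth[OF U(1)])
      qed
      show "\<bar>\<phi> y\<bar> \<le> 2 ^ N / \<eta> * (norm x + 1)" if \<phi>: "(\<phi>, c) \<in> set ps" and y: "y \<in> ?U" for \<phi> c y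
      proof -
        obtain i where i: "i < N" "\<phi> = \<psi> i" using \<phi> by (auto simp: ps_def)
        have "\<bar>y \<bullet> e i\<bar> \<le> norm y * norm (e i)" by (rule Cauchy_Schwarz_ineq2)
        also have "\<dots> \<le> norm y" using normalized[of i] by auto
        also have "\<dots> \<le> norm x + 1"
          using y norm_triangle_sub[of y x] by (simp add: dist_norm norm_minus_commute)
        finally have "\<bar>weight i y * (y \<bullet> e i)\<bar> \<le> 1 * (norm x + 1)"
          unfolding abs_mult using weight_bounds[of i y] by (intro mult_mono) auto
        moreover have "(2::real) ^ Suc i \<le> 2 ^ N"
          using i(1) by (intro power_increasing) auto
        ultimately have "2 ^ Suc i / \<eta> * \<bar>weight i y * (y \<bullet> e i)\<bar> \<le> 2 ^ N / \<eta> * (1 * (norm x + 1))"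
          using \<eta>_pos by (intro mult_mono divide_right_mono) auto
        then show ?thesis
          using \<eta>_pos by (simp add: i(2) \<psi>_def abs_mult)
      qed
    qed simp
    then have "bdd_deriv k ?U {g}"
    proof (rule bdd_deriv_cong[OF U(1)])
      have "retract y = (\<Sum>(\<psi>, d)\<leftarrow>ps. \<psi> y *\<^sub>R d)" if "y \<in> ?U" for y
      proof -
        have "retract y = (\<Sum>i<N. \<psi> i y *\<^sub>R d i)"
          using retract_eq_sum[of N y] V(3) that \<eta>_pos by (simp add: \<psi>_def d_def)
        also have "\<dots> = (\<Sum>(\<psi>, d)\<leftarrow>ps. \<psi> y *\<^sub>R d)"
          by (simp add: ps_def comp_def interv_sum_list_conv_sum_set_nat atLeast0LessThan)
        finally show ?thesis .
      qed
      moreover have "map snd ps = map d [0..<N]" by (simp add: ps_def comp_def)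
      ultimately show "\<exists>f\<in>{\<lambda>y. smear_list (map snd ps) G (z + (\<Sum>(\<psi>, d)\<leftarrow>ps. \<psi> y *\<^sub>R d)) | z. z \<in> {0}}.
          \<forall>y\<in>?U. h y = f y" if "h \<in> {g}" for h
        using that by (auto simp: g_def G(2))
    qed
    then show "\<exists>V. open V \<and> x \<in> V \<and> bdd_deriv k V {g}"
      using U by blast
  qed
  then have "g \<in> smooth" by (rule smoothI)
  moreover have "((5 + 4 * cutoff_lip) * L)-lipschitz_on UNIV g"
  proof (rule lipschitz_onI)
    fix x y
    have "dist (g x) (g y) \<le> L * norm (retract x - retract y)"
      using lipschitz_onD[OF F(1), of "retract x" "retract y"] by (simp add: g_def dist_norm)
    also have "\<dots> \<le> L * ((5 + 4 * cutoff_lip) * norm (x - y))"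
      using L by (intro mult_left_mono retract_lipschitz)
    finally show "dist (g x) (g y) \<le> (5 + 4 * cutoff_lip) * L * dist x y"
      by (simp add: dist_norm mult_ac)
  qed (use L cutoff_lip_nonneg in simp)
  moreover have "\<bar>g x - f x\<bar> \<le> 3 * L * \<eta>" for x
  proof -
    have "\<bar>f (retract x) - f x\<bar> \<le> L * norm (x - retract x)"
      using lipschitz_onD[OF f, of "retract x" x] by (simp add: dist_norm norm_minus_commute)
    also have "\<dots> \<le> L * (2 * \<eta>)" using L by (intro mult_left_mono retract_near)
    finally show ?thesis using F(2)[of "retract x"] by (simp add: g_def)
  qed
  moreover have "g x = 0" if "\<And>x. norm x \<ge> R \<Longrightarrow> f x = 0" "norm x \<ge> R + 3 * \<eta>" for R x
  proof -
    have "norm (retract x) \<ge> R + \<eta>"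
      using that(2) retract_near[of x] norm_triangle_ineq2[of x "retract x"] norm_triangle_sub[of x "retract x"] by linarith
    then show ?thesis unfolding g_def using F(3)[of R] that(1) by blast
  qed
  ultimately show ?thesis using that by blast
qed

end

subsection \<open>Gram-Schmidt orthonormalization of a dense sequence\<close>

text \<open>Since \<open>sgn 0 = 0\<close>, a vector in the span of its predecessors yields 0
  instead of being skipped.\<close>

fun gram_schmidt :: "(nat \<Rightarrow> 'a::real_inner) \<Rightarrow> nat \<Rightarrow> 'a" where
  "gram_schmidt d n = sgn (d n - (\<Sum>i<n. (d n \<bullet> gram_schmidt d i) *\<^sub>R gram_schmidt d i))"

declare gram_schmidt.simps [simp del]

lemma gram_schmidt_normalized: "gram_schmidt d n = 0 \<or> norm (gram_schmidt d n) = 1"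
  by (subst (1 2) gram_schmidt.simps) (simp add: norm_sgn sgn_zero_iff)

lemma gram_schmidt_orthogonal_less: "j < n \<Longrightarrow> gram_schmidt d n \<bullet> gram_schmidt d j = 0"
proof (induction n arbitrary: j rule: less_induct)
  case (less n)
  let ?e = "gram_schmidt d"
  have "(\<Sum>i<n. (d n \<bullet> ?e i) * (?e i \<bullet> ?e j)) = (\<Sum>i<n. if i = j then d n \<bullet> ?e j else 0)"
  proof (rule sum.cong)
    fix i assume i: "i \<in> {..<n}"
    show "(d n \<bullet> ?e i) * (?e i \<bullet> ?e j) = (if i = j then d n \<bullet> ?e j else 0)"
    proof (cases i j rule: linorder_cases)
      case less
      then show ?thesis using less.IH[of j i] \<open>j < n\<close> by (simp add: inner_commute)
    next
      case equal
      then show ?thesis using gram_schmidt_normalized[of d j] by (auto simp: norm_eq_1)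
    next
      case greater
      then show ?thesis using less.IH[of i j] i by simp
    qed
  qed simp
  then have "(d n - (\<Sum>i<n. (d n \<bullet> ?e i) *\<^sub>R ?e i)) \<bullet> ?e j = 0"
    using less.prems by (simp add: inner_diff_left inner_sum_left)
  then show ?case
    by (subst gram_schmidt.simps) (simp add: sgn_div_norm)
qed

lemma orthonormal_or_zero_gram_schmidt: "orthonormal_or_zero (gram_schmidt d)"
proof
  show "gram_schmidt d i \<bullet> gram_schmidt d j = 0" if "i \<noteq> j" for i j
    using that gram_schmidt_orthogonal_less[of j i d] gram_schmidt_orthogonal_less[of i j d]
    by (cases i j rule: linorder_cases) (auto simp: inner_commute)
qed (rule gram_schmidt_normalized)

text \<open>Each \<open>d m\<close> is spanned by the first m + 1 orthonormalized vectors, so its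
  tails vanish from there on. Density and the 1-Lipschitz bound on tails carry this over to all
  points.\<close>

lemma exhausting_gram_schmidt:
  fixes d :: "nat \<Rightarrow> 'a::real_inner"
  assumes "closure (range d) = UNIV" "0 < \<eta>"
  shows "exhausting_sequence (gram_schmidt d) \<eta>"
proof -
  interpret orthonormal_or_zero "gram_schmidt d"
    by (rule orthonormal_or_zero_gram_schmidt)
  let ?e = "gram_schmidt d"
  have zero: "tail (Suc m) (d m) = 0" for m
  proof -
    let ?u = "tail m (d m)"
    have e: "?e m = sgn ?u"
      by (subst gram_schmidt.simps) (simp add: tail_def)
    have "d m \<bullet> ?e m = ?u \<bullet> sgn ?u"
      using tail_inner[of m "d m"] e by simp
    also have "\<dots> = norm ?u"
      by (cases "?u = 0") (simp_all add: sgn_div_norm power2_norm_eq_inner[symmetric] power2_eq_square)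
    finally show ?thesis
      by (cases "?u = 0") (simp_all add: tail_Suc e sgn_div_norm)
  qed
  have "(\<lambda>n. norm (tail n x)) \<longlonglongrightarrow> 0" for x
  proof (rule LIMSEQ_I)
    fix r :: real assume "r > 0"
    moreover have "x \<in> closure (range d)" using assms(1) by simp
    ultimately obtain m where m: "dist (d m) x < r"
      unfolding closure_approachable by blast
    have "norm (norm (tail n x) - 0) < r" if "n \<ge> Suc m" for n
    proof -
      have "norm (tail n (d m)) = 0"
        using norm_tail_antimono[OF that, of "d m"] zero by simp
      then show ?thesis
        using norm_tail_diff_le[of n x "d m"] m by (simp add: dist_norm norm_minus_commute)
    qed
    then show "\<exists>N. \<forall>n\<ge>N. norm (norm (tail n x) - 0) < r" by blast
  qed
  then show ?thesis
    by unfold_locales (use assms(2) in auto)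
qed

lemma separable_dense_sequence:
  assumes "separable_space (euclidean :: 'a::topological_space topology)"
  shows "\<exists>d :: nat \<Rightarrow> 'a. closure (range d) = UNIV"
proof -
  obtain C :: "'a set" where C: "countable C" "closure C = UNIV"
    using assms by (auto simp: separable_space_def)
  then have "C \<noteq> {}" by auto
  then have "range (from_nat_into C) = C"
    using C(1) by (rule range_from_nat_into)
  then show ?thesis using C(2) by metis
qed

subsection \<open>Vanishing oscillation in terms of real inequalities\<close>

lemma ennreal_tendsto_0_iff_le:
  fixes F :: "'b \<Rightarrow> ennreal"
  shows "(F \<longlongrightarrow> 0) A \<longleftrightarrow> (\<forall>\<epsilon>>0. \<forall>\<^sub>F x in A. F x \<le> ennreal \<epsilon>)"
proof
  assume F: "(F \<longlongrightarrow> 0) A"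
  show "\<forall>\<epsilon>>0. \<forall>\<^sub>F x in A. F x \<le> ennreal \<epsilon>"
  proof (intro allI impI)
    fix \<epsilon> :: real assume "\<epsilon> > 0"
    then have "\<forall>\<^sub>F x in A. F x < ennreal \<epsilon>"
      by (intro order_tendstoD(2)[OF F]) simp
    then show "\<forall>\<^sub>F x in A. F x \<le> ennreal \<epsilon>"
      by eventually_elim simp
  qed
next
  assume *: "\<forall>\<epsilon>>0. \<forall>\<^sub>F x in A. F x \<le> ennreal \<epsilon>"
  show "(F \<longlongrightarrow> 0) A"
  proof (rule order_tendstoI)
    fix a :: ennreal assume "0 < a"
    then obtain z where z: "0 < z" "z < a" using dense by blast
    then obtain r where r: "z = ennreal r" "0 \<le> r" by (cases z) auto
    then have "0 < r" using z by (cases "r = 0") auto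
    with * have "\<forall>\<^sub>F x in A. F x \<le> z" unfolding r(1) by blast
    then show "\<forall>\<^sub>F x in A. F x < a"
      by eventually_elim (use z(2) in simp)
  qed simp
qed

lemma clamp_diff_le:
  fixes a b c d :: real
  assumes "0 \<le> c" "0 \<le> d" "\<bar>a - b\<bar> \<le> B" "\<bar>c - d\<bar> \<le> B"
  shows "\<bar>max (- c) (min a c) - max (- d) (min b d)\<bar> \<le> B"
  using assms unfolding max_def min_def by (auto split: if_splits)

definition bounded_support :: "('a::real_normed_vector \<Rightarrow> real) \<Rightarrow> bool"
  where "bounded_support f \<longleftrightarrow> (\<exists>R. \<forall>x. norm x \<ge> R \<longrightarrow> f x = 0)"

locale modulus =
  fixes w :: "real \<Rightarrow> real"
  assumes pos: "t > 0 \<Longrightarrow> w t > 0"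
    and nondecreasing: "mono_on {0<..} w"
    and lim_infinity: "filterlim w at_top at_top"
    and lim_ratio: "((\<lambda>t. t / w t) \<longlongrightarrow> 0) (at_right 0)"
begin

text \<open>At x = y this would involve \<open>w 0\<close>, about which nothing is known. Therefore
  the statements below either exclude x = y or, as in \<open>VC_large_iff\<close>, bound the
  distance below by a positive number.\<close>

definition osc_le :: "('a::real_normed_vector \<Rightarrow> real) \<Rightarrow> real \<Rightarrow> 'a \<Rightarrow> 'a \<Rightarrow> bool"
  where "osc_le f \<epsilon> x y \<longleftrightarrow> \<bar>f x - f y\<bar> \<le> \<epsilon> * w (norm (x - y))"

definition osc_bound :: "('a::real_normed_vector \<Rightarrow> real) \<Rightarrow> real \<Rightarrow> bool"
  where "osc_bound f \<epsilon> \<longleftrightarrow> (\<forall>x y. x \<noteq> y \<longrightarrow> osc_le f \<epsilon> x y)"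

lemma osc_boundI: "(\<And>x y. x \<noteq> y \<Longrightarrow> osc_le f \<epsilon> x y) \<Longrightarrow> osc_bound f \<epsilon>"
  by (simp add: osc_bound_def)

lemma osc_boundD: "osc_bound f \<epsilon> \<Longrightarrow> x \<noteq> y \<Longrightarrow> osc_le f \<epsilon> x y"
  by (simp add: osc_bound_def)

lemma mono: "0 < s \<Longrightarrow> s \<le> t \<Longrightarrow> w s \<le> w t"
  using nondecreasing by (auto simp: mono_on_def)

lemma osc_iff:
  assumes "0 \<le> \<epsilon>" "x \<noteq> y"
  shows "osc w f x y \<le> ennreal \<epsilon> \<longleftrightarrow> osc_le f \<epsilon> x y"
  using assms pos[of "norm (x - y)"] by (simp add: osc_def osc_le_def divide_le_eq)

lemma osc_le_add: "osc_le f a x y \<Longrightarrow> osc_le g b x y \<Longrightarrow> osc_le (\<lambda>x. f x + g x) (a + b) x y"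
  unfolding osc_le_def by (simp add: distrib_right)

lemma osc_le_diff:
  assumes "osc_le f a x y" "osc_le g b x y"
  shows "osc_le (\<lambda>x. f x - g x) (a + b) x y"
proof -
  have "\<bar>(f x - g x) - (f y - g y)\<bar> \<le> \<bar>f x - f y\<bar> + \<bar>g x - g y\<bar>" by linarith
  then show ?thesis
    using assms unfolding osc_le_def distrib_right by linarith
qed

lemma osc_bound_add: "osc_bound f a \<Longrightarrow> osc_bound g b \<Longrightarrow> osc_bound (\<lambda>x. f x + g x) (a + b)"
  by (simp add: osc_bound_def osc_le_add)

lemma holder_seminorm_le_iff:
  "0 \<le> \<epsilon> \<Longrightarrow> holder_seminorm w f \<le> ennreal \<epsilon> \<longleftrightarrow> osc_bound f \<epsilon>"
  by (auto simp: holder_seminorm_def SUP_le_iff osc_iff osc_bound_def)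

lemma holder_space_iff: "f \<in> holder_space w \<longleftrightarrow> (\<exists>C\<ge>0. osc_bound f C)"
proof
  assume "f \<in> holder_space w"
  then have "holder_seminorm w f < top" by (simp add: holder_space_def)
  then obtain C where "0 \<le> C" "holder_seminorm w f = ennreal C" by (cases "holder_seminorm w f") auto
  then show "\<exists>C\<ge>0. osc_bound f C"
    using holder_seminorm_le_iff[of C f] by auto
next
  assume "\<exists>C\<ge>0. osc_bound f C"
  then obtain C where "holder_seminorm w f \<le> ennreal C"
    using holder_seminorm_le_iff by blast
  also have "\<dots> < top" by simp
  finally show "f \<in> holder_space w" by (simp add: holder_space_def)
qed

lemma osc_at_scale_le_iff:
  assumes "0 \<le> \<epsilon>" "0 < \<delta>"
  shows "osc_at_scale w f \<delta> \<le> ennreal \<epsilon> \<longleftrightarrow> (\<forall>x y. norm (x - y) = \<delta> \<longrightarrow> osc_le f \<epsilon> x y)"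
proof -
  have "osc w f x y \<le> ennreal \<epsilon> \<longleftrightarrow> osc_le f \<epsilon> x y" if "norm (x - y) = \<delta>" for x y
    by (rule osc_iff) (use that assms in auto)
  then show ?thesis
    by (auto simp: osc_at_scale_def SUP_le_iff)
qed

lemma VC_small_iff: "f \<in> VC_small w \<longleftrightarrow> f \<in> holder_space w \<and>
  (\<forall>\<epsilon>>0. \<exists>d>0. \<forall>x y. x \<noteq> y \<longrightarrow> norm (x - y) < d \<longrightarrow> osc_le f \<epsilon> x y)"
proof -
  have "(\<forall>\<^sub>F \<delta> in at_right 0. osc_at_scale w f \<delta> \<le> ennreal \<epsilon>) \<longleftrightarrow>
    (\<exists>d>0. \<forall>x y. x \<noteq> y \<longrightarrow> norm (x - y) < d \<longrightarrow> osc_le f \<epsilon> x y)" if "\<epsilon> > 0" for \<epsilon>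
  proof -
    have "(\<forall>\<^sub>F \<delta> in at_right 0. osc_at_scale w f \<delta> \<le> ennreal \<epsilon>) \<longleftrightarrow>
      (\<exists>d>0. \<forall>\<delta>>0. \<delta> < d \<longrightarrow> (\<forall>x y. norm (x - y) = \<delta> \<longrightarrow> osc_le f \<epsilon> x y))"
      unfolding eventually_at_right_field using osc_at_scale_le_iff[of \<epsilon> _ f] that by (metis less_imp_le)
    also have "\<dots> \<longleftrightarrow> (\<exists>d>0. \<forall>x y. x \<noteq> y \<longrightarrow> norm (x - y) < d \<longrightarrow> osc_le f \<epsilon> x y)"
      by (intro ex_cong1 conj_cong refl) (metis right_minus_eq zero_less_norm_iff)
    finally show ?thesis .
  qed
  then show ?thesis
    by (auto simp: VC_small_def ennreal_tendsto_0_iff_le)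
qed

lemma VC_large_iff: "f \<in> VC_large w \<longleftrightarrow> f \<in> holder_space w \<and>
  (\<forall>\<epsilon>>0. \<exists>M>0. \<forall>x y. M \<le> norm (x - y) \<longrightarrow> osc_le f \<epsilon> x y)"
proof -
  have "(\<forall>\<^sub>F \<delta> in at_top. osc_at_scale w f \<delta> \<le> ennreal \<epsilon>) \<longleftrightarrow>
    (\<exists>M>0. \<forall>x y. M \<le> norm (x - y) \<longrightarrow> osc_le f \<epsilon> x y)" (is "?l \<longleftrightarrow> ?r") if "\<epsilon> > 0" for \<epsilon>
  proof
    assume ?l
    then obtain M where M: "\<And>\<delta>. \<delta> \<ge> M \<Longrightarrow> osc_at_scale w f \<delta> \<le> ennreal \<epsilon>"
      unfolding eventually_at_top_linorder by blast
    have "osc_le f \<epsilon> x y" if "max M 1 \<le> norm (x - y)" for x y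
    proof -
      have "osc_at_scale w f (norm (x - y)) \<le> ennreal \<epsilon>" "0 < norm (x - y)"
        using M that by auto
      then show ?thesis
        using osc_at_scale_le_iff[of \<epsilon> "norm (x - y)" f] \<open>\<epsilon> > 0\<close> by simp
    qed
    then show ?r by (intro exI[of _ "max M 1"]) auto
  next
    assume ?r
    then obtain M where M: "M > 0" "\<And>x y. M \<le> norm (x - y) \<Longrightarrow> osc_le f \<epsilon> x y" by blast
    have "osc_at_scale w f \<delta> \<le> ennreal \<epsilon>" if "\<delta> \<ge> M" for \<delta>
      using M osc_at_scale_le_iff[of \<epsilon> \<delta> f] that \<open>\<epsilon> > 0\<close> by auto
    then show ?l unfolding eventually_at_top_linorder by blast
  qed
  then show ?thesis
    by (auto simp: VC_large_def ennreal_tendsto_0_iff_le)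
qed

lemma VC_far_iff: "f \<in> VC_far w \<longleftrightarrow> f \<in> holder_space w \<and>
  (\<forall>\<epsilon>>0. \<exists>M>0. \<forall>x y. x \<noteq> y \<longrightarrow> M < norm x \<longrightarrow> M < norm y \<longrightarrow> osc_le f \<epsilon> x y)"
proof -
  have le: "osc_far w f \<delta> \<le> ennreal \<epsilon> \<longleftrightarrow> (\<forall>x y. x \<noteq> y \<longrightarrow> \<delta> < norm x \<longrightarrow> \<delta> < norm y \<longrightarrow> osc_le f \<epsilon> x y)"
    if "\<epsilon> > 0" for \<epsilon> \<delta>
    using that by (auto simp: osc_far_def SUP_le_iff osc_iff)
  have "(\<forall>\<^sub>F \<delta> in at_top. osc_far w f \<delta> \<le> ennreal \<epsilon>) \<longleftrightarrow>
    (\<exists>M>0. \<forall>x y. x \<noteq> y \<longrightarrow> M < norm x \<longrightarrow> M < norm y \<longrightarrow> osc_le f \<epsilon> x y)" (is "?l \<longleftrightarrow> ?r")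
    if \<epsilon>: "\<epsilon> > 0" for \<epsilon>
  proof
    assume ?l
    then obtain M where M: "\<And>\<delta>. \<delta> \<ge> M \<Longrightarrow> osc_far w f \<delta> \<le> ennreal \<epsilon>"
      unfolding eventually_at_top_linorder by blast
    show ?r
      using M[of "max M 1"] le[OF \<epsilon>] by (intro exI[of _ "max M 1"]) auto
  next
    assume ?r
    then obtain M where M: "\<And>x y. x \<noteq> y \<Longrightarrow> M < norm x \<Longrightarrow> M < norm y \<Longrightarrow> osc_le f \<epsilon> x y" by blast
    have "osc_far w f \<delta> \<le> ennreal \<epsilon>" if "\<delta> \<ge> M" for \<delta>
      unfolding le[OF \<epsilon>] using M that by auto
    then show ?l unfolding eventually_at_top_linorder by blast
  qed
  then show ?thesis
    by (auto simp: VC_far_def ennreal_tendsto_0_iff_le)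
qed

lemma holder_closure_iff: "f \<in> holder_closure w \<C> \<longleftrightarrow> f \<in> holder_space w \<and>
  (\<forall>\<epsilon>>0. \<exists>g\<in>\<C>. osc_bound (\<lambda>x. g x - f x) \<epsilon>)"
proof (intro iffI conjI allI impI)
  assume f: "f \<in> holder_closure w \<C>"
  then show "f \<in> holder_space w" by (simp add: holder_closure_def)
  fix \<epsilon> :: real assume \<epsilon>: "\<epsilon> > 0"
  obtain F where F: "\<And>n::nat. F n \<in> \<C>" "(\<lambda>n. holder_seminorm w (\<lambda>x. F n x - f x)) \<longlonglongrightarrow> 0"
    using f by (auto simp: holder_closure_def)
  then obtain n where "holder_seminorm w (\<lambda>x. F n x - f x) \<le> ennreal \<epsilon>"
    using \<epsilon> unfolding ennreal_tendsto_0_iff_le eventually_sequentially by blast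
  then show "\<exists>g\<in>\<C>. osc_bound (\<lambda>x. g x - f x) \<epsilon>"
    using holder_seminorm_le_iff[of \<epsilon>] \<epsilon> F(1)[of n] by (intro bexI[of _ "F n"]) auto
next
  assume *: "f \<in> holder_space w \<and>
    (\<forall>\<epsilon>>0. \<exists>g\<in>\<C>. osc_bound (\<lambda>x. g x - f x) \<epsilon>)"
  then have "\<forall>n. \<exists>g\<in>\<C>. osc_bound (\<lambda>x. g x - f x) (inverse (real (Suc n)))"
    by simp
  then obtain F where F: "\<And>n. F n \<in> \<C>"
    "\<And>n. osc_bound (\<lambda>x. F n x - f x) (inverse (real (Suc n)))"
    by metis
  have le: "holder_seminorm w (\<lambda>x. F n x - f x) \<le> ennreal (inverse (real (Suc n)))" for n
    by (subst holder_seminorm_le_iff) (use F(2)[of n] in auto)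
  have "(\<lambda>n. holder_seminorm w (\<lambda>x. F n x - f x)) \<longlonglongrightarrow> 0"
    unfolding ennreal_tendsto_0_iff_le
  proof (intro allI impI)
    fix \<epsilon> :: real assume "\<epsilon> > 0"
    then have "\<forall>\<^sub>F n in sequentially. inverse (real (Suc n)) < \<epsilon>"
      by (rule order_tendstoD(2)[OF LIMSEQ_inverse_real_of_nat])
    then show "\<forall>\<^sub>F n in sequentially. holder_seminorm w (\<lambda>x. F n x - f x) \<le> ennreal \<epsilon>"
    proof eventually_elim
      case (elim n)
      then show ?case using order_trans[OF le[of n] ennreal_leI] by simp
    qed
  qed
  then show "f \<in> holder_closure w \<C>"
    unfolding holder_closure_def using * F(1) by auto
qed

text \<open>The estimate passes from \<open>g\<close> to \<open>f\<close> for each pair of points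
  separately, so the closedness of all three vanishing classes follows from it.\<close>

lemma holder_closureE:
  assumes "f \<in> holder_closure w \<C>" "\<epsilon> > 0"
  obtains g where "g \<in> \<C>" "\<And>x y. osc_le g (\<epsilon> / 2) x y \<Longrightarrow> osc_le f \<epsilon> x y"
proof -
  obtain g where g: "g \<in> \<C>" "osc_bound (\<lambda>x. g x - f x) (\<epsilon> / 2)"
    using assms unfolding holder_closure_iff by (meson half_gt_zero)
  have "osc_le f \<epsilon> x y" if le: "osc_le g (\<epsilon> / 2) x y" for x y
  proof (cases "x = y")
    case True
    then show ?thesis using le by (simp add: osc_le_def zero_le_mult_iff)
  next
    case False
    have "\<epsilon> * w (norm (x - y)) = \<epsilon> / 2 * w (norm (x - y)) + \<epsilon> / 2 * w (norm (x - y))" by simp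
    then show ?thesis
      using osc_boundD[OF g(2) False] le unfolding osc_le_def by linarith
  qed
  then show ?thesis using that g(1) by blast
qed

lemma holder_closure_subset_VC_small: "\<C> \<subseteq> VC_small w \<Longrightarrow> holder_closure w \<C> \<subseteq> VC_small w"
proof
  fix f :: "'a \<Rightarrow> real" assume sub: "\<C> \<subseteq> VC_small w" and f: "f \<in> holder_closure w \<C>"
  have "\<exists>d>0. \<forall>x y. x \<noteq> y \<longrightarrow> norm (x - y) < d \<longrightarrow> osc_le f \<epsilon> x y" if "\<epsilon> > 0" for \<epsilon>
  proof -
    obtain g where g: "g \<in> \<C>" "\<And>x y. osc_le g (\<epsilon> / 2) x y \<Longrightarrow> osc_le f \<epsilon> x y"
      using holder_closureE[OF f \<open>\<epsilon> > 0\<close>] by blast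
    have "g \<in> VC_small w" using g(1) sub by blast
    with \<open>\<epsilon> > 0\<close> obtain d where "d > 0" "\<forall>x y. x \<noteq> y \<longrightarrow> norm (x - y) < d \<longrightarrow> osc_le g (\<epsilon> / 2) x y"
      unfolding VC_small_iff by (meson half_gt_zero)
    then show ?thesis using g(2) by blast
  qed
  then show "f \<in> VC_small w"
    using f unfolding VC_small_iff holder_closure_iff by blast
qed

lemma holder_closure_subset_VC_large: "\<C> \<subseteq> VC_large w \<Longrightarrow> holder_closure w \<C> \<subseteq> VC_large w"
proof
  fix f :: "'a \<Rightarrow> real" assume sub: "\<C> \<subseteq> VC_large w" and f: "f \<in> holder_closure w \<C>"
  have "\<exists>M>0. \<forall>x y. M \<le> norm (x - y) \<longrightarrow> osc_le f \<epsilon> x y" if "\<epsilon> > 0" for \<epsilon>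
  proof -
    obtain g where g: "g \<in> \<C>" "\<And>x y. osc_le g (\<epsilon> / 2) x y \<Longrightarrow> osc_le f \<epsilon> x y"
      using holder_closureE[OF f \<open>\<epsilon> > 0\<close>] by blast
    have "g \<in> VC_large w" using g(1) sub by blast
    with \<open>\<epsilon> > 0\<close> obtain M where M: "M > 0" "\<forall>x y. M \<le> norm (x - y) \<longrightarrow> osc_le g (\<epsilon> / 2) x y"
      unfolding VC_large_iff by (meson half_gt_zero)
    then show ?thesis using g(2) by blast
  qed
  then show "f \<in> VC_large w"
    using f unfolding VC_large_iff holder_closure_iff by blast
qed

lemma holder_closure_subset_VC_far: "\<C> \<subseteq> VC_far w \<Longrightarrow> holder_closure w \<C> \<subseteq> VC_far w"
proof
  fix f :: "'a \<Rightarrow> real" assume sub: "\<C> \<subseteq> VC_far w" and f: "f \<in> holder_closure w \<C>"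
  have "\<exists>M>0. \<forall>x y. x \<noteq> y \<longrightarrow> M < norm x \<longrightarrow> M < norm y \<longrightarrow> osc_le f \<epsilon> x y" if "\<epsilon> > 0" for \<epsilon>
  proof -
    obtain g where g: "g \<in> \<C>" "\<And>x y. osc_le g (\<epsilon> / 2) x y \<Longrightarrow> osc_le f \<epsilon> x y"
      using holder_closureE[OF f \<open>\<epsilon> > 0\<close>] by blast
    have "g \<in> VC_far w" using g(1) sub by blast
    with \<open>\<epsilon> > 0\<close> obtain M where "M > 0"
      "\<forall>x y. x \<noteq> y \<longrightarrow> M < norm x \<longrightarrow> M < norm y \<longrightarrow> osc_le g (\<epsilon> / 2) x y"
      unfolding VC_far_iff by (meson half_gt_zero)
    then show ?thesis using g(2) by blast
  qed
  then show "f \<in> VC_far w"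
    using f unfolding VC_far_iff holder_closure_iff by blast
qed

section \<open>Linear functions against the modulus, and Lipschitz functions in the vanishing
  classes\<close>

lemma linear_le_small:
  assumes "\<epsilon> > 0"
  obtains d where "d > 0" "\<And>t. 0 < t \<Longrightarrow> t < d \<Longrightarrow> L * t \<le> \<epsilon> * w t"
proof -
  have "((\<lambda>t. L * (t / w t)) \<longlongrightarrow> L * 0) (at_right 0)"
    by (intro tendsto_intros lim_ratio)
  then have "\<forall>\<^sub>F t in at_right 0. L * (t / w t) < \<epsilon>"
    by (rule order_tendstoD) (use assms in simp)
  then obtain d where d: "d > 0" "\<And>t. 0 < t \<Longrightarrow> t < d \<Longrightarrow> L * (t / w t) < \<epsilon>"
    unfolding eventually_at_right_field by blast
  have "L * t \<le> \<epsilon> * w t" if "0 < t" "t < d" for t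
    using d(2)[OF that] pos[OF that(1)] by (simp add: divide_less_eq)
  then show ?thesis using that d(1) by blast
qed

text \<open>However large the height \<open>A\<close>, a function of oscillation at most
  \<open>A\<close> has small seminorm once its slope is small enough. Small t are covered by t /
  w(t) tending to 0, large t by w tending to infinity, and the range between by w(t) >=
  w(d).\<close>

lemma truncated_linear_le:
  assumes "\<epsilon> > 0"
  obtains \<kappa> where "\<kappa> > 0" "\<And>t. 0 < t \<Longrightarrow> min A (\<kappa> * t) \<le> \<epsilon> * w t"
proof -
  obtain M where M: "\<And>t. t \<ge> M \<Longrightarrow> A / \<epsilon> \<le> w t"
    using lim_infinity unfolding filterlim_at_top eventually_at_top_linorder by blast
  obtain d where d: "d > 0" "\<And>t. 0 < t \<Longrightarrow> t < d \<Longrightarrow> 1 * t \<le> \<epsilon> * w t"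
    using linear_le_small[OF assms] by blast
  \<comment> \<open>The bound 1 serves t < d; the quotient makes the linear function at most
    \<open>\<epsilon> * w d\<close> up to t = |M|.\<close>
  define \<kappa> where "\<kappa> = min 1 (\<epsilon> * w d / (\<bar>M\<bar> + 1))"
  have \<kappa>: "0 < \<kappa>" "\<kappa> \<le> 1" "\<kappa> * (\<bar>M\<bar> + 1) \<le> \<epsilon> * w d"
  proof -
    have "0 < \<epsilon> * w d / (\<bar>M\<bar> + 1)"
      using assms pos[OF d(1)] by simp
    then show "0 < \<kappa>" "\<kappa> \<le> 1" by (simp_all add: \<kappa>_def)
    have "\<kappa> \<le> \<epsilon> * w d / (\<bar>M\<bar> + 1)" by (simp add: \<kappa>_def)
    then show "\<kappa> * (\<bar>M\<bar> + 1) \<le> \<epsilon> * w d" by (simp add: pos_le_divide_eq)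
  qed
  have "min A (\<kappa> * t) \<le> \<epsilon> * w t" if t: "0 < t" for t
  proof -
    consider "t < d" | "d \<le> t" "t \<le> \<bar>M\<bar>" | "M \<le> t" by linarith
    then show ?thesis
    proof cases
      case 1
      have "\<kappa> * t \<le> 1 * t" using \<kappa> t by (intro mult_right_mono) auto
      then show ?thesis using d(2)[OF t 1] by linarith
    next
      case 2
      have "\<kappa> * t \<le> \<kappa> * (\<bar>M\<bar> + 1)" using 2 \<kappa> by (intro mult_left_mono) auto
      also have "\<dots> \<le> \<epsilon> * w d" by (rule \<kappa>)
      also have "\<dots> \<le> \<epsilon> * w t" using 2 d(1) assms by (intro mult_left_mono mono) auto
      finally show ?thesis by linarith
    next
      case 3
      then show ?thesis using M[OF 3] assms by (simp add: divide_le_eq mult.commute min.coboundedI1)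
    qed
  qed
  then show ?thesis using that \<kappa>(1) by blast
qed

lemma lipschitz_VC_small:
  assumes "f \<in> Lip" "f \<in> holder_space w"
  shows "f \<in> VC_small w"
  unfolding VC_small_iff
proof (intro conjI allI impI)
  fix \<epsilon> :: real assume \<epsilon>: "\<epsilon> > 0"
  obtain L where L: "L-lipschitz_on UNIV f" using assms(1) by (auto simp: Lip_def)
  obtain d where d: "d > 0" "\<And>t. 0 < t \<Longrightarrow> t < d \<Longrightarrow> L * t \<le> \<epsilon> * w t"
    using linear_le_small[OF \<epsilon>] by blast
  have "osc_le f \<epsilon> x y" if "x \<noteq> y" "norm (x - y) < d" for x y
    using lipschitz_onD[OF L, of x y] d(2)[of "norm (x - y)"] that by (simp add: osc_le_def dist_norm)
  then show "\<exists>d>0. \<forall>x y. x \<noteq> y \<longrightarrow> norm (x - y) < d \<longrightarrow> osc_le f \<epsilon> x y" using d(1) by blast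
qed (rule assms(2))

lemma bounded_support_VC:
  assumes f: "f \<in> Lip" and "bounded_support f"
  shows "f \<in> VC w"
proof -
  obtain R where R: "\<And>x. norm x \<ge> R \<Longrightarrow> f x = 0"
    using assms(2) by (auto simp: bounded_support_def)
  obtain L where L: "L-lipschitz_on UNIV f" using f by (auto simp: Lip_def)
  have L0: "0 \<le> L" by (rule lipschitz_on_nonneg[OF L])
  define A where "A = 2 * (\<bar>f 0\<bar> + L * \<bar>R\<bar>)"
  have bd: "\<bar>f x\<bar> \<le> A / 2" for x
  proof (cases "norm x \<ge> R")
    case False
    then have "L * norm x \<le> L * \<bar>R\<bar>" using L0 by (intro mult_left_mono) auto
    then show ?thesis using lipschitz_onD[OF L, of x 0] by (simp add: A_def dist_norm)
  qed (use R L0 in \<open>simp add: A_def\<close>)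
  have A: "0 \<le> A" using L0 by (simp add: A_def)
  have diff: "\<bar>f x - f y\<bar> \<le> A" "\<bar>f x - f y\<bar> \<le> L * norm (x - y)" for x y
    using bd[of x] bd[of y] lipschitz_onD[OF L, of x y] by (auto simp: dist_norm)
  have holder: "f \<in> holder_space w"
  proof -
    obtain \<kappa> where \<kappa>: "\<kappa> > 0" "\<And>t. 0 < t \<Longrightarrow> min A (\<kappa> * t) \<le> 1 * w t"
      using truncated_linear_le[of 1 A] by auto
    \<comment> \<open>The factor L / kappa turns slope kappa into slope L, and the factor is kept at
      least 1 so that the bound \<open>A\<close> survives.\<close>
    define C where "C = max 1 (L / \<kappa>)"
    have "osc_le f C x y" if "x \<noteq> y" for x y
    proof -
      let ?t = "norm (x - y)"
      have "L * ?t = (L / \<kappa>) * (\<kappa> * ?t)" using \<kappa>(1) by simp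
      also have "\<dots> \<le> C * (\<kappa> * ?t)"
        using \<kappa>(1) by (intro mult_right_mono) (auto simp: C_def)
      finally have 1: "\<bar>f x - f y\<bar> \<le> C * (\<kappa> * ?t)" using diff(2)[of x y] by linarith
      have "1 * A \<le> C * A" using A by (intro mult_right_mono) (auto simp: C_def)
      with diff(1)[of x y] have 2: "\<bar>f x - f y\<bar> \<le> C * A" by linarith
      have "\<bar>f x - f y\<bar> \<le> C * min A (\<kappa> * ?t)" using 1 2 by (simp add: min_def)
      also have "\<dots> \<le> C * w ?t"
        using \<kappa>(2)[of ?t] that by (intro mult_left_mono) (auto simp: C_def)
      finally show ?thesis by (simp add: osc_le_def)
    qed
    then show ?thesis
      unfolding holder_space_iff by (intro exI[of _ C] conjI osc_boundI) (auto simp: C_def)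
  qed
  have "f \<in> VC_large w"
    unfolding VC_large_iff
  proof (intro conjI allI impI holder)
    fix \<epsilon> :: real assume \<epsilon>: "\<epsilon> > 0"
    obtain M where M: "\<And>t. t \<ge> M \<Longrightarrow> A / \<epsilon> \<le> w t"
      using lim_infinity unfolding filterlim_at_top eventually_at_top_linorder by blast
    have "osc_le f \<epsilon> x y" if "max M 1 \<le> norm (x - y)" for x y
      using M[of "norm (x - y)"] that diff(1)[of x y] \<epsilon>
      by (simp add: osc_le_def divide_le_eq mult.commute)
    then show "\<exists>M>0. \<forall>x y. M \<le> norm (x - y) \<longrightarrow> osc_le f \<epsilon> x y"
      by (intro exI[of _ "max M 1"]) auto
  qed
  moreover have "f \<in> VC_far w"
    unfolding VC_far_iff
  proof (intro conjI allI impI holder)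
    fix \<epsilon> :: real assume \<epsilon>: "\<epsilon> > 0"
    have "osc_le f \<epsilon> x y" if "x \<noteq> y" "max R 1 < norm x" "max R 1 < norm y" for x y
      using R[of x] R[of y] that \<epsilon> pos[of "norm (x - y)"] by (simp add: osc_le_def)
    then show "\<exists>M>0. \<forall>x y. x \<noteq> y \<longrightarrow> M < norm x \<longrightarrow> M < norm y \<longrightarrow> osc_le f \<epsilon> x y"
      by (intro exI[of _ "max R 1"]) auto
  qed
  moreover have "f \<in> VC_small w"
    by (rule lipschitz_VC_small[OF f holder])
  ultimately show ?thesis by (simp add: VC_def)
qed

subsection \<open>Lipschitz approximation by infimal convolution\<close>

text \<open>The segment is cut into equal pieces of length at most delta, each costing
  \<open>m\<close>. Rounding their number up produces the additional \<open>m\<close>.\<close>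

lemma coarse_lipschitz:
  fixes f :: "'a::real_normed_vector \<Rightarrow> real"
  assumes "0 < \<delta>" "0 \<le> m" "\<And>x y. norm (x - y) \<le> \<delta> \<Longrightarrow> \<bar>f x - f y\<bar> \<le> m"
  shows "\<bar>f x - f y\<bar> \<le> m / \<delta> * norm (x - y) + m"
proof -
  have *: "\<bar>f x - f y\<bar> \<le> real n * m" if "norm (x - y) \<le> real n * \<delta>" for n x y
    using that
  proof (induction n arbitrary: x y)
    case (Suc n)
    define z where "z = y + (real n / real (Suc n)) *\<^sub>R (x - y)"
    have "z - y = (real n / real (Suc n)) *\<^sub>R (x - y)" by (simp add: z_def)
    then have "norm (z - y) = real n / real (Suc n) * norm (x - y)" by simp
    also have "\<dots> \<le> real n / real (Suc n) * (real (Suc n) * \<delta>)"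
      using Suc.prems by (intro mult_left_mono) auto
    also have "\<dots> = real n * \<delta>" by simp
    finally have zy: "norm (z - y) \<le> real n * \<delta>" .
    have "x - z = (1 - real n / real (Suc n)) *\<^sub>R (x - y)" by (simp add: z_def algebra_simps)
    also have "1 - real n / real (Suc n) = 1 / real (Suc n)" by (simp add: field_simps)
    finally have "norm (x - z) = norm (x - y) / real (Suc n)" by simp
    also have "\<dots> \<le> \<delta>" using Suc.prems by (simp add: divide_le_eq mult.commute)
    finally have "\<bar>f x - f z\<bar> \<le> m" by (rule assms(3))
    with Suc.IH[OF zy] show ?case by (simp add: distrib_right)
  qed simp
  define n where "n = nat \<lceil>norm (x - y) / \<delta>\<rceil>"
  have n: "norm (x - y) / \<delta> \<le> real n" "real n \<le> norm (x - y) / \<delta> + 1"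
    using assms(1) by (simp_all add: n_def of_nat_ceiling)
  have "\<bar>f x - f y\<bar> \<le> real n * m"
    by (rule *) (use n(1) assms(1) in \<open>simp add: divide_le_eq\<close>)
  also have "\<dots> \<le> (norm (x - y) / \<delta> + 1) * m"
    using n(2) assms(2) by (rule mult_right_mono)
  finally show ?thesis by (simp add: algebra_simps)
qed

text \<open>The cone has exactly the coarse slope m / delta of \<open>f\<close>, so the infimum is
  finite and lies within \<open>m\<close> below \<open>f\<close>. This error is harmless at
  distances above delta. At shorter distances \<open>g\<close> and \<open>f\<close> share the small
  modulus of \<open>f\<close>.\<close>

lemma lipschitz_approximation:
  fixes f :: "'a::real_normed_vector \<Rightarrow> real"
  assumes f: "f \<in> VC_small w" and \<epsilon>: "\<epsilon> > 0"
  obtains g K where "K-lipschitz_on UNIV g"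
    "osc_bound (\<lambda>x. g x - f x) \<epsilon>" "bounded_support f \<Longrightarrow> bounded_support g"
proof -
  obtain d where d: "d > 0" "\<And>x y. x \<noteq> y \<Longrightarrow> norm (x - y) < d \<Longrightarrow> osc_le f (\<epsilon> / 2) x y"
    using f \<epsilon> unfolding VC_small_iff by (meson half_gt_zero)
  define \<delta> where "\<delta> = d / 2"
  define m where "m = \<epsilon> / 2 * w \<delta>"
  define K where "K = m / \<delta>"
  have \<delta>: "\<delta> > 0" "\<delta> < d" using d(1) by (simp_all add: \<delta>_def)
  have m: "m > 0" using \<epsilon> pos[OF \<delta>(1)] by (simp add: m_def)
  have K: "K > 0" using m \<delta> by (simp add: K_def)
  have near: "\<bar>f x - f y\<bar> \<le> m" if "norm (x - y) \<le> \<delta>" for x y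
  proof (cases "x = y")
    case False
    then have "\<bar>f x - f y\<bar> \<le> \<epsilon> / 2 * w (norm (x - y))"
      using d(2)[OF False] that \<delta> by (simp add: osc_le_def)
    also have "\<dots> \<le> m"
      unfolding m_def using that False \<epsilon> by (intro mult_left_mono mono) auto
    finally show ?thesis .
  qed (use m in simp)
  have coarse: "\<bar>f x - f y\<bar> \<le> K * norm (x - y) + m" for x y
    unfolding K_def by (rule coarse_lipschitz[OF \<delta>(1) less_imp_le[OF m] near])
  define g where "g x = (INF y. f y + K * norm (x - y))" for x
  have lower: "f x - m \<le> f y + K * norm (x - y)" for x y
    using coarse[of x y] by linarith
  have bdd: "bdd_below (range (\<lambda>y. f y + K * norm (x - y)))" for x
    by (rule bdd_belowI[of _ "f x - m"]) (use lower in auto)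
  have g_le: "g x \<le> f y + K * norm (x - y)" for x y
    unfolding g_def by (rule cINF_lower[OF bdd]) simp
  have g_ge: "c \<le> g x" if "\<And>y. c \<le> f y + K * norm (x - y)" for c x
    unfolding g_def by (rule cINF_greatest) (use that in auto)
  have g_f: "f x - m \<le> g x" "g x \<le> f x" for x
    using g_ge[of "f x - m" x] lower g_le[of x x] by auto
  have lip: "K-lipschitz_on UNIV g"
  proof (rule lipschitz_onI)
    have le: "g x - K * norm (x - y) \<le> g y" for x y
    proof (rule g_ge)
      fix z
      have "norm (x - z) \<le> norm (x - y) + norm (y - z)"
        using norm_triangle_ineq[of "x - y" "y - z"] by simp
      then have "K * norm (x - z) \<le> K * (norm (x - y) + norm (y - z))"
        using K by (intro mult_left_mono) auto
      then show "g x - K * norm (x - y) \<le> f z + K * norm (y - z)"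
        using g_le[of x z] by (simp add: distrib_left)
    qed
    show "dist (g x) (g y) \<le> K * dist x y" for x y
      using le[of x y] le[of y x] by (simp add: dist_norm norm_minus_commute[of y x] abs_le_iff)
  qed (use K in simp)
  \<comment> \<open>Infimal convolution commutes with translations: a competitor z for y gives the
    competitor z + (x - y) for x at the same distance.\<close>
  have shift: "\<bar>g x - g y\<bar> \<le> c" if c: "\<And>u v. u - v = x - y \<Longrightarrow> \<bar>f u - f v\<bar> \<le> c" for x y c
  proof -
    have "g x - c \<le> g y" if c: "\<And>u v. u - v = x - y \<Longrightarrow> \<bar>f u - f v\<bar> \<le> c" for x y
    proof (rule g_ge)
      fix z
      have "\<bar>f (z + (x - y)) - f z\<bar> \<le> c" by (rule c) simp
      moreover have "x - (z + (x - y)) = y - z" by simp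
      ultimately show "g x - c \<le> f z + K * norm (y - z)"
        using g_le[of x "z + (x - y)"] by simp
    qed
    from this[of x y] this[of y x] show ?thesis
      using c by (smt (verit, best) minus_diff_eq)
  qed
  have "osc_le (\<lambda>x. g x - f x) \<epsilon> x y" if xy: "x \<noteq> y" for x y
  proof (cases "norm (x - y) \<le> \<delta>")
    case True
    have fuv: "\<bar>f u - f v\<bar> \<le> \<epsilon> / 2 * w (norm (x - y))" if "u - v = x - y" for u v
    proof -
      have "u \<noteq> v" "norm (u - v) < d" using that xy True \<delta> by auto
      from d(2)[OF this] show ?thesis by (simp add: osc_le_def that)
    qed
    show ?thesis
      using osc_le_diff[of g "\<epsilon> / 2" x y f "\<epsilon> / 2"] shift[of x y, OF fuv] fuv[of x y]
      by (simp add: osc_le_def)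
  next
    case False
    then have "m \<le> \<epsilon> / 2 * w (norm (x - y))"
      unfolding m_def using \<delta> \<epsilon> by (intro mult_left_mono mono) auto
    also have "\<dots> \<le> \<epsilon> * w (norm (x - y))"
      using \<epsilon> pos[of "norm (x - y)"] xy by simp
    finally have "m \<le> \<epsilon> * w (norm (x - y))" .
    \<comment> \<open>Both values of g - f lie in [-m, 0], so they differ by at most
      \<open>m\<close>.\<close>
    then show ?thesis
      unfolding osc_le_def using g_f[of x] g_f[of y] by linarith
  qed
  then have "osc_bound (\<lambda>x. g x - f x) \<epsilon>" by (rule osc_boundI)
  moreover have "bounded_support g" if "bounded_support f"
  proof -
    from \<open>bounded_support f\<close> obtain R where R: "\<And>x. norm x \<ge> R \<Longrightarrow> f x = 0"
      by (auto simp: bounded_support_def)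
    \<comment> \<open>\<open>f\<close> is bounded below by -S, so beyond distance S / K from the
      ball of radius |R| the cone outweighs any negative value of \<open>f\<close>.\<close>
    define S where "S = \<bar>f 0\<bar> + K * \<bar>R\<bar> + m"
    have S: "S \<ge> 0" using K m by (simp add: S_def)
    have "g x = 0" if x: "norm x \<ge> \<bar>R\<bar> + S / K" for x
    proof (rule antisym)
      have "0 \<le> S / K" using S K by simp
      then have "norm x \<ge> R" using x by linarith
      then show "g x \<le> 0" using g_f(2)[of x] R by simp
      show "0 \<le> g x"
      proof (rule g_ge)
        fix y
        show "0 \<le> f y + K * norm (x - y)"
        proof (cases "norm y \<ge> R")
          case False
          then have "K * norm y \<le> K * \<bar>R\<bar>" using K by (intro mult_left_mono) auto
          then have fy: "- S \<le> f y" using coarse[of y 0] by (simp add: S_def)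
          have "S / K \<le> norm (x - y)"
            using x False norm_triangle_ineq2[of x y] by linarith
          then have "S \<le> K * norm (x - y)" using K by (simp add: divide_le_eq mult.commute)
          with fy show ?thesis by simp
        qed (use R K in simp)
      qed
    qed
    then show ?thesis unfolding bounded_support_def by blast
  qed
  ultimately show ?thesis using that lip by blast
qed

subsection \<open>Truncation to bounded support\<close>

text \<open>
  Instead of multiplying by a cutoff function, \<open>f\<close> is clamped between \<open>- c\<close> and \<open>c\<close> for a slowly
  decreasing cone \<open>c\<close>: lattice operations do not increase the oscillation.
\<close>

lemma bounded_support_approximation:
  fixes f :: "'a::real_normed_vector \<Rightarrow> real"
  assumes f: "f \<in> VC w" and \<epsilon>: "\<epsilon> > 0"
  obtains g where "g \<in> VC_small w" "bounded_support g" "osc_bound (\<lambda>x. g x - f x) \<epsilon>"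
proof -
  have f_small: "f \<in> VC_small w" and f_large: "f \<in> VC_large w" and f_far: "f \<in> VC_far w"
    using f by (auto simp: VC_def)
  obtain C where C: "C \<ge> 0" "osc_bound f C"
    using f_small unfolding VC_small_iff holder_space_iff by blast
  obtain M1 where M1: "M1 > 0" "\<And>x y. M1 \<le> norm (x - y) \<Longrightarrow> osc_le f (\<epsilon> / 2) x y"
    using f_large \<epsilon> unfolding VC_large_iff by (meson half_gt_zero)
  obtain M2 where M2: "M2 > 0"
    "\<And>x y. x \<noteq> y \<Longrightarrow> M2 < norm x \<Longrightarrow> M2 < norm y \<Longrightarrow> osc_le f (\<epsilon> / 2) x y"
    using f_far \<epsilon> unfolding VC_far_iff by (meson half_gt_zero)
  define M where "M = max M1 M2"
  have M: "M > 0" using M1 M2 by (simp add: M_def)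
  define S where "S r = \<bar>f 0\<bar> + C * w r" for r
  have S: "\<bar>f x\<bar> \<le> S r" if "norm x \<le> r" "0 < r" for x r
  proof (cases "x = 0")
    case True
    then show ?thesis using C(1) pos[OF that(2)] by (simp add: S_def)
  next
    case False
    have "C * w (norm x) \<le> C * w r" using C(1) False that by (intro mult_left_mono mono) auto
    then show ?thesis using osc_boundD[OF C(2) False] by (simp add: S_def osc_le_def)
  qed
  \<comment> \<open>\<open>D\<close> is chosen such that the size of \<open>f\<close> on the ball of
    radius \<open>M\<close> is negligible against \<open>w\<close> at distance
    \<open>D\<close>.\<close>
  obtain D0 where D0: "\<And>t. t \<ge> D0 \<Longrightarrow> S M / (\<epsilon> / 2) \<le> w t"
    using lim_infinity unfolding filterlim_at_top eventually_at_top_linorder by blast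
  define D where "D = max D0 M"
  have D: "D \<ge> M" "S M \<le> \<epsilon> / 2 * w D"
    using D0[of D] \<epsilon> by (auto simp: D_def divide_le_eq mult.commute)
  \<comment> \<open>The extra 1 is what the cone is allowed to lose up to radius M + D, so that
    clamping is inactive on that ball.\<close>
  define A where "A = S (M + D) + 1"
  have A: "A \<ge> 1" using C(1) pos[of "M + D"] M D by (simp add: A_def S_def)
  obtain \<kappa>0 where \<kappa>0: "\<kappa>0 > 0" "\<And>t. 0 < t \<Longrightarrow> min A (\<kappa>0 * t) \<le> \<epsilon> / 2 * w t"
    using truncated_linear_le[of "\<epsilon> / 2" A] \<epsilon> by auto
  \<comment> \<open>The first bound keeps the oscillation of the cone small at all distances; the
    second limits its descent up to radius M + D to 1.\<close>
  define \<kappa> where "\<kappa> = min \<kappa>0 (1 / (M + D))"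
  have \<kappa>: "\<kappa> > 0" "\<kappa> \<le> \<kappa>0" "\<kappa> * (M + D) \<le> 1"
  proof -
    show "\<kappa> > 0" "\<kappa> \<le> \<kappa>0" using \<kappa>0 M D by (auto simp: \<kappa>_def)
    have "\<kappa> \<le> 1 / (M + D)" by (simp add: \<kappa>_def)
    then show "\<kappa> * (M + D) \<le> 1" using M D by (simp add: pos_le_divide_eq)
  qed
  define c where "c x = max 0 (A - \<kappa> * norm x)" for x :: 'a
  define g where "g x = max (- c x) (min (f x) (c x))" for x
  have c0: "c x \<ge> 0" for x by (simp add: c_def)
  have c_diff: "\<bar>c x - c y\<bar> \<le> A" "\<bar>c x - c y\<bar> \<le> \<kappa> * norm (x - y)" for x y
  proof -
    have "0 \<le> \<kappa> * norm x" "0 \<le> \<kappa> * norm y" using \<kappa>(1) by auto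
    then show "\<bar>c x - c y\<bar> \<le> A" using A by (auto simp: c_def)
    have "\<bar>\<kappa> * norm x - \<kappa> * norm y\<bar> \<le> \<kappa> * norm (x - y)"
      using \<kappa>(1) norm_triangle_ineq3[of x y]
      by (simp add: abs_mult flip: right_diff_distrib)
    then show "\<bar>c x - c y\<bar> \<le> \<kappa> * norm (x - y)" by (auto simp: c_def max_def)
  qed
  have c_osc: "osc_le c (\<epsilon> / 2) x y" if "x \<noteq> y" for x y
  proof -
    let ?t = "norm (x - y)"
    have "\<kappa> * ?t \<le> \<kappa>0 * ?t" using \<kappa>(2) by (intro mult_right_mono) auto
    then have "\<bar>c x - c y\<bar> \<le> min A (\<kappa>0 * ?t)" using c_diff[of x y] by simp
    also have "\<dots> \<le> \<epsilon> / 2 * w ?t" using that by (intro \<kappa>0) simp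
    finally show ?thesis by (simp add: osc_le_def)
  qed
  have g_osc: "osc_le g a x y" if "osc_le f a x y" "osc_le c a x y" for a x y
    using that unfolding osc_le_def g_def by (intro clamp_diff_le c0)
  have inner: "g x = f x" if "norm x \<le> M + D" for x
  proof -
    have "\<kappa> * norm x \<le> \<kappa> * (M + D)" using \<kappa>(1) that by (intro mult_left_mono) auto
    then have "S (M + D) \<le> c x" using \<kappa>(3) by (simp add: c_def A_def)
    moreover have "\<bar>f x\<bar> \<le> S (M + D)" using S[OF that] M D by simp
    ultimately show ?thesis by (auto simp: g_def)
  qed
  have g_f: "\<bar>g x - f x\<bar> \<le> \<bar>f x\<bar>" for x
    using c0[of x] by (auto simp: g_def)
  have osc: "osc_le (\<lambda>x. g x - f x) \<epsilon> x y" if xy: "x \<noteq> y" for x y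
  proof -
    have w0: "0 < w (norm (x - y))" using xy by (intro pos) simp
    \<comment> \<open>Clamping can only change \<open>f\<close> at \<open>v\<close> if
      \<open>u\<close> and \<open>v\<close> are at least \<open>D\<close> apart. The change is at
      most |f v| <= |f u| + |f u - f v|; the choice of \<open>D\<close> controls the first term and
      large-scale vanishing the second.\<close>
    have cross: "\<bar>g v - f v\<bar> \<le> \<epsilon> * w (norm (u - v))" if u: "norm u \<le> M" and uv: "u \<noteq> v" for u v
    proof (cases "norm v \<le> M + D")
      case True
      then show ?thesis using inner \<epsilon> pos[of "norm (u - v)"] uv by simp
    next
      case False
      then have t: "D \<le> norm (u - v)"
        using u norm_triangle_ineq2[of v u] by (simp add: norm_minus_commute)
      have "M1 \<le> norm (u - v)" using t D(1) by (simp add: M_def)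
      then have "\<bar>f u - f v\<bar> \<le> \<epsilon> / 2 * w (norm (u - v))" using M1(2)[of u v] by (simp add: osc_le_def)
      moreover have "\<bar>f u\<bar> \<le> \<epsilon> / 2 * w D" using S[OF u M] D(2) by linarith
      moreover have "\<epsilon> / 2 * w D \<le> \<epsilon> / 2 * w (norm (u - v))"
        using t M D(1) \<epsilon> by (intro mult_left_mono mono) auto
      moreover have "\<epsilon> * w (norm (u - v)) = \<epsilon> / 2 * w (norm (u - v)) + \<epsilon> / 2 * w (norm (u - v))"
        by simp
      ultimately show ?thesis using g_f[of v] by linarith
    qed
    consider "norm x \<le> M" | "norm y \<le> M" | "norm x > M" "norm y > M" by linarith
    then show ?thesis
    proof cases
      case 1
      then have "g x = f x" using D M by (intro inner) auto
      then show ?thesis using cross[OF 1 xy] by (simp add: osc_le_def abs_minus_commute)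
    next
      case 2
      then have "g y = f y" using D M by (intro inner) auto
      then show ?thesis using cross[OF 2 xy[symmetric]] by (simp add: osc_le_def norm_minus_commute)
    next
      case 3
      \<comment> \<open>With both points far out, \<open>f\<close> and the cone each have
        oscillation at most eps/2; clamping preserves this bound, and subtracting \<open>f\<close>
        adds another eps/2.\<close>
      then have *: "osc_le f (\<epsilon> / 2) x y" using M2(2)[OF xy] by (simp add: M_def)
      from osc_le_diff[OF g_osc[OF this c_osc[OF xy]] *] show ?thesis by simp
    qed
  qed
  have "g \<in> VC_small w"
    unfolding VC_small_iff holder_space_iff
  proof (intro conjI allI impI)
    have "osc_le g (max C (\<epsilon> / 2)) x y" if xy: "x \<noteq> y" for x y
    proof (rule g_osc)
      have le: "osc_le h a x y" if "osc_le h b x y" "b \<le> a" for h :: "'a \<Rightarrow> real" and a b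
      proof -
        have "b * w (norm (x - y)) \<le> a * w (norm (x - y))"
          using that(2) pos[of "norm (x - y)"] xy by (intro mult_right_mono) auto
        then show ?thesis using that(1) unfolding osc_le_def by linarith
      qed
      show "osc_le f (max C (\<epsilon> / 2)) x y" by (rule le[OF osc_boundD[OF C(2) xy]]) simp
      show "osc_le c (max C (\<epsilon> / 2)) x y" by (rule le[OF c_osc[OF xy]]) simp
    qed
    then show "\<exists>C\<ge>0. osc_bound g C"
      using C(1) by (intro exI[of _ "max C (\<epsilon> / 2)"] conjI osc_boundI) auto
    fix a :: real assume a: "a > 0"
    obtain d1 where d1: "d1 > 0" "\<And>x y. x \<noteq> y \<Longrightarrow> norm (x - y) < d1 \<Longrightarrow> osc_le f a x y"
      using f_small a unfolding VC_small_iff by blast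
    obtain d2 where d2: "d2 > 0" "\<And>t. 0 < t \<Longrightarrow> t < d2 \<Longrightarrow> \<kappa> * t \<le> a * w t"
      using linear_le_small[OF a] by blast
    have "osc_le g a x y" if "x \<noteq> y" "norm (x - y) < min d1 d2" for x y
    proof (rule g_osc)
      show "osc_le f a x y" using d1(2) that by simp
      show "osc_le c a x y"
        using d2(2)[of "norm (x - y)"] c_diff(2)[of x y] that by (simp add: osc_le_def)
    qed
    then show "\<exists>d>0. \<forall>x y. x \<noteq> y \<longrightarrow> norm (x - y) < d \<longrightarrow> osc_le g a x y"
      using d1 d2 by (intro exI[of _ "min d1 d2"]) auto
  qed
  moreover have "g x = 0" if "norm x \<ge> A / \<kappa>" for x
    using that \<kappa>(1) by (simp add: g_def c_def divide_le_eq mult.commute)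
  then have "bounded_support g" unfolding bounded_support_def by blast
  ultimately show ?thesis using that osc_boundI[OF osc] by blast
qed

text \<open>The order of choices is essential: first \<open>h\<close> with its constant
  \<open>L\<close>, then the scale \<open>d\<close> for the slope of g - h, and only then eta in
  terms of \<open>d\<close>.\<close>

lemma smooth_lipschitz_approximation:
  fixes f :: "'a::real_inner \<Rightarrow> real"
  assumes "separable_space (euclidean :: 'a topology)" and f: "f \<in> VC_small w" and \<epsilon>: "\<epsilon> > 0"
  obtains g where "g \<in> smooth" "g \<in> Lip" "osc_bound (\<lambda>x. g x - f x) \<epsilon>"
    "bounded_support f \<Longrightarrow> bounded_support g"
proof -
  obtain e :: "nat \<Rightarrow> 'a" where e: "closure (range e) = UNIV"
    using separable_dense_sequence[OF assms(1)] by blast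
  have \<epsilon>2: "\<epsilon> / 2 > 0" using \<epsilon> by simp
  obtain h L where h: "L-lipschitz_on UNIV h" "osc_bound (\<lambda>x. h x - f x) (\<epsilon> / 2)"
    "bounded_support f \<Longrightarrow> bounded_support h"
    using lipschitz_approximation[OF f \<epsilon>2] by blast
  have L: "0 \<le> L" by (rule lipschitz_on_nonneg[OF h(1)])
  let ?K = "(5 + 4 * cutoff_lip) * L"
  obtain d where d: "d > 0" "\<And>t. 0 < t \<Longrightarrow> t < d \<Longrightarrow> (?K + L) * t \<le> \<epsilon> / 2 * w t"
    using linear_le_small[OF \<epsilon>2] by blast
  \<comment> \<open>The uniform error 3 L eta enters at two points; the summand 1 keeps the
    denominator positive when L = 0.\<close>
  define \<eta> where "\<eta> = \<epsilon> / 2 * w d / (6 * L + 1)"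
  have \<eta>: "\<eta> > 0" "6 * L * \<eta> \<le> \<epsilon> / 2 * w d"
  proof -
    show pos: "\<eta> > 0" using \<epsilon> L pos[OF d(1)] by (simp add: \<eta>_def)
    have ne: "6 * L + 1 \<noteq> 0" using L by simp
    have "(6 * L + 1) * \<eta> = \<epsilon> / 2 * w d"
      unfolding \<eta>_def times_divide_eq_right[of "6 * L + 1"]
      by (rule nonzero_mult_div_cancel_left[OF ne])
    then show "6 * L * \<eta> \<le> \<epsilon> / 2 * w d" using pos by (simp add: distrib_right)
  qed
  interpret exhausting_sequence "gram_schmidt e" \<eta>
    by (rule exhausting_gram_schmidt[OF e \<eta>(1)])
  obtain g where g: "g \<in> smooth" "?K-lipschitz_on UNIV g" "\<And>x. \<bar>g x - h x\<bar> \<le> 3 * L * \<eta>"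
    "\<And>R x. (\<And>x. norm x \<ge> R \<Longrightarrow> h x = 0) \<Longrightarrow> norm x \<ge> R + 3 * \<eta> \<Longrightarrow> g x = 0"
    using smooth_approximation[OF h(1)] by blast
  have gh: "osc_le (\<lambda>x. g x - h x) (\<epsilon> / 2) x y" if xy: "x \<noteq> y" for x y
  proof (cases "norm (x - y) < d")
    case True
    have "\<bar>(g x - h x) - (g y - h y)\<bar> \<le> (?K + L) * norm (x - y)"
      using lipschitz_onD[OF g(2), of x y] lipschitz_onD[OF h(1), of x y]
      by (simp add: dist_norm distrib_right)
    also have "\<dots> \<le> \<epsilon> / 2 * w (norm (x - y))" using True xy by (intro d) auto
    finally show ?thesis by (simp add: osc_le_def)
  next
    case False
    have "\<bar>(g x - h x) - (g y - h y)\<bar> \<le> 6 * L * \<eta>" using g(3)[of x] g(3)[of y] by linarith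
    also have "\<dots> \<le> \<epsilon> / 2 * w d" by (rule \<eta>)
    also have "\<dots> \<le> \<epsilon> / 2 * w (norm (x - y))" using False d(1) \<epsilon> by (intro mult_left_mono mono) auto
    finally show ?thesis by (simp add: osc_le_def)
  qed
  have "osc_bound (\<lambda>x. g x - f x) \<epsilon>"
    using osc_bound_add[OF osc_boundI[OF gh] h(2)] by simp
  moreover have "bounded_support g" if "bounded_support f"
    using h(3)[OF that] g(4) unfolding bounded_support_def by blast
  moreover have "g \<in> Lip" using g(2) by (auto simp: Lip_def)
  ultimately show ?thesis using that g(1) by blast
qed

end

theorem corollary3p7:
  fixes \<omega> :: "real \<Rightarrow> real" and C_db :: real
  assumes separable: "separable_space (euclidean :: 'a::{real_inner, complete_space} topology)"
    and pos: "\<And>t. t > 0 \<Longrightarrow> \<omega> t > 0"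
    and nondecreasing: "mono_on {0<..} \<omega>"
    and lim_zero: "(\<omega> \<longlongrightarrow> 0) (at_right 0)"
    and lim_infinity: "filterlim \<omega> at_top at_top"
    and lim_ratio: "((\<lambda>t. t / \<omega> t) \<longlongrightarrow> 0) (at_right 0)"
    and doubling_const: "C_db > 1"
    and doubling: "\<And>t. t > 0 \<Longrightarrow> \<omega> (2 * t) \<le> C_db * \<omega> t"
  shows "holder_closure \<omega> (smooth \<inter> Lip \<inter> holder_space \<omega>) = (VC_small \<omega> :: ('a \<Rightarrow> real) set) \<and>
    holder_closure \<omega> (smooth_bs \<inter> Lip) = (VC \<omega> :: ('a \<Rightarrow> real) set)"
proof -
  interpret modulus \<omega>
    by unfold_locales (fact pos nondecreasing lim_infinity lim_ratio)+
  have bs_iff: "f \<in> smooth_bs \<longleftrightarrow> f \<in> smooth \<and> bounded_support f" for f :: "'a \<Rightarrow> real"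
  proof -
    have "(\<exists>R>0. \<forall>x. x \<notin> ball 0 R \<longrightarrow> f x = 0) \<longleftrightarrow> bounded_support f"
      unfolding bounded_support_def
    proof
      assume "\<exists>R. \<forall>x. norm x \<ge> R \<longrightarrow> f x = 0"
      then obtain R where "\<forall>x. norm x \<ge> R \<longrightarrow> f x = 0" by blast
      then show "\<exists>R>0. \<forall>x. x \<notin> ball 0 R \<longrightarrow> f x = 0"
        by (intro exI[of _ "max R 1"]) simp
    qed (auto simp: not_less)
    then show ?thesis by (simp add: smooth_bs_def)
  qed
  show ?thesis
  proof (intro conjI equalityI)
    show "holder_closure \<omega> (smooth \<inter> Lip \<inter> holder_space \<omega>) \<subseteq> (VC_small \<omega> :: ('a \<Rightarrow> real) set)"
      by (rule holder_closure_subset_VC_small) (auto intro: lipschitz_VC_small)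
    show "VC_small \<omega> \<subseteq> holder_closure \<omega> (smooth \<inter> Lip \<inter> holder_space \<omega> :: ('a \<Rightarrow> real) set)"
    proof
      fix f :: "'a \<Rightarrow> real" assume f: "f \<in> VC_small \<omega>"
      then obtain C where C: "C \<ge> 0" "osc_bound f C"
        unfolding VC_small_iff holder_space_iff by blast
      have "\<exists>g\<in>smooth \<inter> Lip \<inter> holder_space \<omega>. osc_bound (\<lambda>x. g x - f x) \<epsilon>"
        if \<epsilon>: "\<epsilon> > 0" for \<epsilon>
      proof -
        obtain g where g: "g \<in> smooth" "g \<in> Lip" "osc_bound (\<lambda>x. g x - f x) \<epsilon>"
          using smooth_lipschitz_approximation[OF separable f \<epsilon>] by blast
        have "osc_bound g (\<epsilon> + C)"
          using osc_bound_add[OF g(3) C(2)] by simp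
        then have "g \<in> holder_space \<omega>"
          unfolding holder_space_iff using C(1) \<epsilon> by (intro exI[of _ "\<epsilon> + C"]) auto
        then show ?thesis using g by blast
      qed
      moreover have "f \<in> holder_space \<omega>"
        using f by (simp add: VC_small_def)
      ultimately show "f \<in> holder_closure \<omega> (smooth \<inter> Lip \<inter> holder_space \<omega>)"
        unfolding holder_closure_iff by simp
    qed
    have "smooth_bs \<inter> Lip \<subseteq> (VC \<omega> :: ('a \<Rightarrow> real) set)"
      using bounded_support_VC bs_iff by blast
    then show "holder_closure \<omega> (smooth_bs \<inter> Lip) \<subseteq> (VC \<omega> :: ('a \<Rightarrow> real) set)"
      unfolding VC_def
      by (intro Int_greatest holder_closure_subset_VC_small holder_closure_subset_VC_large
          holder_closure_subset_VC_far) blast+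
    show "VC \<omega> \<subseteq> holder_closure \<omega> (smooth_bs \<inter> Lip :: ('a \<Rightarrow> real) set)"
    proof
      fix f :: "'a \<Rightarrow> real" assume f: "f \<in> VC \<omega>"
      have "\<exists>g\<in>smooth_bs \<inter> Lip. osc_bound (\<lambda>x. g x - f x) \<epsilon>"
        if "\<epsilon> > 0" for \<epsilon>
      proof -
        \<comment> \<open>Truncating to bounded support and smoothing each receive half of the
          error.\<close>
        have \<epsilon>2: "\<epsilon> / 2 > 0" using that by simp
        obtain h where h: "h \<in> VC_small \<omega>" "bounded_support h" "osc_bound (\<lambda>x. h x - f x) (\<epsilon> / 2)"
          using bounded_support_approximation[OF f \<epsilon>2] by blast
        obtain g where g: "g \<in> smooth" "g \<in> Lip" "osc_bound (\<lambda>x. g x - h x) (\<epsilon> / 2)"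
          "bounded_support h \<Longrightarrow> bounded_support g"
          using smooth_lipschitz_approximation[OF separable h(1) \<epsilon>2] by blast
        have "g \<in> smooth_bs"
          using g(1) g(4)[OF h(2)] by (simp add: bs_iff)
        moreover have "osc_bound (\<lambda>x. g x - f x) \<epsilon>"
          using osc_bound_add[OF g(3) h(3)] by simp
        ultimately show ?thesis using g(2) by blast
      qed
      moreover have "f \<in> holder_space \<omega>"
        using f by (simp add: VC_def VC_small_def)
      ultimately show "f \<in> holder_closure \<omega> (smooth_bs \<inter> Lip)"
        unfolding holder_closure_iff by simp
    qed
  qed
qed

end
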